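(* Let $\Omega \subset \mathbb{R}^n$ be a bounded domain with $C^1$-boundary, let $k \geq 1$ be an integer, let $f \in C^k(\Omega) \cap L^{\infty}(\Omega)$, let $x_0 \in \Omega$ and let $\nu \in \mathbb{S}^{n-1}$. For $t > 0$ let $e^{t\Delta} f$ denote the solution at time $t$ of the heat equation in $\Omega$ with initial datum $f$ and Dirichlet boundary conditions $u(t,x) = g(x)$ for $x \in \partial\Omega$ (with $g$ a function on $\partial \Omega$ not depending on time). Then, for all $t>0$, the quantity $$X = \left| \frac{\partial^k }{\partial \nu^k} e^{t\Delta} f(x_0) - \int_{\Omega} p_t(x_0, y) \frac{\partial^k }{\partial \nu^k} f(y)\, dy \right|$$ satisfies $$X \leq \left(1 - \int_{\Omega}p_t(x_0, y)\, dy \right) \max_{0 \leq s \leq t} \left\| \frac{\partial^k }{\partial \nu^k} e^{s\Delta} f \right\|_{L^{\infty}(\partial \Omega)}.$$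
   Context: The function $u(t,x) = (e^{t\Delta} f)(x)$ denotes the solution of $\partial_t u = \Delta u$ in $\Omega$ for $t>0$ with $u(0,x) = f(x)$ for $x \in \Omega$ and $u(t,x) = g(x)$ for $x \in \partial\Omega$; in particular $e^{0\Delta} f = f$. The function $p_t(\cdot,\cdot)$ is the Dirichlet heat kernel of $\Omega$, i.e. the fundamental solution of $\partial_t - \Delta$ in $\Omega$ with zero boundary values, so that $w(t,x) = \int_\Omega p_t(x,y) h(y)\,dy$ solves $\partial_t w = \Delta w$ in $\Omega$ with $w(0,\cdot)=h$ and $w = 0$ on $\partial\Omega$. For a unit vector $\nu \in \mathbb{S}^{n-1}$, the operator $\partial^k/\partial\nu^k$ is the $k$-th order directional derivative in the fixed direction $\nu$ (with respect to the spatial variable). The norm $\| \frac{\partial^k}{\partial\nu^k} e^{s\Delta} f\|_{L^\infty(\partial\Omega)}$ is the supremum over $y \in \partial\Omega$ of the absolute value of the $k$-th directional derivative of $e^{s\Delta}f$ at $y$, where the derivative at a boundary point is taken from inside the domain.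
   Formalization: Added assumption: the k-th derivative of e^{sΔ}f in direction ν is bounded on [0,t]×Ω; without it the claim is false (Ω=(0,1), f=1, g=0, k=2: the right side is 0 but X>0). *)

theory Defs
  imports "HOL-Analysis.Analysis"
begin

text \<open>Euclidean space is an arbitrary type of class \<open>euclidean_space\<close>. All derivatives
  below are taken at points of an open set, so they do not depend on values outside that set.\<close>

definition dir_deriv :: "'a::euclidean_space \<Rightarrow> ('a \<Rightarrow> real) \<Rightarrow> 'a \<Rightarrow> real" where
  "dir_deriv \<nu> h x = deriv (\<lambda>r. h (x + r *\<^sub>R \<nu>)) 0"

definition dir_deriv_iter :: "nat \<Rightarrow> 'a::euclidean_space \<Rightarrow> ('a \<Rightarrow> real) \<Rightarrow> 'a \<Rightarrow> real" where
  "dir_deriv_iter k \<nu> h = (dir_deriv \<nu> ^^ k) h"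

definition laplacian :: "('a::euclidean_space \<Rightarrow> real) \<Rightarrow> 'a \<Rightarrow> real" where
  "laplacian h x = (\<Sum>b\<in>Basis. dir_deriv_iter 2 b h x)"

primrec Ck_on :: "nat \<Rightarrow> 'a::euclidean_space set \<Rightarrow> ('a \<Rightarrow> real) \<Rightarrow> bool" where
  "Ck_on 0 S h \<longleftrightarrow> continuous_on S h"
| "Ck_on (Suc k) S h \<longleftrightarrow>
     (\<forall>x\<in>S. h differentiable (at x)) \<and>
     (\<forall>v. Ck_on k S (\<lambda>x. frechet_derivative h (at x) v))"

text \<open>Near each boundary point the set lies on one side of the graph of a \<open>C\<^sup>1\<close>
  function \<open>\<gamma>\<close> over the hyperplane orthogonal to a unit vector \<open>e\<close>; the argument
  \<open>x - (x \<bullet> e) *\<^sub>R e\<close> is the orthogonal projection of \<open>x\<close> to that hyperplane, so only the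
  values of \<open>\<gamma>\<close> on the hyperplane matter.\<close>

definition C1_boundary :: "'a::euclidean_space set \<Rightarrow> bool" where
  "C1_boundary \<Omega> \<longleftrightarrow>
     (\<forall>z\<in>frontier \<Omega>. \<exists>r>0. \<exists>e \<gamma>. norm e = 1 \<and> Ck_on 1 UNIV \<gamma> \<and>
        \<Omega> \<inter> ball z r = {x \<in> ball z r. x \<bullet> e > \<gamma> (x - (x \<bullet> e) *\<^sub>R e)})"

definition bounded_C1_domain :: "'a::euclidean_space set \<Rightarrow> bool" where
  "bounded_C1_domain \<Omega> \<longleftrightarrow>
     open \<Omega> \<and> connected \<Omega> \<and> \<Omega> \<noteq> {} \<and> bounded \<Omega> \<and> C1_boundary \<Omega>"

text \<open>\<open>u\<close> is a classical solution (once continuously differentiable in time and twice in space)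
  of the heat equation on the open cylinder. Continuity of the time derivative is a consequence
  of the equation.\<close>

definition solves_heat :: "'a::euclidean_space set \<Rightarrow> (real \<Rightarrow> 'a \<Rightarrow> real) \<Rightarrow> bool" where
  "solves_heat \<Omega> u \<longleftrightarrow>
     (\<forall>t>0. Ck_on 2 \<Omega> (u t)) \<and>
     continuous_on ({0<..} \<times> \<Omega>) (\<lambda>(t, x). u t x) \<and>
     (\<forall>b\<in>Basis. continuous_on ({0<..} \<times> \<Omega>) (\<lambda>(t, x). dir_deriv b (u t) x)) \<and>
     (\<forall>b\<in>Basis. \<forall>c\<in>Basis.
        continuous_on ({0<..} \<times> \<Omega>) (\<lambda>(t, x). dir_deriv b (dir_deriv c (u t)) x)) \<and>
     (\<forall>t>0. \<forall>x\<in>\<Omega>. ((\<lambda>s. u s x) has_real_derivative laplacian (u t) x) (at t))"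

text \<open>The solution \<open>u t = e\<^sup>t\<^sup>\<Delta> f\<close> with boundary values \<open>g\<close>. Initial and boundary
  values are attained continuously except at the corner \<open>{0} \<times> \<partial>\<Omega>\<close>, where \<open>f\<close>
  (given only in \<open>\<Omega>\<close>) and \<open>g\<close> need not be compatible. Boundedness singles out the solution:
  without it, singularities at the corner would destroy uniqueness.\<close>

definition dirichlet_heat_solution ::
  "'a::euclidean_space set \<Rightarrow> ('a \<Rightarrow> real) \<Rightarrow> ('a \<Rightarrow> real) \<Rightarrow> (real \<Rightarrow> 'a \<Rightarrow> real) \<Rightarrow> bool" where
  "dirichlet_heat_solution \<Omega> f g u \<longleftrightarrow>
     solves_heat \<Omega> u \<and>
     (\<forall>x\<in>\<Omega>. u 0 x = f x) \<and>
     (\<forall>t>0. \<forall>x\<in>frontier \<Omega>. u t x = g x) \<and>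
     continuous_on ({0..} \<times> closure \<Omega> - {0} \<times> frontier \<Omega>) (\<lambda>(t, x). u t x) \<and>
     (\<forall>T. bounded ((\<lambda>(t, x). u t x) ` ({0..T} \<times> \<Omega>)))"

text \<open>The fundamental solution with zero boundary values. The last clause determines
  \<open>p t x\<close> almost everywhere in \<open>\<Omega>\<close>, for \<open>t > 0\<close> and \<open>x \<in> \<Omega>\<close>.\<close>

definition dirichlet_heat_kernel ::
  "'a::euclidean_space set \<Rightarrow> (real \<Rightarrow> 'a \<Rightarrow> 'a \<Rightarrow> real) \<Rightarrow> bool" where
  "dirichlet_heat_kernel \<Omega> p \<longleftrightarrow>
     (\<forall>y\<in>\<Omega>. solves_heat \<Omega> (\<lambda>t x. p t x y) \<and>
        continuous_on ({0<..} \<times> closure \<Omega>) (\<lambda>(t, x). p t x y) \<and>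
        (\<forall>t>0. \<forall>x\<in>frontier \<Omega>. p t x y = 0)) \<and>
     (\<forall>t>0. \<forall>x\<in>\<Omega>. set_integrable lebesgue \<Omega> (p t x)) \<and>
     (\<forall>h. continuous_on \<Omega> h \<and> bounded (h ` \<Omega>) \<longrightarrow>
        dirichlet_heat_solution \<Omega> h (\<lambda>_. 0)
          (\<lambda>t x. if t = 0 then h x else (LINT y:\<Omega>|lebesgue. p t x y * h y)))"

text \<open>Supremum over the boundary of the absolute value taken from inside. \<open>Limsup\<close> is the limit
  of \<open>\<bar>h x\<bar>\<close> as \<open>x \<in> \<Omega>\<close> tends to the boundary point \<open>y\<close> whenever that limit exists, and
  the value is meaningful (possibly infinite) also when it does not.\<close>

definition boundary_norm :: "'a::euclidean_space set \<Rightarrow> ('a \<Rightarrow> real) \<Rightarrow> ereal" where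
  "boundary_norm \<Omega> h = (SUP y\<in>frontier \<Omega>. Limsup (at y within \<Omega>) (\<lambda>x. ereal \<bar>h x\<bar>))"

end

theory Submission
  imports Defs
begin

text \<open>Differences of \<open>v = \<partial>\<^sup>k u / \<partial>\<nu>\<^sup>k\<close> and its Dirichlet evolution vanish at time zero, and on the
  lateral boundary they are at most \<open>M\<close>, the maximal boundary norm. The function \<open>M (1 - \<integral> p\<^sub>t(x, y) dy)\<close>
  also solves the heat equation, vanishes at time zero and equals \<open>M\<close> on the lateral boundary, so the
  estimate is an instance of the maximum principle. Four points need care.

  \<^item> That \<open>v\<close> is a classical solution: gradients and Hessians of solutions are bounded by the supremum
    norm (reflection and a barrier), so difference quotients converge together with their derivatives.
  \<^item> That \<open>v\<close> is continuous at time zero inside \<open>\<Omega>\<close>: this follows from a barrier for difference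
    quotients of order \<open>k\<close>, which are bounded since \<open>v\<close> is.
  \<^item> The boundary norm only controls limits at fixed times: averaging in time makes \<open>v\<close>
    Lipschitz in time and turns these limits into joint ones.
  \<^item> Nothing is known at the corner \<open>{0} \<times> \<partial>\<Omega>\<close>: it is negligible, hence covered by balls of small total
    volume, and Gaussians centred at these balls serve as a barrier.\<close>

section \<open>The parabolic maximum principle\<close>

text \<open>\<open>solves_heat\<close> grants two space derivatives, and the kernel represents only
  solutions with zero boundary values; so the derivative of order \<open>k\<close> has to be
  extracted from the equation itself. Each quantitative step compares with an explicit function: a
  quadratic polynomial for the interior bounds, |x|^2 + 2nt at the initial time, Gaussians at the
  corner.

  The obstacle that shapes the end of the proof is the lateral boundary.
  \<open>boundary_norm\<close> controls v(s, x) as x tends to the boundary for each s separately,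
  with no uniformity in s, whereas the maximum principle asks for neighbourhoods in space-time.
  Integration over [s, s + h] repairs this: dominated convergence keeps the bound for fixed s, a
  bound C on v gives the Lipschitz constant 2C in s, the same for all x, and the equation survives
  because differentiation commutes with the integral. The C^1 condition on the boundary enters
  through one consequence, that the frontier is a null set.\<close>

lemma second_deriv_nonpos_at_max:
  fixes f f' :: "real \<Rightarrow> real"
  assumes "\<delta> > 0"
    and f: "\<And>r. \<bar>r\<bar> < \<delta> \<Longrightarrow> (f has_real_derivative f' r) (at r)"
    and f': "(f' has_real_derivative D) (at 0)"
    and max: "\<And>r. \<bar>r\<bar> < \<delta> \<Longrightarrow> f r \<le> f 0"
  shows "D \<le> 0"
proof (rule ccontr)
  assume "\<not> D \<le> 0"
  then have "D > 0" by simp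
  have 0: "f' 0 = 0"
    using DERIV_local_max[OF f[of 0] \<open>\<delta> > 0\<close>] max \<open>\<delta> > 0\<close> by simp
  \<comment> \<open>A positive derivative at its zero makes \<open>f'\<close> positive just to the
    right of 0, and the mean value theorem then lifts \<open>f\<close> above
    \<open>f 0\<close>.\<close>
  obtain d where d: "d > 0" "\<And>h. h > 0 \<Longrightarrow> h < d \<Longrightarrow> f' 0 < f' (0 + h)"
    using DERIV_pos_inc_right[OF f' \<open>D > 0\<close>] by auto
  define r where "r = min d \<delta> / 2"
  have r: "r > 0" "r < d" "r < \<delta>" using d \<open>\<delta> > 0\<close> by (auto simp: r_def)
  obtain z where z: "z > 0" "z < r" "f r - f 0 = (r - 0) * f' z"
    using MVT2[of 0 r f f'] f r by force
  have "f' z > 0" using d(2)[of z] z r 0 by simp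
  then have "f r > f 0" using z r by (smt (verit) mult_pos_pos)
  then show False using max[of r] r by simp
qed

text \<open>One-sided because a maximum over a space-time cylinder may lie at the final time, where
  only earlier times can be compared.\<close>

lemma deriv_nonneg_at_left_max:
  fixes f :: "real \<Rightarrow> real"
  assumes "(f has_real_derivative D) (at t)" and "\<delta> > 0"
    and max: "\<And>s. t - \<delta> < s \<Longrightarrow> s < t \<Longrightarrow> f s \<le> f t"
  shows "D \<ge> 0"
proof (rule ccontr)
  assume "\<not> D \<ge> 0"
  then obtain d where d: "d > 0" "\<And>h. h > 0 \<Longrightarrow> h < d \<Longrightarrow> f t < f (t - h)"
    using DERIV_neg_dec_left[OF assms(1)] by auto
  define r where "r = min d \<delta> / 2"
  have r: "r > 0" "r < d" "r < \<delta>" using d \<open>\<delta> > 0\<close> by (auto simp: r_def)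
  then show False using d(2)[of r] max[of "t - r"] by auto
qed

lemma has_real_derivative_shift:
  fixes f :: "'a::real_vector \<Rightarrow> real"
  assumes "((\<lambda>r. f (x + s *\<^sub>R b + r *\<^sub>R b)) has_real_derivative D) (at 0)"
  shows "((\<lambda>r. f (x + r *\<^sub>R b)) has_real_derivative D) (at s)"
  using assms DERIV_at_within_shift[of "\<lambda>r. f (x + r *\<^sub>R b)" D s 0 UNIV]
  by (simp add: scaleR_left_distrib add.assoc)

text \<open>A positive value would, after subtracting a small multiple of the elapsed time, produce
  an attained maximum at which the time derivative strictly exceeds the Laplacian. The boundary
  hypothesis asks for eventual upper bounds rather than boundary values, so \<open>F\<close> needs
  no extension to the closure; derivatives are taken along coordinate lines, which lets time
  averages and sums of Gaussians qualify.\<close>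

lemma parabolic_maximum_principle:
  fixes S :: "'a::euclidean_space set" and F :: "real \<Rightarrow> 'a \<Rightarrow> real"
  assumes "open S" "bounded S"
    and cont: "continuous_on ({a<..T} \<times> S) (\<lambda>(t, x). F t x)"
    and d1: "\<And>b t x. \<lbrakk>b \<in> Basis; t \<in> {a<..T}; x \<in> S\<rbrakk> \<Longrightarrow>
               ((\<lambda>r. F t (x + r *\<^sub>R b)) has_real_derivative G b t x) (at 0)"
    and d2: "\<And>b t x. \<lbrakk>b \<in> Basis; t \<in> {a<..T}; x \<in> S\<rbrakk> \<Longrightarrow>
               ((\<lambda>r. G b t (x + r *\<^sub>R b)) has_real_derivative H b t x) (at 0)"
    and dt: "\<And>t x. \<lbrakk>t \<in> {a<..T}; x \<in> S\<rbrakk> \<Longrightarrow> ((\<lambda>s. F s x) has_real_derivative D t x) (at t)"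
    and sub: "\<And>t x. \<lbrakk>t \<in> {a<..T}; x \<in> S\<rbrakk> \<Longrightarrow> D t x \<le> (\<Sum>b\<in>Basis. H b t x)"
    and bdry: "\<And>s y e. \<lbrakk>s \<in> {a..T}; y \<in> closure S; s = a \<or> y \<notin> S; e > 0\<rbrakk> \<Longrightarrow>
               \<forall>\<^sub>F z in at (s, y) within ({a<..T} \<times> S). F (fst z) (snd z) \<le> e"
    and "t \<in> {a<..T}" "x \<in> S"
  shows "F t x \<le> 0"
proof (rule ccontr)
  assume "\<not> F t x \<le> 0"
  define Q where "Q = {a<..T} \<times> S"
  \<comment> \<open>This slope halves the offending value: \<open>E (t, x) = F t x / 2\<close>,
    still positive, becomes the level \<open>m\<close>.\<close>
  define \<delta> where "\<delta> = F t x / (2 * (t - a))"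
  have \<delta>: "\<delta> > 0" using \<open>\<not> F t x \<le> 0\<close> \<open>t \<in> {a<..T}\<close> by (auto simp: \<delta>_def)
  define E where "E z = F (fst z) (snd z) - \<delta> * (fst z - a)" for z
  define m where "m = E (t, x)"
  have m: "m > 0" using \<open>\<not> F t x \<le> 0\<close> \<open>t \<in> {a<..T}\<close>
    by (auto simp: m_def E_def \<delta>_def field_simps)
  have contE: "continuous_on Q E"
    unfolding E_def using cont by (auto simp: Q_def split_beta intro!: continuous_intros)
  define K where "K = {z \<in> Q. E z \<ge> m}"
  \<comment> \<open>Closedness replaces continuity up to the boundary: a limit outside
    \<open>Q\<close> of points of \<open>K\<close> would lie at the initial time or on the lateral
    side, where \<open>F\<close> is eventually at most \<open>m / 2\<close>, while
    \<open>m \<le> E \<le> F\<close> on \<open>K\<close>.\<close>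
  have "closed K"
    unfolding closed_sequential_limits
  proof (intro allI impI, elim conjE)
    fix z l assume z: "\<forall>n. z n \<in> K" and l: "z \<longlonglongrightarrow> l"
    have zQ: "z n \<in> Q" and zE: "E (z n) \<ge> m" for n using z by (auto simp: K_def)
    have "l \<in> closure Q" using zQ l closure_sequential by blast
    moreover have "closure {a<..T} \<subseteq> {a..T}" by (rule closure_minimal) auto
    ultimately have l': "fst l \<in> {a..T}" "snd l \<in> closure S"
      unfolding Q_def closure_Times by auto
    show "l \<in> K"
    proof (cases "l \<in> Q")
      case True
      have "(\<lambda>n. E (z n)) \<longlonglongrightarrow> E l"
        using continuous_on_tendsto_compose[OF contE l True] zQ by simp
      then have "E l \<ge> m" using zE LIMSEQ_le_const by blast
      then show ?thesis using True by (simp add: K_def)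
    next
      case False
      have "fst l = a \<or> snd l \<notin> S" using False l' by (auto simp: Q_def mem_Times_iff)
      then have "\<forall>\<^sub>F z in at l within Q. F (fst z) (snd z) \<le> m / 2"
        using bdry[of "fst l" "snd l" "m / 2"] l' m by (simp add: Q_def)
      moreover have "filterlim z (at l within Q) sequentially"
        unfolding filterlim_at using l zQ False by (metis (mono_tags, lifting) always_eventually)
      ultimately have "\<forall>\<^sub>F n in sequentially. F (fst (z n)) (snd (z n)) \<le> m / 2"
        by (rule eventually_compose_filterlim)
      then obtain n where "F (fst (z n)) (snd (z n)) \<le> m / 2"
        using eventually_sequentially by auto
      moreover have "fst (z n) > a" using zQ[of n] by (auto simp: Q_def mem_Times_iff)
      ultimately have "E (z n) < m" using \<delta> m unfolding E_def
        by (smt (verit) field_sum_of_halves mult_nonneg_nonneg)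
      then show ?thesis using zE[of n] by simp
    qed
  qed
  moreover have "bounded K"
  proof (rule bounded_subset)
    show "bounded ({a..T} \<times> S)" using \<open>bounded S\<close> by (simp add: bounded_Times)
  qed (auto simp: K_def Q_def)
  ultimately have "compact K" by (simp add: compact_eq_bounded_closed)
  moreover have "(t, x) \<in> K" using assms(9,10) by (simp add: K_def Q_def m_def)
  ultimately obtain z where z: "z \<in> K" "\<And>w. w \<in> K \<Longrightarrow> E w \<le> E z"
    using continuous_attains_sup[of K E] contE
    by (metis (no_types, lifting) K_def continuous_on_subset empty_iff mem_Collect_eq subsetI)
  have zmax: "E w \<le> E z" if "w \<in> Q" for w
    using z that by (cases "w \<in> K") (auto simp: K_def)
  obtain s y where sy: "z = (s, y)" by fastforce
  have s: "s \<in> {a<..T}" and y: "y \<in> S" using z(1) by (auto simp: K_def Q_def sy)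
  obtain d where d: "d > 0" "ball y d \<subseteq> S" using \<open>open S\<close> y openE by blast
  have in_S: "y + r *\<^sub>R b \<in> S" if "\<bar>r\<bar> < d" "b \<in> Basis" for r b
    using that d by (auto simp: subset_iff dist_norm)
  have "H b s y \<le> 0" if b: "b \<in> Basis" for b
  proof (rule second_deriv_nonpos_at_max[OF d(1)])
    show "((\<lambda>r. F s (y + r *\<^sub>R b)) has_real_derivative G b s (y + r *\<^sub>R b)) (at r)"
      if "\<bar>r\<bar> < d" for r
      by (rule has_real_derivative_shift) (use d1[OF b s in_S[OF that b]] in simp)
    show "((\<lambda>r. G b s (y + r *\<^sub>R b)) has_real_derivative H b s y) (at 0)"
      by (rule d2[OF b s y])
    show "F s (y + r *\<^sub>R b) \<le> F s (y + 0 *\<^sub>R b)" if "\<bar>r\<bar> < d" for r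
      using zmax[of "(s, y + r *\<^sub>R b)"] in_S[OF that b] s by (simp add: Q_def E_def sy)
  qed
  then have "(\<Sum>b\<in>Basis. H b s y) \<le> 0" by (simp add: sum_nonpos)
  moreover have "D s y - \<delta> \<ge> 0"
  proof (rule deriv_nonneg_at_left_max)
    show "((\<lambda>s. F s y - \<delta> * (s - a)) has_real_derivative D s y - \<delta>) (at s)"
      by (auto intro!: derivative_eq_intros dt[OF s y])
    show "s - a > 0" using s by simp
    show "F r y - \<delta> * (r - a) \<le> F s y - \<delta> * (s - a)" if "s - (s - a) < r" "r < s" for r
      using zmax[of "(r, y)"] that s y by (simp add: Q_def E_def sy)
  qed
  ultimately show False using sub[OF s y] \<delta> by simp
qed

section \<open>Interior gradient and Hessian bounds\<close>

text \<open>Gradient \<open>g\<close> and Hessian \<open>h\<close> are parameters, so that linear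
  combinations, translates and limits come with visible witnesses; \<open>h b c\<close> is the
  derivative of \<open>g b\<close> in direction \<open>c\<close>. The time set is arbitrary because
  the maximum principle works on half-open intervals and the regularity theory on open ones; the
  time derivative is two-sided in both cases.\<close>

definition heat :: "real set \<Rightarrow> 'a::euclidean_space set \<Rightarrow> (real \<Rightarrow> 'a \<Rightarrow> real) \<Rightarrow>
    ('a \<Rightarrow> real \<Rightarrow> 'a \<Rightarrow> real) \<Rightarrow> ('a \<Rightarrow> 'a \<Rightarrow> real \<Rightarrow> 'a \<Rightarrow> real) \<Rightarrow> bool" where
  "heat I S w g h \<longleftrightarrow>
     (\<forall>t\<in>I. \<forall>x\<in>S. (w t has_derivative (\<lambda>v. \<Sum>b\<in>Basis. g b t x * (v \<bullet> b))) (at x)) \<and>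
     (\<forall>b\<in>Basis. \<forall>t\<in>I. \<forall>x\<in>S.
        (g b t has_derivative (\<lambda>v. \<Sum>c\<in>Basis. h b c t x * (v \<bullet> c))) (at x)) \<and>
     (\<forall>t\<in>I. \<forall>x\<in>S. ((\<lambda>s. w s x) has_real_derivative (\<Sum>b\<in>Basis. h b b t x)) (at t)) \<and>
     continuous_on (I \<times> S) (\<lambda>(t, x). w t x) \<and>
     (\<forall>b\<in>Basis. continuous_on (I \<times> S) (\<lambda>(t, x). g b t x))"

lemma heatD:
  assumes "heat I S w g h"
  shows "t \<in> I \<Longrightarrow> x \<in> S \<Longrightarrow> (w t has_derivative (\<lambda>v. \<Sum>b\<in>Basis. g b t x * (v \<bullet> b))) (at x)"
    and "b \<in> Basis \<Longrightarrow> t \<in> I \<Longrightarrow> x \<in> S \<Longrightarrow>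
           (g b t has_derivative (\<lambda>v. \<Sum>c\<in>Basis. h b c t x * (v \<bullet> c))) (at x)"
    and "t \<in> I \<Longrightarrow> x \<in> S \<Longrightarrow> ((\<lambda>s. w s x) has_real_derivative (\<Sum>b\<in>Basis. h b b t x)) (at t)"
    and "continuous_on (I \<times> S) (\<lambda>(t, x). w t x)"
    and "b \<in> Basis \<Longrightarrow> continuous_on (I \<times> S) (\<lambda>(t, x). g b t x)"
  using assms unfolding heat_def by blast+

lemma sum_Basis_inner_collapse:
  assumes "c \<in> Basis"
  shows "(\<Sum>b\<in>Basis. k b * (r *\<^sub>R c \<bullet> b)) = r * k c"
proof -
  have "(\<Sum>b\<in>Basis. k b * (r *\<^sub>R c \<bullet> b)) = (\<Sum>b\<in>Basis. if b = c then r * k b else 0)"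
    using assms by (intro sum.cong) (auto simp: inner_Basis)
  then show ?thesis using assms by simp
qed

lemma has_real_derivative_along_line:
  fixes f :: "'a::real_normed_vector \<Rightarrow> real"
  assumes "(f has_derivative f') (at x)"
  shows "((\<lambda>r. f (x + r *\<^sub>R v)) has_real_derivative f' v) (at 0)"
proof -
  have 1: "(f has_derivative f') (at (x + 0 *\<^sub>R v))" using assms by simp
  have 2: "((\<lambda>r::real. x + r *\<^sub>R v) has_derivative (\<lambda>r. r *\<^sub>R v)) (at 0)"
    by (auto intro!: derivative_eq_intros)
  have "((\<lambda>r. f (x + r *\<^sub>R v)) has_derivative (\<lambda>r. f' (r *\<^sub>R v))) (at 0)"
    using has_derivative_compose[OF 2 1] by simp
  moreover have "f' (r *\<^sub>R v) = f' v * r" for r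
    using linear_scale[OF has_derivative_linear[OF assms]] by simp
  ultimately show ?thesis by (simp add: has_field_derivative_def)
qed

lemma has_real_derivative_along_axis:
  fixes f :: "'a::euclidean_space \<Rightarrow> real"
  assumes "(f has_derivative (\<lambda>v. \<Sum>b\<in>Basis. k b * (v \<bullet> b))) (at x)" "c \<in> Basis"
  shows "((\<lambda>r. f (x + r *\<^sub>R c)) has_real_derivative k c) (at 0)"
    and "((\<lambda>r. f (x + (- r) *\<^sub>R c)) has_real_derivative - k c) (at 0)"
proof -
  show "((\<lambda>r. f (x + r *\<^sub>R c)) has_real_derivative k c) (at 0)"
    using has_real_derivative_along_line[OF assms(1), of c]
      sum_Basis_inner_collapse[OF assms(2), of k 1] by simp
  show "((\<lambda>r. f (x + (- r) *\<^sub>R c)) has_real_derivative - k c) (at 0)"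
    using has_real_derivative_along_line[OF assms(1), of "- c"]
      sum_Basis_inner_collapse[OF assms(2), of k "- 1"] by simp
qed

section \<open>Linear combinations, translates and difference quotients of solutions\<close>

lemma heat_subset:
  "heat I S w g h \<Longrightarrow> I' \<subseteq> I \<Longrightarrow> S' \<subseteq> S \<Longrightarrow> heat I' S' w g h"
  unfolding heat_def by (blast intro: continuous_on_subset)

lemma heat_cong:
  assumes "open I" "open S" "heat I S w g h"
    and "\<And>t x. t \<in> I \<Longrightarrow> x \<in> S \<Longrightarrow> w' t x = w t x"
  shows "heat I S w' g h"
proof -
  have "(w' t has_derivative F) (at x)" if "t \<in> I" "x \<in> S" "(w t has_derivative F) (at x)" for t x F
    using has_derivative_transform_within_open[OF that(3) \<open>open S\<close> that(2)] assms(4) that by simp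
  moreover have "((\<lambda>s. w' s x) has_real_derivative F) (at t)"
    if "t \<in> I" "x \<in> S" "((\<lambda>s. w s x) has_real_derivative F) (at t)" for t x F
    using has_field_derivative_transform_within_open[OF that(3) \<open>open I\<close> that(1)] assms(4) that
    by simp
  moreover have "continuous_on (I \<times> S) (\<lambda>(t, x). w' t x) = continuous_on (I \<times> S) (\<lambda>(t, x). w t x)"
    by (rule continuous_on_cong) (auto simp: assms(4))
  ultimately show ?thesis using assms(3) unfolding heat_def by simp
qed

lemma heat_zero: "heat I S (\<lambda>t x. 0) (\<lambda>b t x. 0) (\<lambda>b c t x. 0)"
  unfolding heat_def by (auto intro!: derivative_eq_intros)

lemma heat_lincomb:
  assumes "heat I S w g h" "heat I S w' g' h'"
  shows "heat I S (\<lambda>t x. c * w t x + d * w' t x) (\<lambda>b t x. c * g b t x + d * g' b t x)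
           (\<lambda>b b' t x. c * h b b' t x + d * h' b b' t x)"
  unfolding heat_def
proof (intro conjI ballI)
  have eq: "(\<Sum>b\<in>Basis. (c * k b + d * k' b) * (v \<bullet> b)) =
     c * (\<Sum>b\<in>Basis. k b * (v \<bullet> b)) + d * (\<Sum>b\<in>Basis. k' b * (v \<bullet> b))" for k k' and v :: 'a
    by (simp add: sum_distrib_left flip: sum.distrib) (simp add: algebra_simps)
  fix t x assume tx: "t \<in> I" "x \<in> S"
  show "((\<lambda>x. c * w t x + d * w' t x) has_derivative
        (\<lambda>v. \<Sum>b\<in>Basis. (c * g b t x + d * g' b t x) * (v \<bullet> b))) (at x)"
    unfolding eq by (intro derivative_intros heatD(1)[OF assms(1) tx] heatD(1)[OF assms(2) tx])
  show "((\<lambda>s. c * w s x + d * w' s x) has_real_derivative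
        (\<Sum>b\<in>Basis. c * h b b t x + d * h' b b t x)) (at t)"
    unfolding sum.distrib sum_distrib_left[symmetric]
    by (rule DERIV_add; rule DERIV_cmult; rule heatD(3)[OF assms(1) tx] heatD(3)[OF assms(2) tx])
  fix b :: 'a assume b: "b \<in> Basis"
  show "((\<lambda>x. c * g b t x + d * g' b t x) has_derivative
        (\<lambda>v. \<Sum>b'\<in>Basis. (c * h b b' t x + d * h' b b' t x) * (v \<bullet> b'))) (at x)"
    unfolding eq by (intro derivative_intros heatD(2)[OF assms(1) b tx] heatD(2)[OF assms(2) b tx])
next
  show "continuous_on (I \<times> S) (\<lambda>(t, x). c * w t x + d * w' t x)"
    using heatD(4)[OF assms(1)] heatD(4)[OF assms(2)]
    by (auto simp: split_beta intro!: continuous_intros)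
  show "continuous_on (I \<times> S) (\<lambda>(t, x). c * g b t x + d * g' b t x)" if "b \<in> Basis" for b
    using heatD(5)[OF assms(1) that] heatD(5)[OF assms(2) that]
    by (auto simp: split_beta intro!: continuous_intros)
qed

lemma heat_sum:
  assumes "finite B" "\<And>i. i \<in> B \<Longrightarrow> heat I S (w i) (g i) (h i)"
  shows "\<exists>g h. heat I S (\<lambda>t x. \<Sum>i\<in>B. k i * w i t x) g h"
  using assms
proof (induction B rule: finite_induct)
  case empty
  show ?case using heat_zero by auto
next
  case (insert i B)
  then obtain g' h' where 1: "heat I S (\<lambda>t x. \<Sum>i\<in>B. k i * w i t x) g' h'" by blast
  have "heat I S (w i) (g i) (h i)" using insert by simp
  from heat_lincomb[OF this 1, of "k i" 1] show ?case using insert by auto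
qed

lemma heat_translate:
  assumes "heat I S w g h"
  shows "heat I {x. x + a \<in> S} (\<lambda>t x. w t (x + a)) (\<lambda>b t x. g b t (x + a)) (\<lambda>b c t x. h b c t (x + a))"
  unfolding heat_def
proof (intro conjI ballI)
  have shift: "((\<lambda>x. f (x + a)) has_derivative F) (at x)" if "(f has_derivative F) (at (x + a))"
    for f :: "'a \<Rightarrow> real" and F x
  proof -
    have "((\<lambda>x. x + a) has_derivative (\<lambda>x. x)) (at x)" by (auto intro!: derivative_eq_intros)
    from has_derivative_compose[OF this that] show ?thesis .
  qed
  fix t x assume tx: "t \<in> I" "x \<in> {x. x + a \<in> S}"
  then have x: "x + a \<in> S" by simp
  show "((\<lambda>x. w t (x + a)) has_derivative (\<lambda>v. \<Sum>b\<in>Basis. g b t (x + a) * (v \<bullet> b))) (at x)"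
    by (rule shift, rule heatD(1)[OF assms tx(1) x])
  show "((\<lambda>s. w s (x + a)) has_real_derivative (\<Sum>b\<in>Basis. h b b t (x + a))) (at t)"
    by (rule heatD(3)[OF assms tx(1) x])
  fix b :: 'a assume b: "b \<in> Basis"
  show "((\<lambda>x. g b t (x + a)) has_derivative (\<lambda>v. \<Sum>c\<in>Basis. h b c t (x + a) * (v \<bullet> c))) (at x)"
    by (rule shift, rule heatD(2)[OF assms b tx(1) x])
next
  have cont: "continuous_on (I \<times> {x. x + a \<in> S}) (\<lambda>(t, x). f t (x + a))"
    if "continuous_on (I \<times> S) (\<lambda>(t, x). f t x)" for f :: "real \<Rightarrow> 'a \<Rightarrow> real"
    unfolding split_beta
    by (rule continuous_on_compose2[OF that[unfolded split_beta],
          of "I \<times> {x. x + a \<in> S}" "\<lambda>z. (fst z, snd z + a)", simplified])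
       (auto intro!: continuous_intros)
  show "continuous_on (I \<times> {x. x + a \<in> S}) (\<lambda>(t, x). w t (x + a))"
    by (rule cont, rule heatD(4)[OF assms])
  show "continuous_on (I \<times> {x. x + a \<in> S}) (\<lambda>(t, x). g b t (x + a))" if "b \<in> Basis" for b
    by (rule cont, rule heatD(5)[OF assms that])
qed

text \<open>Constant coefficients make the equation invariant under translation. This is the source
  of all higher regularity below.\<close>

lemma heat_diff_quotient:
  assumes "heat I S w g h" "S' \<subseteq> S" "\<And>x. x \<in> S' \<Longrightarrow> x + a \<in> S"
  shows "heat I S' (\<lambda>t x. (w t (x + a) - w t x) / \<eta>) (\<lambda>b t x. (g b t (x + a) - g b t x) / \<eta>)
           (\<lambda>b c t x. (h b c t (x + a) - h b c t x) / \<eta>)"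
proof -
  have "heat I S' (\<lambda>t x. w t (x + a)) (\<lambda>b t x. g b t (x + a)) (\<lambda>b c t x. h b c t (x + a))"
    by (rule heat_subset[OF heat_translate[OF assms(1)]]) (use assms(3) in auto)
  from heat_lincomb[OF this heat_subset[OF assms(1) order_refl assms(2)], of "1/\<eta>" "-1/\<eta>"]
  show ?thesis by (simp add: diff_divide_distrib)
qed

lemma inner_axis_shift:
  assumes "b \<in> Basis" "c \<in> Basis"
  shows "(x + r *\<^sub>R c - y) \<bullet> b = (x - y) \<bullet> b + (if c = b then r else 0)"
  using assms by (auto simp: inner_add_left inner_diff_left inner_Basis)

text \<open>The solution minus its reflection vanishes on the hyperplane through \<open>x\<^sub>0\<close>; on the
  half ball it is dominated by a quadratic barrier that grows linearly away from the hyperplane.\<close>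

lemma heat_reflection_estimate:
  fixes x\<^sub>0 :: "'a::euclidean_space"
  assumes heat: "heat {t\<^sub>0 - d\<^sup>2<..t\<^sub>0} (ball x\<^sub>0 d) w g h"
    and d: "d > 0" and b: "b \<in> Basis"
    and A: "\<And>t x. t \<in> {t\<^sub>0 - d\<^sup>2<..t\<^sub>0} \<Longrightarrow> x \<in> ball x\<^sub>0 d \<Longrightarrow> \<bar>w t x\<bar> \<le> A"
    and \<xi>: "0 < \<xi>" "\<xi> < d"
  shows "w t\<^sub>0 (x\<^sub>0 + \<xi> *\<^sub>R b) - w t\<^sub>0 (x\<^sub>0 - \<xi> *\<^sub>R b) \<le> 2 * (real DIM('a) + 1) * A / d * \<xi>"
proof -
  define a where "a = t\<^sub>0 - d\<^sup>2"
  define I where "I = {a<..t\<^sub>0}"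
  \<comment> \<open>With n = \<open>DIM('a)\<close>, the Laplacian of \<open>q\<close> is 2n - 2K =
    -2, below its time derivative -1: \<open>q\<close> is a supersolution.\<close>
  define K where "K = real DIM('a) + 1"
  \<comment> \<open>On the sphere and at the starting time \<open>q\<close> is at least
    \<open>d\<^sup>2\<close>, so \<open>A' * q\<close> is at least 2A there, the largest possible
    gap between \<open>w\<close> and its reflection.\<close>
  define A' where "A' = 2 * A / d\<^sup>2"
  define X where "X x = (x - x\<^sub>0) \<bullet> b" for x
  define R where "R x = x - (2 * X x) *\<^sub>R b" for x
  \<comment> \<open>The first two terms are large on the sphere and at the starting time; the last
    product vanishes on the mirror hyperplane and supplies the negative second derivative across
    it.\<close>
  define q where "q t x = (x - x\<^sub>0) \<bullet> (x - x\<^sub>0) + (t\<^sub>0 - t) + K * (X x * (d - X x))" for t x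
  define S where "S = {x \<in> ball x\<^sub>0 d. X x > 0}"
  have heat': "heat I (ball x\<^sub>0 d) w g h" using heat by (simp add: I_def a_def)
  have A0: "A \<ge> 0" using A[of t\<^sub>0 x\<^sub>0] d by force
  then have A'0: "A' \<ge> 0" by (simp add: A'_def)
  have contX: "continuous_on T X" for T unfolding X_def by (intro continuous_intros)
  have contR: "continuous_on T R" for T unfolding R_def by (intro continuous_intros contX)
  have S: "open S" "bounded S"
  proof -
    have "S = ball x\<^sub>0 d \<inter> X -` {0<..}" by (auto simp: S_def)
    then show "open S" using continuous_open_preimage[OF contX[of "ball x\<^sub>0 d"]] by simp
    show "bounded S" by (rule bounded_subset[of "ball x\<^sub>0 d"]) (auto simp: S_def)
  qed
  have bb: "b \<bullet> b = 1" using b by simp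
  have R_in: "R x \<in> ball x\<^sub>0 d" if "x \<in> ball x\<^sub>0 d" for x
  proof -
    have "(R x - x\<^sub>0) \<bullet> (R x - x\<^sub>0) = (x - x\<^sub>0) \<bullet> (x - x\<^sub>0)"
      unfolding R_def X_def
      by (simp add: inner_diff_left inner_diff_right inner_commute bb algebra_simps)
    then have "norm (R x - x\<^sub>0) = norm (x - x\<^sub>0)" by (simp add: norm_eq_sqrt_inner)
    then show ?thesis using that by (simp add: dist_norm norm_minus_commute)
  qed
  have X_shift: "X (x + r *\<^sub>R c) = X x + (if c = b then r else 0)" if "c \<in> Basis" for x r c
    unfolding X_def using inner_axis_shift[OF b that] by auto
  have R_shift: "R (x + r *\<^sub>R c) = R x + (if c = b then - r else r) *\<^sub>R c" if "c \<in> Basis" for x r c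
  proof -
    have "(2 * (X x + r)) *\<^sub>R b = (2 * X x) *\<^sub>R b + r *\<^sub>R b + r *\<^sub>R b"
      unfolding scaleR_left_distrib[symmetric] by simp
    then show ?thesis unfolding R_def X_shift[OF that] by auto
  qed
  have X_le: "X x < d" if "x \<in> ball x\<^sub>0 d" for x
    using that norm_cauchy_schwarz[of "x - x\<^sub>0" b] b
    by (simp add: X_def dist_norm norm_minus_commute[of x\<^sub>0])
  have q_ge: "q t x \<ge> (x - x\<^sub>0) \<bullet> (x - x\<^sub>0)" "q t x \<ge> t\<^sub>0 - t" "q t x \<ge> 0"
    if "t \<le> t\<^sub>0" "0 \<le> X x" "X x \<le> d" for t x
  proof -
    have "K * (X x * (d - X x)) \<ge> 0" using that by (simp add: K_def)
    then show "q t x \<ge> (x - x\<^sub>0) \<bullet> (x - x\<^sub>0)" "q t x \<ge> t\<^sub>0 - t" "q t x \<ge> 0"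
      using that inner_ge_zero[of "x - x\<^sub>0"] unfolding q_def by linarith+
  qed
  have contq: "continuous_on T (\<lambda>z. q (fst z) (snd z))" for T
    unfolding q_def by (intro continuous_intros continuous_on_compose2[OF contX[of UNIV]]) auto
  define F where "F t x = w t x - w t (R x) - A' * q t x" for t x
  define G where "G c t x = g c t x - (if c = b then - g c t (R x) else g c t (R x))
      - A' * (2 * ((x - x\<^sub>0) \<bullet> c) + K * (if c = b then d - 2 * X x else 0))" for c t x
  define H where "H c t x = h c c t x - h c c t (R x) - A' * (2 - (if c = b then 2 * K else 0))" for c t x
  define D where "D t x = (\<Sum>c\<in>Basis. h c c t x) - (\<Sum>c\<in>Basis. h c c t (R x)) + A'" for t x
  have contwR: "continuous_on (I \<times> ball x\<^sub>0 d) (\<lambda>z. w (fst z) (snd z) - w (fst z) (R (snd z)))"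
  proof -
    have "continuous_on (I \<times> ball x\<^sub>0 d) (\<lambda>z. w (fst z) (R (snd z)))"
      by (rule continuous_on_compose2[OF heatD(4)[OF heat', unfolded split_beta],
            of "I \<times> ball x\<^sub>0 d" "\<lambda>z. (fst z, R (snd z))", unfolded fst_conv snd_conv])
         (use R_in in \<open>auto intro!: continuous_intros continuous_on_compose2[OF contR[of UNIV]]\<close>)
    then show ?thesis
      using heatD(4)[OF heat'] by (auto simp: split_beta intro!: continuous_intros)
  qed
  have main: "F t x \<le> 0" if "t \<in> I" "x \<in> S" for t x
  proof (rule parabolic_maximum_principle[where F = F and G = G and H = H and D = D and
        a = a and T = t\<^sub>0 and S = S])
    show "open S" "bounded S" by fact+
    show "t \<in> {a<..t\<^sub>0}" "x \<in> S" using that by (auto simp: I_def)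
    show "continuous_on ({a<..t\<^sub>0} \<times> S) (\<lambda>(t, x). F t x)"
      unfolding F_def split_beta
      by (intro continuous_intros contq continuous_on_subset[OF contwR]) (auto simp: I_def S_def)
  next
    fix c :: 'a and t x assume c: "c \<in> Basis" and t: "t \<in> {a<..t\<^sub>0}" and x: "x \<in> S"
    have t': "t \<in> I" and x': "x \<in> ball x\<^sub>0 d" and Rx: "R x \<in> ball x\<^sub>0 d"
      using t x R_in by (auto simp: I_def S_def)
    note axis = has_real_derivative_along_axis[OF _ c]
    have q1: "((\<lambda>r. q t (x + r *\<^sub>R c)) has_real_derivative
        2 * ((x - x\<^sub>0) \<bullet> c) + K * (if c = b then d - 2 * X x else 0)) (at 0)"
      unfolding q_def X_shift[OF c]
      by (cases "c = b") (auto intro!: derivative_eq_intros simp: inner_commute algebra_simps)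
    have w1: "((\<lambda>r. w t (R (x + r *\<^sub>R c))) has_real_derivative
        (if c = b then - g c t (R x) else g c t (R x))) (at 0)"
      using axis[OF heatD(1)[OF heat' t' Rx]] unfolding R_shift[OF c] by (cases "c = b") auto
    show "((\<lambda>r. F t (x + r *\<^sub>R c)) has_real_derivative G c t x) (at 0)"
      unfolding F_def G_def
      by (intro DERIV_diff DERIV_cmult axis(1)[OF heatD(1)[OF heat' t' x']] w1 q1)
    have q2: "((\<lambda>r. 2 * ((x + r *\<^sub>R c - x\<^sub>0) \<bullet> c)
          + K * (if c = b then d - 2 * X (x + r *\<^sub>R c) else 0)) has_real_derivative
        2 - (if c = b then 2 * K else 0)) (at 0)"
      unfolding X_shift[OF c]
      by (cases "c = b") (use c in \<open>auto intro!: derivative_eq_intros simp: algebra_simps\<close>)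
    have g1: "((\<lambda>r. if c = b then - g c t (R (x + r *\<^sub>R c)) else g c t (R (x + r *\<^sub>R c)))
        has_real_derivative h c c t (R x)) (at 0)"
      using axis(1)[OF heatD(2)[OF heat' c t' Rx]] DERIV_minus[OF axis(2)[OF heatD(2)[OF heat' c t' Rx]]]
      unfolding R_shift[OF c] by (cases "c = b") auto
    show "((\<lambda>r. G c t (x + r *\<^sub>R c)) has_real_derivative H c t x) (at 0)"
      unfolding H_def G_def
      by (intro DERIV_diff DERIV_cmult axis(1)[OF heatD(2)[OF heat' c t' x']] g1 q2)
  next
    fix t x assume t: "t \<in> {a<..t\<^sub>0}" and x: "x \<in> S"
    have t': "t \<in> I" and x': "x \<in> ball x\<^sub>0 d" and Rx: "R x \<in> ball x\<^sub>0 d"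
      using t x R_in by (auto simp: I_def S_def)
    show "((\<lambda>s. F s x) has_real_derivative D t x) (at t)"
      unfolding F_def D_def q_def
      by (auto intro!: derivative_eq_intros heatD(3)[OF heat' t' x'] heatD(3)[OF heat' t' Rx])
    have "(\<Sum>c\<in>Basis. H c t x) = (\<Sum>c\<in>Basis. h c c t x) - (\<Sum>c\<in>Basis. h c c t (R x))
        - A' * (2 * DIM('a) - 2 * K)"
      using b unfolding H_def
      by (simp add: sum_subtractf sum_distrib_left[symmetric] right_diff_distrib)
    then show "D t x \<le> (\<Sum>c\<in>Basis. H c t x)"
      using A'0 by (simp add: D_def K_def algebra_simps)
  next
    fix s y e assume s: "s \<in> {a..t\<^sub>0}" and y: "y \<in> closure S" and sy: "s = a \<or> y \<notin> S"
      and e: "(e::real) > 0"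
    have le: "w t x - w t (R x) \<le> 2 * A" if "t \<in> I" "x \<in> S" for t x
      using A[of t x] A[of t "R x"] R_in[of x] that by (auto simp: I_def a_def S_def)
    have Xy: "0 \<le> X y"
    proof (rule continuous_ge_on_closure[OF contX y])
      show "0 \<le> X x" if "x \<in> S" for x using that by (simp add: S_def)
    qed
    have yd: "dist x\<^sub>0 y \<le> d"
    proof -
      have "closure S \<subseteq> cball x\<^sub>0 d" by (rule closure_minimal) (auto simp: S_def)
      then show ?thesis using y by auto
    qed
    have Xyd: "X y \<le> d"
      using yd norm_cauchy_schwarz[of "y - x\<^sub>0" b] b
      by (simp add: X_def dist_norm norm_minus_commute[of x\<^sub>0])
    have qt: "((\<lambda>z. A' * q (fst z) (snd z)) \<longlongrightarrow> A' * q s y) (at (s, y) within I \<times> S)"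
    proof -
      have "continuous (at (s, y) within I \<times> S) (\<lambda>z. q (fst z) (snd z))"
        using contq[of UNIV] continuous_at_imp_continuous_at_within
        by (metis UNIV_I continuous_on_eq_continuous_within)
      then show ?thesis by (intro tendsto_intros) (simp add: continuous_within)
    qed
    have in_Q: "\<forall>\<^sub>F z in at (s, y) within I \<times> S. fst z \<in> I \<and> snd z \<in> S"
      by (auto simp: eventually_at_filter intro!: always_eventually)
    show "\<forall>\<^sub>F z in at (s, y) within {a<..t\<^sub>0} \<times> S. F (fst z) (snd z) \<le> e"
    proof (cases "s = a \<or> dist x\<^sub>0 y = d")
      case True
      then have "q s y \<ge> d\<^sup>2"
      proof
        assume "s = a"
        then show ?thesis using q_ge(2)[of s y] s Xy Xyd by (simp add: a_def)
      next
        assume "dist x\<^sub>0 y = d"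
        then have "(y - x\<^sub>0) \<bullet> (y - x\<^sub>0) = d\<^sup>2"
          by (metis dist_norm dist_commute power2_norm_eq_inner)
        then show ?thesis using q_ge(1)[of s y] s Xy Xyd by simp
      qed
      then have "A' * q s y \<ge> A' * d\<^sup>2" using A'0 by (simp add: mult_left_mono)
      then have "A' * q s y > 2 * A - e" using d e by (simp add: A'_def)
      from order_tendstoD(1)[OF qt this] in_Q show ?thesis
        unfolding I_def[symmetric]
      proof eventually_elim
        case (elim z)
        then show ?case using le[of "fst z" "snd z"] by (simp add: F_def)
      qed
    next
      \<comment> \<open>What remains of the boundary is the flat face. Reflection fixes its points,
        so the difference of \<open>w\<close> and its reflection tends to 0 there.\<close>
      case False
      then have sI: "s \<in> I" and yb: "y \<in> ball x\<^sub>0 d" using s yd by (auto simp: I_def)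
      then have "y \<notin> S" using sy by (auto simp: I_def)
      then have "R y = y" using Xy yb by (simp add: S_def R_def)
      have "continuous (at (s, y) within I \<times> ball x\<^sub>0 d)
          (\<lambda>z. w (fst z) (snd z) - w (fst z) (R (snd z)))"
        using contwR sI yb by (simp add: continuous_on_eq_continuous_within)
      then have "((\<lambda>z. w (fst z) (snd z) - w (fst z) (R (snd z))) \<longlongrightarrow> 0)
          (at (s, y) within I \<times> ball x\<^sub>0 d)"
        using \<open>R y = y\<close> by (simp add: continuous_within)
      then have "((\<lambda>z. w (fst z) (snd z) - w (fst z) (R (snd z))) \<longlongrightarrow> 0)
          (at (s, y) within I \<times> S)"
        by (rule tendsto_within_subset) (auto simp: S_def)
      from order_tendstoD(2)[OF this e] in_Q show ?thesis
        unfolding I_def[symmetric]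
      proof eventually_elim
        case (elim z)
        have "q (fst z) (snd z) \<ge> 0"
          using elim X_le[of "snd z"] by (intro q_ge(3)) (auto simp: I_def S_def less_imp_le)
        then have "A' * q (fst z) (snd z) \<ge> 0" using A'0 by simp
        then show ?case using elim by (simp add: F_def)
      qed
    qed
  qed
  define x where "x = x\<^sub>0 + \<xi> *\<^sub>R b"
  have Xx: "X x = \<xi>" by (simp add: X_def x_def bb)
  have "x \<in> S" using \<xi> b Xx by (simp add: S_def) (simp add: x_def dist_norm)
  then have "w t\<^sub>0 x - w t\<^sub>0 (R x) \<le> A' * q t\<^sub>0 x"
    using main[of t\<^sub>0 x] d by (simp add: F_def I_def a_def)
  moreover have "R x = x\<^sub>0 - \<xi> *\<^sub>R b"
  proof -
    have "(2 * \<xi>) *\<^sub>R b = \<xi> *\<^sub>R b + \<xi> *\<^sub>R b" unfolding scaleR_left_distrib[symmetric] by simp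
    then show ?thesis by (simp add: R_def Xx) (simp add: x_def)
  qed
  moreover have "A' * q t\<^sub>0 x \<le> A' * (K * d * \<xi>)"
  proof (rule mult_left_mono[OF _ A'0])
    have "q t\<^sub>0 x = \<xi> * \<xi> + K * (\<xi> * (d - \<xi>))"
      unfolding q_def Xx by (simp add: x_def bb)
    \<comment> \<open>The square of \<xi> is absorbed because \<open>K \<ge> 1\<close>.\<close>
    also have "\<dots> \<le> K * d * \<xi>"
      using \<xi> by (simp add: K_def algebra_simps)
    finally show "q t\<^sub>0 x \<le> K * d * \<xi>" .
  qed
  moreover have "A' * (K * d * \<xi>) = 2 * K * A / d * \<xi>"
    using d by (simp add: A'_def field_simps power2_eq_square)
  ultimately show ?thesis by (simp add: x_def K_def)
qed

text \<open>The reflection estimate bounds a symmetric difference linearly in its step \<xi>;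
  dividing by 2\<xi> and letting \<xi> tend to 0 gives the derivative. A larger derivative would
  violate the estimate for small steps.\<close>

lemma heat_gradient_upper_bound:
  fixes x\<^sub>0 :: "'a::euclidean_space"
  assumes heat: "heat {t\<^sub>0 - d\<^sup>2<..t\<^sub>0} (ball x\<^sub>0 d) w g h"
    and d: "d > 0" and b: "b \<in> Basis"
    and A: "\<And>t x. t \<in> {t\<^sub>0 - d\<^sup>2<..t\<^sub>0} \<Longrightarrow> x \<in> ball x\<^sub>0 d \<Longrightarrow> \<bar>w t x\<bar> \<le> A"
  shows "g b t\<^sub>0 x\<^sub>0 \<le> (real DIM('a) + 1) * A / d"
proof (rule ccontr)
  define C where "C = (real DIM('a) + 1) * A / d"
  assume "\<not> g b t\<^sub>0 x\<^sub>0 \<le> (real DIM('a) + 1) * A / d"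
  then have pos: "0 < 2 * g b t\<^sub>0 x\<^sub>0 - 2 * C" by (simp add: C_def)
  have "(w t\<^sub>0 has_derivative (\<lambda>v. \<Sum>b\<in>Basis. g b t\<^sub>0 x\<^sub>0 * (v \<bullet> b))) (at x\<^sub>0)"
    using heatD(1)[OF heat] d by simp
  note axis = has_real_derivative_along_axis[OF this b]
  have "((\<lambda>r. w t\<^sub>0 (x\<^sub>0 + r *\<^sub>R b) - w t\<^sub>0 (x\<^sub>0 + (- r) *\<^sub>R b) - 2 * C * r)
      has_real_derivative 2 * g b t\<^sub>0 x\<^sub>0 - 2 * C) (at 0)"
    by (rule derivative_eq_intros axis | simp)+
  from DERIV_pos_inc_right[OF this pos] obtain \<delta> where \<delta>: "\<delta> > 0"
    "\<And>r. 0 < r \<Longrightarrow> r < \<delta> \<Longrightarrow> 0 < w t\<^sub>0 (x\<^sub>0 + r *\<^sub>R b) - w t\<^sub>0 (x\<^sub>0 + (- r) *\<^sub>R b) - 2 * C * r"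
    by auto
  define r where "r = min \<delta> d / 2"
  have r: "0 < r" "r < \<delta>" "r < d" using \<delta> d by (auto simp: r_def)
  show False
    using heat_reflection_estimate[OF heat d b A r(1,3)] \<delta>(2)[OF r(1,2)]
    by (simp add: C_def algebra_simps)
qed

lemma heat_gradient_bound:
  fixes x\<^sub>0 :: "'a::euclidean_space"
  assumes heat: "heat {t\<^sub>0 - d\<^sup>2<..t\<^sub>0} (ball x\<^sub>0 d) w g h"
    and d: "d > 0" and b: "b \<in> Basis"
    and A: "\<And>t x. t \<in> {t\<^sub>0 - d\<^sup>2<..t\<^sub>0} \<Longrightarrow> x \<in> ball x\<^sub>0 d \<Longrightarrow> \<bar>w t x\<bar> \<le> A"
  shows "\<bar>g b t\<^sub>0 x\<^sub>0\<bar> \<le> (real DIM('a) + 1) * A / d"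
  using heat_gradient_upper_bound[OF heat d b A]
    heat_gradient_upper_bound[OF heat_lincomb[OF heat heat_zero, of "-1" 0] d b, of A] A
  by simp

lemma mean_value_along_line:
  fixes f :: "'a::real_vector \<Rightarrow> real"
  assumes "\<eta> > 0"
    and "\<And>r. 0 \<le> r \<Longrightarrow> r \<le> \<eta> \<Longrightarrow>
           ((\<lambda>s. f (x + r *\<^sub>R v + s *\<^sub>R v)) has_real_derivative D (x + r *\<^sub>R v)) (at 0)"
  obtains r where "0 < r" "r < \<eta>" "f (x + \<eta> *\<^sub>R v) - f x = \<eta> * D (x + r *\<^sub>R v)"
proof -
  have "\<exists>r. 0 < r \<and> r < \<eta> \<and>
      f (x + \<eta> *\<^sub>R v) - f (x + 0 *\<^sub>R v) = (\<eta> - 0) * D (x + r *\<^sub>R v)"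
  proof (rule MVT2)
    show "((\<lambda>r. f (x + r *\<^sub>R v)) has_real_derivative D (x + r *\<^sub>R v)) (at r)"
      if "0 \<le> r" "r \<le> \<eta>" for r
      by (rule has_real_derivative_shift, rule assms(2)[OF that])
  qed (rule assms)
  then show ?thesis using that by auto
qed

lemma heat_mean_value:
  assumes "heat I S w g h" "t \<in> I" "c \<in> Basis" "\<eta> > 0"
    and "\<And>r. 0 \<le> r \<Longrightarrow> r \<le> \<eta> \<Longrightarrow> x + r *\<^sub>R c \<in> S"
  obtains r where "0 < r" "r < \<eta>" "(w t (x + \<eta> *\<^sub>R c) - w t x) / \<eta> = g c t (x + r *\<^sub>R c)"
proof (rule mean_value_along_line[OF assms(4)])
  show "((\<lambda>s. w t (x + r *\<^sub>R c + s *\<^sub>R c)) has_real_derivative g c t (x + r *\<^sub>R c)) (at 0)"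
    if "0 \<le> r" "r \<le> \<eta>" for r
    by (rule has_real_derivative_along_axis(1)[OF heatD(1)[OF assms(1,2)] assms(3)])
      (rule assms(5)[OF that])
  fix r assume "0 < r" "r < \<eta>" "w t (x + \<eta> *\<^sub>R c) - w t x = \<eta> * g c t (x + r *\<^sub>R c)"
  then show ?thesis using that[of r] \<open>\<eta> > 0\<close> by simp
qed

text \<open>The gradient bound applied to difference quotients, which are again solutions.\<close>

lemma heat_hessian_bound:
  fixes x\<^sub>0 :: "'a::euclidean_space"
  assumes heat: "heat {t\<^sub>0 - d\<^sup>2<..t\<^sub>0} (ball x\<^sub>0 d) w g h"
    and d: "d > 0" and b: "b \<in> Basis" and c: "c \<in> Basis"
    and A: "\<And>t x. t \<in> {t\<^sub>0 - d\<^sup>2<..t\<^sub>0} \<Longrightarrow> x \<in> ball x\<^sub>0 d \<Longrightarrow> \<bar>w t x\<bar> \<le> A"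
  shows "\<bar>h b c t\<^sub>0 x\<^sub>0\<bar> \<le> 8 * (real DIM('a) + 1)\<^sup>2 * A / d\<^sup>2"
proof -
  define K where "K = real DIM('a) + 1"
  define I where "I = {t\<^sub>0 - (d/4)\<^sup>2<..t\<^sub>0}"
  have ball: "ball x r \<subseteq> ball x\<^sub>0 d" if "dist x\<^sub>0 x + r \<le> d" for x r
    using that by (simp add: ball_subset_ball_iff dist_commute)
  have sq: "(d/4)\<^sup>2 = d\<^sup>2 / 16" "(d/2)\<^sup>2 = d\<^sup>2 / 4" by (simp_all add: power_divide)
  \<comment> \<open>Half of the radius pays for this gradient bound, a quarter for the gradient of
    the quotient, a quarter for the step of the quotient. The divisors \<open>d/2\<close> and
    \<open>d/4\<close> produce the final factor 8.\<close>
  have g: "\<bar>g c s y\<bar> \<le> K * A / (d/2)" if "s \<in> I" "y \<in> ball x\<^sub>0 (d/2)" for s y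
    unfolding K_def
  proof (rule heat_gradient_bound[where g = g and t\<^sub>0 = s and x\<^sub>0 = y, OF _ _ c])
    have sub: "{s - (d/2)\<^sup>2<..s} \<subseteq> {t\<^sub>0 - d\<^sup>2<..t\<^sub>0}"
      using that(1) by (auto simp: I_def sq)
    have sub': "ball y (d/2) \<subseteq> ball x\<^sub>0 d" using that(2) by (intro ball) simp
    show "heat {s - (d/2)\<^sup>2<..s} (ball y (d/2)) w g h"
      by (rule heat_subset[OF heat sub sub'])
    show "d/2 > 0" using d by simp
    show "\<bar>w t x\<bar> \<le> A" if "t \<in> {s - (d/2)\<^sup>2<..s}" "x \<in> ball y (d/2)" for t x
      using A that sub sub' by blast
  qed
  have quot: "\<bar>(g b t\<^sub>0 (x\<^sub>0 + \<eta> *\<^sub>R c) - g b t\<^sub>0 x\<^sub>0) / \<eta>\<bar> \<le> K * (K * A / (d/2)) / (d/4)"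
    if \<eta>: "0 < \<eta>" "\<eta> < d/4" for \<eta>
    unfolding K_def
  proof (rule heat_gradient_bound[where t\<^sub>0 = t\<^sub>0 and x\<^sub>0 = x\<^sub>0
        and g = "\<lambda>b t x. (g b t (x + \<eta> *\<^sub>R c) - g b t x) / \<eta>", OF _ _ b])
    have in_ball: "x + r *\<^sub>R c \<in> ball x\<^sub>0 (d/2)"
      if "x \<in> ball x\<^sub>0 (d/4)" "0 \<le> r" "r \<le> \<eta>" for x r
    proof -
      have "dist x\<^sub>0 (x + r *\<^sub>R c) \<le> dist x\<^sub>0 x + dist x (x + r *\<^sub>R c)" by (rule dist_triangle)
      also have "dist x (x + r *\<^sub>R c) = r" using c that by (simp add: dist_norm)
      finally show ?thesis using that \<eta> by simp
    qed
    have heat2: "heat I (ball x\<^sub>0 (d/2)) w g h"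
      by (rule heat_subset[OF heat]) (use d in \<open>auto simp: I_def sq intro!: ball\<close>)
    show "heat {t\<^sub>0 - (d/4)\<^sup>2<..t\<^sub>0} (ball x\<^sub>0 (d/4)) (\<lambda>t x. (w t (x + \<eta> *\<^sub>R c) - w t x) / \<eta>)
      (\<lambda>b t x. (g b t (x + \<eta> *\<^sub>R c) - g b t x) / \<eta>)
      (\<lambda>b b' t x. (h b b' t (x + \<eta> *\<^sub>R c) - h b b' t x) / \<eta>)"
      unfolding I_def[symmetric]
      by (rule heat_diff_quotient[OF heat2]) (use d in_ball[of _ \<eta>] \<eta> in auto)
    show "d/4 > 0" using d by simp
    show "\<bar>(w t (x + \<eta> *\<^sub>R c) - w t x) / \<eta>\<bar> \<le> (real DIM('a) + 1) * A / (d/2)"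
      if "t \<in> {t\<^sub>0 - (d/4)\<^sup>2<..t\<^sub>0}" "x \<in> ball x\<^sub>0 (d/4)" for t x
    proof -
      have t: "t \<in> I" using that by (simp add: I_def)
      note in_ball = in_ball[OF that(2)]
      obtain r where r: "0 < r" "r < \<eta>" "(w t (x + \<eta> *\<^sub>R c) - w t x) / \<eta> = g c t (x + r *\<^sub>R c)"
        using heat_mean_value[OF heat2 t c \<eta>(1) in_ball] by blast
      then show ?thesis using g[OF t in_ball[of r]] by (simp add: K_def)
    qed
  qed
  have "(g b t\<^sub>0 has_derivative (\<lambda>v. \<Sum>c\<in>Basis. h b c t\<^sub>0 x\<^sub>0 * (v \<bullet> c))) (at x\<^sub>0)"
    using heatD(2)[OF heat b] d by simp
  from has_real_derivative_along_axis(1)[OF this c]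
  have "((\<lambda>\<eta>. (g b t\<^sub>0 (x\<^sub>0 + \<eta> *\<^sub>R c) - g b t\<^sub>0 x\<^sub>0) / \<eta>) \<longlongrightarrow> h b c t\<^sub>0 x\<^sub>0) (at 0)"
    by (simp add: DERIV_def)
  then have "((\<lambda>\<eta>. (g b t\<^sub>0 (x\<^sub>0 + \<eta> *\<^sub>R c) - g b t\<^sub>0 x\<^sub>0) / \<eta>) \<longlongrightarrow> h b c t\<^sub>0 x\<^sub>0) (at_right 0)"
    by (rule tendsto_within_subset) simp
  from tendsto_rabs[OF this]
  have "\<bar>h b c t\<^sub>0 x\<^sub>0\<bar> \<le> K * (K * A / (d/2)) / (d/4)"
  proof (rule tendsto_upperbound)
    show "\<forall>\<^sub>F \<eta> in at_right 0.
        \<bar>(g b t\<^sub>0 (x\<^sub>0 + \<eta> *\<^sub>R c) - g b t\<^sub>0 x\<^sub>0) / \<eta>\<bar> \<le> K * (K * A / (d/2)) / (d/4)"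
      by (rule eventually_at_rightI[of 0 "d/4"]) (use quot d in auto)
  qed simp
  also have "\<dots> = 8 * (real DIM('a) + 1)\<^sup>2 * A / d\<^sup>2"
    by (simp add: K_def power2_eq_square field_simps)
  finally show ?thesis .
qed

text \<open>Since \<open>B\<close> is finite, uniform convergence of the coefficients is uniform
  convergence of the derivatives in operator norm. The functionals \<open>l\<close> stay abstract
  for two uses: the coordinates of a space increment, and \<open>l b v = v\<close> for the
  derivative in time.\<close>

lemma has_derivative_uniform_limit:
  fixes f :: "nat \<Rightarrow> 'a::real_normed_vector \<Rightarrow> real"
  assumes "convex S" "open S" "finite B"
    and der: "\<And>n x. x \<in> S \<Longrightarrow> (f n has_derivative (\<lambda>v. \<Sum>b\<in>B. k n b x * l b v)) (at x)"
    and l: "\<And>b v. b \<in> B \<Longrightarrow> \<bar>l b v\<bar> \<le> norm v"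
    and k: "\<And>b. b \<in> B \<Longrightarrow> uniform_limit S (\<lambda>n. k n b) (K b) sequentially"
    and lim: "\<And>x. x \<in> S \<Longrightarrow> (\<lambda>n. f n x) \<longlonglongrightarrow> F x"
    and x: "x \<in> S"
  shows "(F has_derivative (\<lambda>v. \<Sum>b\<in>B. K b x * l b v)) (at x)"
proof -
  have "\<exists>g. \<forall>x\<in>S. (\<lambda>n. f n x) \<longlonglongrightarrow> g x \<and>
      (g has_derivative (\<lambda>v. \<Sum>b\<in>B. K b x * l b v)) (at x within S)"
  proof (rule has_derivative_sequence[where f = f and
        f' = "\<lambda>n x v. \<Sum>b\<in>B. k n b x * l b v"])
    show "convex S" "x \<in> S" "(\<lambda>n. f n x) \<longlonglongrightarrow> F x" using assms by auto
    show "(f n has_derivative (\<lambda>v. \<Sum>b\<in>B. k n b x * l b v)) (at x within S)" if "x \<in> S" for n x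
      by (rule has_derivative_at_withinI[OF der[OF that]])
    fix e :: real assume "e > 0"
    \<comment> \<open>The added 1 covers an empty \<open>B\<close>.\<close>
    define e' where "e' = e / (real (card B) + 1)"
    have e': "e' > 0" using \<open>e > 0\<close> by (simp add: e'_def)
    have "\<forall>\<^sub>F n in sequentially. \<forall>b\<in>B. \<forall>x\<in>S. dist (k n b x) (K b x) < e'"
      using k e' by (intro eventually_ball_finite[OF \<open>finite B\<close>]) (auto simp: uniform_limit_iff)
    then show "\<forall>\<^sub>F n in sequentially. \<forall>x\<in>S. \<forall>v.
        norm ((\<Sum>b\<in>B. k n b x * l b v) - (\<Sum>b\<in>B. K b x * l b v)) \<le> e * norm v"
    proof eventually_elim
      case (elim n)
      show ?case
      proof (intro ballI allI)
        fix x v assume x: "x \<in> S"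
        have "norm ((\<Sum>b\<in>B. k n b x * l b v) - (\<Sum>b\<in>B. K b x * l b v))
            = \<bar>\<Sum>b\<in>B. (k n b x - K b x) * l b v\<bar>"
          by (simp add: sum_subtractf left_diff_distrib)
        also have "\<dots> \<le> (\<Sum>b\<in>B. \<bar>(k n b x - K b x) * l b v\<bar>)" by (rule sum_abs)
        also have "\<dots> \<le> (\<Sum>b\<in>B. e' * norm v)"
          unfolding abs_mult using elim x l e'
          by (intro sum_mono mult_mono) (auto simp: dist_real_def less_imp_le)
        also have "\<dots> = (card B * e') * norm v" by simp
        also have "\<dots> \<le> e * norm v"
          using \<open>e > 0\<close> by (intro mult_right_mono) (auto simp: e'_def field_simps)
        finally show "norm ((\<Sum>b\<in>B. k n b x * l b v) - (\<Sum>b\<in>B. K b x * l b v)) \<le> e * norm v" .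
      qed
    qed
  qed
  then obtain g where g: "\<And>x. x \<in> S \<Longrightarrow> (\<lambda>n. f n x) \<longlonglongrightarrow> g x"
      "\<And>x. x \<in> S \<Longrightarrow> (g has_derivative (\<lambda>v. \<Sum>b\<in>B. K b x * l b v)) (at x within S)" by blast
  have eq: "g y = F y" if "y \<in> S" for y using LIMSEQ_unique[OF g(1)[OF that] lim[OF that]] .
  have "(g has_derivative (\<lambda>v. \<Sum>b\<in>B. K b x * l b v)) (at x)"
    using g(2)[OF x] unfolding at_within_open[OF x \<open>open S\<close>] .
  from has_derivative_transform_within_open[OF this \<open>open S\<close> x eq] show ?thesis .
qed

text \<open>Differences \<open>w m - w n\<close> are solutions of small supremum, so the interior
  bounds make gradients and Hessians uniformly Cauchy on a smaller cylinder, and the limit can be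
  differentiated term by term. Some neighbourhood is enough, since being a solution is a local
  property.\<close>

lemma heat_uniform_limit:
  fixes S :: "'a::euclidean_space set"
  assumes "open I" "open S" "t\<^sub>0 \<in> I" "x\<^sub>0 \<in> S"
    and heat: "\<And>n. heat I S (w n) (g n) (h n)"
    and lim: "uniform_limit (I \<times> S) (\<lambda>n (t, x). w n t x) (\<lambda>(t, x). W t x) sequentially"
  shows "\<exists>I' S' G H. open I' \<and> open S' \<and> t\<^sub>0 \<in> I' \<and> x\<^sub>0 \<in> S' \<and> heat I' S' W G H"
proof -
  obtain d1 where d1: "d1 > 0" "ball t\<^sub>0 d1 \<subseteq> I" using \<open>open I\<close> \<open>t\<^sub>0 \<in> I\<close> openE by blast
  obtain d2 where d2: "d2 > 0" "ball x\<^sub>0 d2 \<subseteq> S" using \<open>open S\<close> \<open>x\<^sub>0 \<in> S\<close> openE by blast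
  \<comment> \<open>Chosen so that every backward cylinder of radius \<open>d\<close> and duration
    \<open>d\<^sup>2\<close> that ends at a point of \<open>I' \<times> S'\<close> stays inside
    \<open>I \<times> S\<close>.\<close>
  define d where "d = min (sqrt (d1 / 2)) (d2 / 2)"
  have d: "d > 0" "2 * d\<^sup>2 \<le> d1" "2 * d \<le> d2"
  proof -
    show "d > 0" using d1 d2 by (simp add: d_def)
    have "d\<^sup>2 \<le> (sqrt (d1 / 2))\<^sup>2"
      using \<open>d > 0\<close> by (intro power_mono) (auto simp: d_def)
    then show "2 * d\<^sup>2 \<le> d1" using d1 by simp
  qed (auto simp: d_def)
  define I' where "I' = ball t\<^sub>0 (d\<^sup>2)"
  define S' where "S' = ball x\<^sub>0 d"
  have sub: "{s - d\<^sup>2<..s} \<subseteq> I" "ball y d \<subseteq> S" if "s \<in> I'" "y \<in> S'" for s y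
  proof -
    have "{s - d\<^sup>2<..s} \<subseteq> ball t\<^sub>0 d1"
      using that d by (auto simp: I'_def dist_real_def abs_if split: if_splits)
    then show "{s - d\<^sup>2<..s} \<subseteq> I" using d1 by blast
    have "ball y d \<subseteq> ball x\<^sub>0 d2"
      using that d by (simp add: S'_def ball_subset_ball_iff dist_commute)
    then show "ball y d \<subseteq> S" using d2 by blast
  qed
  have I'S': "I' \<subseteq> I" "S' \<subseteq> S" "t\<^sub>0 \<in> I'" "x\<^sub>0 \<in> S'" "open I'" "open S'" "convex I'" "convex S'"
  proof -
    show "t\<^sub>0 \<in> I'" "x\<^sub>0 \<in> S'" using d by (auto simp: I'_def S'_def)
    then show "I' \<subseteq> I" "S' \<subseteq> S" using sub d by fastforce+
  qed (auto simp: I'_def S'_def)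
  define K where "K = max ((real DIM('a) + 1) / d) (8 * (real DIM('a) + 1)\<^sup>2 / d\<^sup>2)"
  have K: "K > 0" using d by (simp add: K_def less_max_iff_disj)
  have bounds: "\<bar>g m b t x - g n b t x\<bar> \<le> K * e \<and> \<bar>h m b c t x - h n b c t x\<bar> \<le> K * e"
    if e: "\<And>t x. t \<in> I \<Longrightarrow> x \<in> S \<Longrightarrow> \<bar>w m t x - w n t x\<bar> \<le> e"
      and tx: "t \<in> I'" "x \<in> S'" and b: "b \<in> Basis" and c: "c \<in> Basis" for m n e t x b c
  proof -
    have "heat {t - d\<^sup>2<..t} (ball x d) (\<lambda>t x. w m t x - w n t x) (\<lambda>b t x. g m b t x - g n b t x)
        (\<lambda>b c t x. h m b c t x - h n b c t x)"
      using heat_lincomb[OF heat_subset[OF heat[of m] sub[OF tx]]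
          heat_subset[OF heat[of n] sub[OF tx]], of 1 "-1"] by simp
    moreover have "\<bar>w m s y - w n s y\<bar> \<le> e" if "s \<in> {t - d\<^sup>2<..t}" "y \<in> ball x d" for s y
      using e that sub[OF tx] by blast
    ultimately have "\<bar>g m b t x - g n b t x\<bar> \<le> (real DIM('a) + 1) * e / d"
        "\<bar>h m b c t x - h n b c t x\<bar> \<le> 8 * (real DIM('a) + 1)\<^sup>2 * e / d\<^sup>2"
      using heat_gradient_bound[OF _ d(1) b] heat_hessian_bound[OF _ d(1) b c] by blast+
    moreover have "e \<ge> 0" using e[of t x] tx I'S' by force
    then have "(real DIM('a) + 1) / d * e \<le> K * e" "8 * (real DIM('a) + 1)\<^sup>2 / d\<^sup>2 * e \<le> K * e"
      by (intro mult_right_mono; simp add: K_def)+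
    ultimately show ?thesis by simp
  qed
  have Cauchy: "\<exists>M. \<forall>m\<ge>M. \<forall>n\<ge>M. \<forall>t\<in>I'. \<forall>x\<in>S'. \<forall>b\<in>Basis. \<forall>c\<in>Basis.
      \<bar>g m b t x - g n b t x\<bar> < e \<and> \<bar>h m b c t x - h n b c t x\<bar> < e" if "e > 0" for e
  proof -
    have "uniformly_Cauchy_on (I \<times> S) (\<lambda>n (t, x). w n t x)"
      using lim uniformly_convergent_eq_Cauchy uniformly_convergent_on_def by blast
    moreover have "e / (2 * K) > 0" using that K by simp
    ultimately obtain M where M: "\<And>z m n. z \<in> I \<times> S \<Longrightarrow> m \<ge> M \<Longrightarrow> n \<ge> M \<Longrightarrow>
        dist ((\<lambda>(t, x). w m t x) z) ((\<lambda>(t, x). w n t x) z) < e / (2 * K)"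
      unfolding uniformly_Cauchy_on_def by meson
    have "\<bar>g m b t x - g n b t x\<bar> < e \<and> \<bar>h m b c t x - h n b c t x\<bar> < e"
      if mn: "m \<ge> M" "n \<ge> M" and tx: "t \<in> I'" "x \<in> S'" and bc: "b \<in> Basis" "c \<in> Basis"
      for m n t x b c
    proof -
      have "\<bar>w m t x - w n t x\<bar> \<le> e / (2 * K)" if "t \<in> I" "x \<in> S" for t x
        using M[of "(t, x)" m n] mn that by (simp add: dist_real_def)
      from bounds[OF this tx bc] show ?thesis using K \<open>e > 0\<close> by simp
    qed
    then show ?thesis by blast
  qed
  have "\<exists>G. uniform_limit (I' \<times> S') (\<lambda>n (t, x). g n b t x) G sequentially" if b: "b \<in> Basis" for b
  proof -
    have "uniformly_Cauchy_on (I' \<times> S') (\<lambda>n (t, x). g n b t x)"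
      unfolding uniformly_Cauchy_on_def
    proof (intro allI impI)
      fix e :: real assume "e > 0"
      from Cauchy[OF this] b show "\<exists>M. \<forall>x\<in>I' \<times> S'. \<forall>m\<ge>M. \<forall>n\<ge>M.
          dist (case x of (t, x) \<Rightarrow> g m b t x) (case x of (t, x) \<Rightarrow> g n b t x) < e"
        by (fastforce simp: dist_real_def)
    qed
    then show ?thesis
      using uniformly_convergent_eq_Cauchy uniformly_convergent_on_def by blast
  qed
  then obtain G where G: "\<And>b. b \<in> Basis \<Longrightarrow>
      uniform_limit (I' \<times> S') (\<lambda>n (t, x). g n b t x) (G b) sequentially" by metis
  have "\<exists>H. uniform_limit (I' \<times> S') (\<lambda>n (t, x). h n b c t x) H sequentially"
    if b: "b \<in> Basis" and c: "c \<in> Basis" for b c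
  proof -
    have "uniformly_Cauchy_on (I' \<times> S') (\<lambda>n (t, x). h n b c t x)"
      unfolding uniformly_Cauchy_on_def
    proof (intro allI impI)
      fix e :: real assume "e > 0"
      from Cauchy[OF this] b c show "\<exists>M. \<forall>x\<in>I' \<times> S'. \<forall>m\<ge>M. \<forall>n\<ge>M.
          dist (case x of (t, x) \<Rightarrow> h m b c t x) (case x of (t, x) \<Rightarrow> h n b c t x) < e"
        by (fastforce simp: dist_real_def)
    qed
    then show ?thesis
      using uniformly_convergent_eq_Cauchy uniformly_convergent_on_def by blast
  qed
  then obtain H where H: "\<And>b c. b \<in> Basis \<Longrightarrow> c \<in> Basis \<Longrightarrow>
      uniform_limit (I' \<times> S') (\<lambda>n (t, x). h n b c t x) (H b c) sequentially" by metis
  have ptw: "(\<lambda>n. f n t x) \<longlonglongrightarrow> F (t, x)"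
    if "uniform_limit X (\<lambda>n (t, x). f n t x) F sequentially" "(t, x) \<in> X"
    for f :: "nat \<Rightarrow> real \<Rightarrow> 'a \<Rightarrow> real" and F X t x
    using tendsto_uniform_limitI[OF that] by simp
  have slice_x: "uniform_limit S' (\<lambda>n. f n t) (\<lambda>x. F (t, x)) sequentially"
    if "uniform_limit (I' \<times> S') (\<lambda>n (t, x). f n t x) F sequentially" "t \<in> I'"
    for f :: "nat \<Rightarrow> real \<Rightarrow> 'a \<Rightarrow> real" and F t
    using that by (fastforce simp: uniform_limit_iff elim!: eventually_mono)
  have slice_t: "uniform_limit I' (\<lambda>n t. f n t x) (\<lambda>t. F (t, x)) sequentially"
    if "uniform_limit (I' \<times> S') (\<lambda>n (t, x). f n t x) F sequentially" "x \<in> S'"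
    for f :: "nat \<Rightarrow> real \<Rightarrow> 'a \<Rightarrow> real" and F x
    using that by (fastforce simp: uniform_limit_iff elim!: eventually_mono)
  have W: "(\<lambda>n. w n t x) \<longlonglongrightarrow> W t x" if "t \<in> I'" "x \<in> S'" for t x
    using ptw[OF lim, of t x] that I'S' by auto
  have heat': "heat I' S' (w n) (g n) (h n)" for n by (rule heat_subset[OF heat I'S'(1,2)])
  have "heat I' S' W (\<lambda>b t x. G b (t, x)) (\<lambda>b c t x. H b c (t, x))"
    unfolding heat_def
  proof (intro conjI ballI)
    fix t x assume tx: "t \<in> I'" "x \<in> S'"
    show "(W t has_derivative (\<lambda>v. \<Sum>b\<in>Basis. G b (t, x) * (v \<bullet> b))) (at x)"
      by (rule has_derivative_uniform_limit[where S = S' and f = "\<lambda>n. w n t"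
            and k = "\<lambda>n b. g n b t" and K = "\<lambda>b x. G b (t, x)"])
        (use I'S' tx W heatD(1)[OF heat'] in
          \<open>auto intro!: slice_x[OF G] simp: Basis_le_norm\<close>)
    show "((\<lambda>s. W s x) has_real_derivative (\<Sum>b\<in>Basis. H b b (t, x))) (at t)"
      unfolding has_field_derivative_def sum_distrib_right
      by (rule has_derivative_uniform_limit[where S = I' and f = "\<lambda>n s. w n s x"
            and k = "\<lambda>n b s. h n b b s x" and K = "\<lambda>b s. H b b (s, x)" and l = "\<lambda>b v. v"])
        (use I'S' tx W heatD(3)[OF heat', unfolded has_field_derivative_def sum_distrib_right] in
          \<open>auto intro!: slice_t[OF H]\<close>)
    fix b :: 'a assume b: "b \<in> Basis"
    show "((\<lambda>x. G b (t, x)) has_derivative (\<lambda>v. \<Sum>c\<in>Basis. H b c (t, x) * (v \<bullet> c))) (at x)"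
      by (rule has_derivative_uniform_limit[where S = S' and f = "\<lambda>n. g n b t"
            and k = "\<lambda>n c. h n b c t" and K = "\<lambda>c x. H b c (t, x)"])
        (use I'S' tx b ptw[OF G[OF b]] heatD(2)[OF heat' b] in
          \<open>auto intro!: slice_x[OF H] simp: Basis_le_norm\<close>)
  next
    have "uniform_limit (I' \<times> S') (\<lambda>n (t, x). w n t x) (\<lambda>(t, x). W t x) sequentially"
      by (rule uniform_limit_on_subset[OF lim]) (use I'S' in auto)
    then show "continuous_on (I' \<times> S') (\<lambda>(t, x). W t x)"
      by (rule uniform_limit_theorem[rotated]) (use heatD(4)[OF heat'] in auto)
    fix b :: 'a assume b: "b \<in> Basis"
    have "continuous_on (I' \<times> S') (G b)"
      by (rule uniform_limit_theorem[OF _ G[OF b]]) (use heatD(5)[OF heat' b] in auto)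
    then show "continuous_on (I' \<times> S') (\<lambda>(t, x). G b (t, x))" by simp
  qed
  then show ?thesis using I'S' by blast
qed

section \<open>Directional derivatives of solutions\<close>

lemma dir_deriv_eqI:
  assumes "((\<lambda>r. f (x + r *\<^sub>R \<nu>)) has_real_derivative D) (at 0)"
  shows "dir_deriv \<nu> f x = D"
  unfolding dir_deriv_def by (rule DERIV_imp_deriv[OF assms])

lemma dir_deriv_cong:
  assumes "open S" "x \<in> S" "\<And>y. y \<in> S \<Longrightarrow> f y = g y"
  shows "dir_deriv \<nu> f x = dir_deriv \<nu> g x"
  unfolding dir_deriv_def
proof (rule deriv_cong_ev)
  have "((\<lambda>r::real. x + r *\<^sub>R \<nu>) \<longlongrightarrow> x + 0 *\<^sub>R \<nu>) (nhds 0)"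
    by (intro tendsto_intros filterlim_ident)
  then have "\<forall>\<^sub>F r in nhds 0. x + r *\<^sub>R \<nu> \<in> S"
    by (rule topological_tendstoD) (use assms(1,2) in auto)
  then show "\<forall>\<^sub>F r in nhds 0. f (x + r *\<^sub>R \<nu>) = g (x + r *\<^sub>R \<nu>)"
    by eventually_elim (rule assms(3))
qed simp

lemma dir_deriv_iter_cong:
  assumes "open S" "x \<in> S" "\<And>y. y \<in> S \<Longrightarrow> f y = g y"
  shows "dir_deriv_iter k \<nu> f x = dir_deriv_iter k \<nu> g x"
  using assms(2)
proof (induction k arbitrary: x)
  case 0
  then show ?case using assms(3) by (simp add: dir_deriv_iter_def)
next
  case (Suc k)
  have "dir_deriv \<nu> (dir_deriv_iter k \<nu> f) x = dir_deriv \<nu> (dir_deriv_iter k \<nu> g) x"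
    by (rule dir_deriv_cong[OF \<open>open S\<close> Suc.prems Suc.IH])
  then show ?case by (simp add: dir_deriv_iter_def)
qed

lemma dir_deriv_iter_Suc:
  "dir_deriv_iter (Suc k) \<nu> f = dir_deriv \<nu> (dir_deriv_iter k \<nu> f)"
  by (simp add: dir_deriv_iter_def)

lemma differentiable_dir_deriv:
  fixes f :: "'a::euclidean_space \<Rightarrow> real"
  assumes "f differentiable (at x)"
  shows "dir_deriv \<nu> f x = frechet_derivative f (at x) \<nu>"
    and "((\<lambda>r. f (x + r *\<^sub>R \<nu>)) has_real_derivative dir_deriv \<nu> f x) (at 0)"
    and "(f has_derivative (\<lambda>v. \<Sum>b\<in>Basis. dir_deriv b f x * (v \<bullet> b))) (at x)"
proof -
  let ?D = "frechet_derivative f (at x)"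
  have D: "(f has_derivative ?D) (at x)" using assms frechet_derivative_works by blast
  note line = has_real_derivative_along_line[OF D]
  show eq: "dir_deriv \<nu> f x = ?D \<nu>" for \<nu> by (rule dir_deriv_eqI[OF line])
  show "((\<lambda>r. f (x + r *\<^sub>R \<nu>)) has_real_derivative dir_deriv \<nu> f x) (at 0)"
    unfolding eq by (rule line)
  have "linear ?D" by (rule has_derivative_linear[OF D])
  then have "?D v = (\<Sum>b\<in>Basis. (v \<bullet> b) *\<^sub>R ?D b)" for v
    using linear_sum[of ?D "\<lambda>b. (v \<bullet> b) *\<^sub>R b" Basis] linear_scale[of ?D]
    unfolding euclidean_representation by simp
  then have "?D = (\<lambda>v. \<Sum>b\<in>Basis. dir_deriv b f x * (v \<bullet> b))"
    unfolding eq real_scaleR_def mult.commute[of "?D _"] by blast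
  then show "(f has_derivative (\<lambda>v. \<Sum>b\<in>Basis. dir_deriv b f x * (v \<bullet> b))) (at x)"
    using D by simp
qed

text \<open>Neighbourhoods obtained from separate existence proofs carry unrelated \<open>g\<close>
  and \<open>h\<close>. Directional derivatives are canonical witnesses that agree on overlaps, so
  local solutions can be glued.\<close>

abbreviation heat_solution ::
    "real set \<Rightarrow> 'a::euclidean_space set \<Rightarrow> (real \<Rightarrow> 'a \<Rightarrow> real) \<Rightarrow> bool" where
  "heat_solution I S w \<equiv> heat I S w (\<lambda>b t. dir_deriv b (w t))
     (\<lambda>b c t. dir_deriv c (dir_deriv b (w t)))"

lemma heat_imp_dir_deriv:
  assumes "open S" "heat I S w g h" "t \<in> I" "x \<in> S" "b \<in> Basis"
  shows "dir_deriv b (w t) x = g b t x"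
    and "c \<in> Basis \<Longrightarrow> dir_deriv c (dir_deriv b (w t)) x = h b c t x"
proof -
  have 1: "dir_deriv b (w t) x = g b t x" if "x \<in> S" for x
    by (rule dir_deriv_eqI[OF has_real_derivative_along_axis(1)])
      (use heatD(1)[OF assms(2,3) that] assms(5) in auto)
  then show "dir_deriv b (w t) x = g b t x" using assms(4) .
  assume c: "c \<in> Basis"
  have "dir_deriv c (dir_deriv b (w t)) x = dir_deriv c (g b t) x"
    by (rule dir_deriv_cong[OF assms(1,4) 1])
  also have "\<dots> = h b c t x"
    by (rule dir_deriv_eqI[OF has_real_derivative_along_axis(1)])
      (use heatD(2)[OF assms(2,5,3,4)] c in auto)
  finally show "dir_deriv c (dir_deriv b (w t)) x = h b c t x" .
qed

lemma heat_imp_heat_solution: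
  assumes "open S" "heat I S w g h"
  shows "heat_solution I S w"
  unfolding heat_def
proof (intro conjI ballI)
  note eq = heat_imp_dir_deriv[OF assms]
  fix t x assume tx: "t \<in> I" "x \<in> S"
  show "(w t has_derivative (\<lambda>v. \<Sum>b\<in>Basis. dir_deriv b (w t) x * (v \<bullet> b))) (at x)"
    using heatD(1)[OF assms(2) tx] eq[OF tx] by simp
  show "((\<lambda>s. w s x) has_real_derivative (\<Sum>b\<in>Basis. dir_deriv b (dir_deriv b (w t)) x)) (at t)"
    using heatD(3)[OF assms(2) tx] eq[OF tx] by simp
  fix b :: 'a assume b: "b \<in> Basis"
  have "(g b t has_derivative (\<lambda>v. \<Sum>c\<in>Basis. dir_deriv c (dir_deriv b (w t)) x * (v \<bullet> c))) (at x)"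
    using heatD(2)[OF assms(2) b tx] eq[OF tx b] by simp
  then show "(dir_deriv b (w t) has_derivative
      (\<lambda>v. \<Sum>c\<in>Basis. dir_deriv c (dir_deriv b (w t)) x * (v \<bullet> c))) (at x)"
    by (rule has_derivative_transform_within_open[OF _ assms(1) tx(2)])
      (simp add: eq(1)[OF tx(1) _ b])
next
  show "continuous_on (I \<times> S) (\<lambda>(t, x). w t x)" by (rule heatD(4)[OF assms(2)])
  fix b :: 'a assume b: "b \<in> Basis"
  have "continuous_on (I \<times> S) (\<lambda>(t, x). dir_deriv b (w t) x)
      = continuous_on (I \<times> S) (\<lambda>(t, x). g b t x)"
    by (rule continuous_on_cong) (auto simp: heat_imp_dir_deriv[OF assms _ _ b])
  then show "continuous_on (I \<times> S) (\<lambda>(t, x). dir_deriv b (w t) x)"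
    using heatD(5)[OF assms(2) b] by simp
qed

lemma heat_solution_local:
  assumes "open I" "open S"
    and local: "\<And>t x. t \<in> I \<Longrightarrow> x \<in> S \<Longrightarrow>
      \<exists>I' S' g h. open I' \<and> open S' \<and> t \<in> I' \<and> x \<in> S' \<and> heat I' S' w g h"
  shows "heat_solution I S w"
proof -
  have ex: "\<exists>I' S'. open (I' \<times> S') \<and> t \<in> I' \<and> x \<in> S' \<and> heat_solution I' S' w"
    if "t \<in> I" "x \<in> S" for t x
    using local[OF that] heat_imp_heat_solution open_Times by blast
  have cont: "continuous_on (I \<times> S) f"
    if f: "\<And>I' S'. heat_solution I' S' w \<Longrightarrow> continuous_on (I' \<times> S') f" for f :: "real \<times> 'a \<Rightarrow> real"
    unfolding continuous_on_eq_continuous_at[OF open_Times[OF assms(1,2)]]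
  proof safe
    fix t x assume "t \<in> I" "x \<in> S"
    from ex[OF this] f show "isCont f (t, x)"
      using continuous_on_eq_continuous_at by blast
  qed
  show ?thesis
    unfolding heat_def
  proof (intro conjI ballI)
    fix t x assume "t \<in> I" "x \<in> S"
    from ex[OF this] obtain I' S' where tx: "t \<in> I'" "x \<in> S'" and heat: "heat_solution I' S' w"
      by blast
    show "(w t has_derivative (\<lambda>v. \<Sum>b\<in>Basis. dir_deriv b (w t) x * (v \<bullet> b))) (at x)"
      by (rule heatD(1)[OF heat tx])
    show "((\<lambda>s. w s x) has_real_derivative (\<Sum>b\<in>Basis. dir_deriv b (dir_deriv b (w t)) x)) (at t)"
      by (rule heatD(3)[OF heat tx])
    fix b :: 'a assume b: "b \<in> Basis"
    show "(dir_deriv b (w t) has_derivative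
        (\<lambda>v. \<Sum>c\<in>Basis. dir_deriv c (dir_deriv b (w t)) x * (v \<bullet> c))) (at x)"
      by (rule heatD(2)[OF heat b tx])
  next
    show "continuous_on (I \<times> S) (\<lambda>(t, x). w t x)" by (rule cont, rule heatD(4))
    show "continuous_on (I \<times> S) (\<lambda>(t, x). dir_deriv b (w t) x)" if "b \<in> Basis" for b
      by (rule cont, rule heatD(5)[OF _ that])
  qed
qed

text \<open>This gains one derivative, and iteration gives all orders. Quotients in direction
  \<open>c\<close> are solutions; by the mean value theorem and uniform continuity of
  \<open>g c\<close> on a compact cylinder they converge to \<open>g c\<close> uniformly near each
  point.\<close>

lemma heat_partial_deriv:
  fixes S :: "'a::euclidean_space set"
  assumes "open I" "open S" and heat: "heat I S w g h" and c: "c \<in> Basis"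
  shows "heat_solution I S (g c)"
proof (rule heat_solution_local[OF assms(1,2)])
  fix t\<^sub>0 x\<^sub>0 assume tx: "t\<^sub>0 \<in> I" "x\<^sub>0 \<in> S"
  obtain \<tau> where \<tau>: "\<tau> > 0" "cball t\<^sub>0 \<tau> \<subseteq> I" using \<open>open I\<close> tx open_contains_cball by blast
  obtain d where d: "d > 0" "cball x\<^sub>0 d \<subseteq> S" using \<open>open S\<close> tx open_contains_cball by blast
  \<comment> \<open>The other half of the radius is reserved for the steps, which are at most
    \<rho>.\<close>
  define \<rho> where "\<rho> = d / 2"
  have \<rho>: "\<rho> > 0" using d by (simp add: \<rho>_def)
  have shift: "x + r *\<^sub>R c \<in> cball x\<^sub>0 d" if "x \<in> ball x\<^sub>0 \<rho>" "0 \<le> r" "r \<le> \<rho>" for x r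
  proof -
    have "dist x\<^sub>0 (x + r *\<^sub>R c) \<le> dist x\<^sub>0 x + dist x (x + r *\<^sub>R c)" by (rule dist_triangle)
    also have "dist x (x + r *\<^sub>R c) = r" using c that by (simp add: dist_norm)
    finally show ?thesis using that by (simp add: \<rho>_def)
  qed
  have heat': "heat (ball t\<^sub>0 \<tau>) S w g h"
    by (rule heat_subset[OF heat]) (use \<tau> ball_subset_cball in auto)
  define \<eta> where "\<eta> n = \<rho> / real (Suc n)" for n
  have \<eta>: "0 < \<eta> n" "\<eta> n \<le> \<rho>" for n
    using \<rho> by (auto simp: \<eta>_def field_simps)
  have \<eta>_lim: "\<eta> \<longlonglongrightarrow> 0" unfolding \<eta>_def
    by (rule LIMSEQ_Suc[OF lim_const_over_n])
  show "\<exists>I' S' G H. open I' \<and> open S' \<and> t\<^sub>0 \<in> I' \<and> x\<^sub>0 \<in> S' \<and> heat I' S' (g c) G H"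
  proof (rule heat_uniform_limit)
    show "open (ball t\<^sub>0 \<tau>)" "open (ball x\<^sub>0 \<rho>)" "t\<^sub>0 \<in> ball t\<^sub>0 \<tau>" "x\<^sub>0 \<in> ball x\<^sub>0 \<rho>"
      using \<tau> \<rho> by auto
    have *: "x + 0 *\<^sub>R c \<in> S" if "x \<in> ball x\<^sub>0 \<rho>" for x using shift[OF that, of 0] \<rho> d by auto
    show "heat (ball t\<^sub>0 \<tau>) (ball x\<^sub>0 \<rho>) (\<lambda>t x. (w t (x + \<eta> n *\<^sub>R c) - w t x) / \<eta> n)
        (\<lambda>b t x. (g b t (x + \<eta> n *\<^sub>R c) - g b t x) / \<eta> n)
        (\<lambda>b b' t x. (h b b' t (x + \<eta> n *\<^sub>R c) - h b b' t x) / \<eta> n)" for n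
      by (rule heat_diff_quotient[OF heat'])
        (use * shift[of _ "\<eta> n"] \<eta>[of n] d in \<open>auto simp: less_imp_le\<close>)
    show "uniform_limit (ball t\<^sub>0 \<tau> \<times> ball x\<^sub>0 \<rho>)
        (\<lambda>n (t, x). (w t (x + \<eta> n *\<^sub>R c) - w t x) / \<eta> n) (\<lambda>(t, x). g c t x) sequentially"
      unfolding uniform_limit_iff
    proof (intro allI impI)
      fix e :: real assume "e > 0"
      have "uniformly_continuous_on (cball t\<^sub>0 \<tau> \<times> cball x\<^sub>0 d) (\<lambda>(t, x). g c t x)"
        by (intro compact_uniformly_continuous continuous_on_subset[OF heatD(5)[OF heat c]]
            compact_Times) (use \<tau> d in auto)
      then obtain \<delta> where \<delta>: "\<delta> > 0" "\<And>z z'. z \<in> cball t\<^sub>0 \<tau> \<times> cball x\<^sub>0 d \<Longrightarrow>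
          z' \<in> cball t\<^sub>0 \<tau> \<times> cball x\<^sub>0 d \<Longrightarrow> dist z' z < \<delta> \<Longrightarrow>
          dist (case z' of (t, x) \<Rightarrow> g c t x) (case z of (t, x) \<Rightarrow> g c t x) < e"
        using \<open>e > 0\<close> unfolding uniformly_continuous_on_def by meson
      have "\<forall>\<^sub>F n in sequentially. \<eta> n < \<delta>" by (rule order_tendstoD(2)[OF \<eta>_lim \<delta>(1)])
      then show "\<forall>\<^sub>F n in sequentially. \<forall>z\<in>ball t\<^sub>0 \<tau> \<times> ball x\<^sub>0 \<rho>.
          dist (case z of (t, x) \<Rightarrow> (w t (x + \<eta> n *\<^sub>R c) - w t x) / \<eta> n)
            (case z of (t, x) \<Rightarrow> g c t x) < e"
      proof eventually_elim
        case (elim n)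
        show ?case
        proof safe
          fix t x assume t: "t \<in> ball t\<^sub>0 \<tau>" and x: "x \<in> ball x\<^sub>0 \<rho>"
          have inS: "x + r *\<^sub>R c \<in> S" if "0 \<le> r" "r \<le> \<eta> n" for r
            using shift[OF x that(1)] that(2) \<eta>[of n] d by auto
          obtain r where r: "0 < r" "r < \<eta> n"
              "(w t (x + \<eta> n *\<^sub>R c) - w t x) / \<eta> n = g c t (x + r *\<^sub>R c)"
            using heat_mean_value[OF heat' t c \<eta>(1)[of n] inS] by blast
          have "dist (t, x + r *\<^sub>R c) (t, x) < \<delta>"
            using r elim c by (simp add: dist_Pair_Pair) (simp add: dist_norm)
          then show "dist ((w t (x + \<eta> n *\<^sub>R c) - w t x) / \<eta> n) (g c t x) < e"
            using \<delta>(2)[of "(t, x)" "(t, x + r *\<^sub>R c)"] r \<eta>[of n] t x shift[OF x, of r] shift[OF x, of 0] \<rho>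
            by auto
        qed
      qed
    qed
  qed
qed

text \<open>The derivative along \<nu> is a linear combination of partial derivatives, each of them
  a solution. The second claim is recorded because \<open>dir_deriv\<close> denotes some value even
  where the limit does not exist.\<close>

lemma heat_solution_dir_deriv:
  assumes "open I" "open S" and heat: "heat_solution I S w"
  shows "heat_solution I S (\<lambda>t. dir_deriv \<nu> (w t))"
    and "\<And>t x. t \<in> I \<Longrightarrow> x \<in> S \<Longrightarrow>
      ((\<lambda>r. w t (x + r *\<^sub>R \<nu>)) has_real_derivative dir_deriv \<nu> (w t) x) (at 0)"
proof -
  have line: "((\<lambda>r. w t (x + r *\<^sub>R \<nu>)) has_real_derivative
      (\<Sum>b\<in>Basis. (\<nu> \<bullet> b) * dir_deriv b (w t) x)) (at 0)" if "t \<in> I" "x \<in> S" for t x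
    using has_real_derivative_along_line[OF heatD(1)[OF heat that]] by (simp add: mult.commute)
  note eq = dir_deriv_eqI[OF line]
  show "((\<lambda>r. w t (x + r *\<^sub>R \<nu>)) has_real_derivative dir_deriv \<nu> (w t) x) (at 0)"
    if "t \<in> I" "x \<in> S" for t x
    unfolding eq[OF that] by (rule line[OF that])
  have "\<exists>g h. heat I S (\<lambda>t x. \<Sum>b\<in>Basis. (\<nu> \<bullet> b) * dir_deriv b (w t) x) g h"
    by (rule heat_sum[OF finite_Basis]) (rule heat_partial_deriv[OF assms])
  then obtain g h where "heat I S (\<lambda>t x. \<Sum>b\<in>Basis. (\<nu> \<bullet> b) * dir_deriv b (w t) x) g h"
    by blast
  from heat_cong[OF assms(1,2) this eq]
  have "heat I S (\<lambda>t. dir_deriv \<nu> (w t)) g h" .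
  then show "heat_solution I S (\<lambda>t. dir_deriv \<nu> (w t))"
    by (rule heat_imp_heat_solution[OF assms(2)])
qed

lemma heat_solution_dir_deriv_iter:
  assumes "open I" "open S" "heat_solution I S w"
  shows "heat_solution I S (\<lambda>t. dir_deriv_iter k \<nu> (w t))"
proof (induction k)
  case 0
  then show ?case using assms(3) by (simp add: dir_deriv_iter_def)
next
  case (Suc k)
  then show ?case
    using heat_solution_dir_deriv(1)[OF assms(1,2) Suc] by (simp add: dir_deriv_iter_Suc)
qed

text \<open>\<open>heat\<close> includes continuity of first derivatives; second derivatives are
  first derivatives of the solution \<open>dir_deriv b (w t)\<close>.\<close>

lemma heat_solution_continuous_hessian:
  assumes "open I" "open S" "heat_solution I S w" "b \<in> Basis" "c \<in> Basis"
  shows "continuous_on (I \<times> S) (\<lambda>(t, x). dir_deriv c (dir_deriv b (w t)) x)"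
  using heatD(5)[OF heat_partial_deriv[OF assms(1-4)] assms(5)] .

lemma solves_heat_imp_heat_solution:
  assumes "open \<Omega>" "solves_heat \<Omega> u"
  shows "heat_solution {0<..} \<Omega> u"
  unfolding heat_def
proof (intro conjI ballI)
  have C2: "Ck_on (Suc (Suc 0)) \<Omega> (u t)" if "t > 0" for t
    using assms(2) that unfolding solves_heat_def numeral_2_eq_2 by blast
  have d1: "u t differentiable (at x)" if "t > 0" "x \<in> \<Omega>" for t x
    using C2[OF that(1)] that(2) by simp
  fix t x assume "t \<in> {0::real<..}" and x: "x \<in> \<Omega>"
  then have t: "t > 0" by simp
  show "(u t has_derivative (\<lambda>v. \<Sum>b\<in>Basis. dir_deriv b (u t) x * (v \<bullet> b))) (at x)"
    by (rule differentiable_dir_deriv(3)[OF d1[OF t x]])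
  have "laplacian (u t) x = (\<Sum>b\<in>Basis. dir_deriv b (dir_deriv b (u t)) x)"
    by (simp add: laplacian_def dir_deriv_iter_def numeral_2_eq_2)
  moreover have "((\<lambda>s. u s x) has_real_derivative laplacian (u t) x) (at t)"
    using assms(2) t x unfolding solves_heat_def by blast
  ultimately show "((\<lambda>s. u s x) has_real_derivative
      (\<Sum>b\<in>Basis. dir_deriv b (dir_deriv b (u t)) x)) (at t)" by simp
  fix b :: 'a
  \<comment> \<open>The second layer of \<open>Ck_on\<close> speaks of Frechet derivatives in a
    fixed direction; on the open \<Omega> these coincide with \<open>dir_deriv\<close>.\<close>
  have "(\<lambda>y. frechet_derivative (u t) (at y) b) differentiable (at x)"
    using C2[OF t] x by simp
  then obtain D where "((\<lambda>y. frechet_derivative (u t) (at y) b) has_derivative D) (at x)"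
    by (auto simp: differentiable_def)
  then have "(dir_deriv b (u t) has_derivative D) (at x)"
    by (rule has_derivative_transform_within_open[OF _ assms(1) x])
      (simp add: differentiable_dir_deriv(1)[OF d1[OF t]])
  then have "dir_deriv b (u t) differentiable (at x)" by (auto simp: differentiable_def)
  then show "(dir_deriv b (u t) has_derivative
      (\<lambda>v. \<Sum>c\<in>Basis. dir_deriv c (dir_deriv b (u t)) x * (v \<bullet> c))) (at x)"
    by (rule differentiable_dir_deriv(3))
qed (use assms(2) in \<open>auto simp: solves_heat_def\<close>)

section \<open>Continuity up to the initial time\<close>

text \<open>The forward difference of order \<open>k\<close> divided by the \<open>k\<close>-th
  power of the step. Recursion on the innermost quotient suits inductions over functions, since a
  quotient of a solution is again a solution.\<close>

primrec diff_quot :: "real \<Rightarrow> 'a::real_vector \<Rightarrow> nat \<Rightarrow> ('a \<Rightarrow> real) \<Rightarrow> 'a \<Rightarrow> real" where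
  "diff_quot \<eta> \<nu> 0 f = f"
| "diff_quot \<eta> \<nu> (Suc k) f = diff_quot \<eta> \<nu> k (\<lambda>x. (f (x + \<eta> *\<^sub>R \<nu>) - f x) / \<eta>)"

text \<open>A chain of successive derivatives remains one when every member is replaced by its
  difference quotient, so the induction runs over chains. One further mean value step turns the
  remaining quotient into a derivative and moves the intermediate point by less than \<eta>, hence
  the range up to \<open>k * \<eta>\<close>.\<close>

lemma diff_quot_mean_value:
  fixes F :: "nat \<Rightarrow> 'a::real_vector \<Rightarrow> real" and \<eta> :: real
  assumes "\<eta> > 0"
    and "\<And>j (r::real). j < k \<Longrightarrow> 0 \<le> r \<Longrightarrow> r \<le> k * \<eta> \<Longrightarrow>
           ((\<lambda>s. F j (x + r *\<^sub>R \<nu> + s *\<^sub>R \<nu>)) has_real_derivative F (Suc j) (x + r *\<^sub>R \<nu>)) (at 0)"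
  shows "\<exists>r. 0 \<le> r \<and> r \<le> k * \<eta> \<and> diff_quot \<eta> \<nu> k (F 0) x = F k (x + r *\<^sub>R \<nu>)"
  using assms(2)
proof (induction k arbitrary: F)
  case 0
  then show ?case by (intro exI[of _ 0]) simp
next
  case (Suc k)
  define G where "G j y = (F j (y + \<eta> *\<^sub>R \<nu>) - F j y) / \<eta>" for j y
  have "\<exists>r. 0 \<le> r \<and> r \<le> k * \<eta> \<and> diff_quot \<eta> \<nu> k (G 0) x = G k (x + r *\<^sub>R \<nu>)"
  proof (rule Suc.IH)
    fix j and r :: real assume j: "j < k" and r: "0 \<le> r" "r \<le> k * \<eta>"
    have 1: "((\<lambda>s. F j (x + r *\<^sub>R \<nu> + s *\<^sub>R \<nu>)) has_real_derivative F (Suc j) (x + r *\<^sub>R \<nu>)) (at 0)"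
      by (rule Suc.prems) (use j r \<open>\<eta> > 0\<close> in \<open>auto simp: algebra_simps\<close>)
    have "((\<lambda>s. F j (x + (r + \<eta>) *\<^sub>R \<nu> + s *\<^sub>R \<nu>)) has_real_derivative
        F (Suc j) (x + (r + \<eta>) *\<^sub>R \<nu>)) (at 0)"
      by (rule Suc.prems) (use j r \<open>\<eta> > 0\<close> in \<open>auto simp: algebra_simps\<close>)
    moreover have "x + (r + \<eta>) *\<^sub>R \<nu> = x + r *\<^sub>R \<nu> + \<eta> *\<^sub>R \<nu>"
      by (simp add: scaleR_left_distrib)
    moreover have "(\<lambda>s. F j (x + r *\<^sub>R \<nu> + \<eta> *\<^sub>R \<nu> + s *\<^sub>R \<nu>))
        = (\<lambda>s. F j (x + r *\<^sub>R \<nu> + s *\<^sub>R \<nu> + \<eta> *\<^sub>R \<nu>))" by (simp add: add_ac)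
    ultimately have 2: "((\<lambda>s. F j (x + r *\<^sub>R \<nu> + s *\<^sub>R \<nu> + \<eta> *\<^sub>R \<nu>)) has_real_derivative
        F (Suc j) (x + r *\<^sub>R \<nu> + \<eta> *\<^sub>R \<nu>)) (at 0)" by metis
    show "((\<lambda>s. G j (x + r *\<^sub>R \<nu> + s *\<^sub>R \<nu>)) has_real_derivative G (Suc j) (x + r *\<^sub>R \<nu>)) (at 0)"
      unfolding G_def by (intro DERIV_cdivide DERIV_diff 1 2)
  qed
  then obtain r where r: "0 \<le> r" "r \<le> k * \<eta>" "diff_quot \<eta> \<nu> k (G 0) x = G k (x + r *\<^sub>R \<nu>)"
    by blast
  have "((\<lambda>s. F k (x + r *\<^sub>R \<nu> + q *\<^sub>R \<nu> + s *\<^sub>R \<nu>)) has_real_derivative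
      F (Suc k) (x + r *\<^sub>R \<nu> + q *\<^sub>R \<nu>)) (at 0)" if "0 \<le> q" "q \<le> \<eta>" for q
    using Suc.prems[of k "r + q"] that r by (simp add: scaleR_left_distrib add.assoc algebra_simps)
  from mean_value_along_line[OF \<open>\<eta> > 0\<close> this]
  obtain q where q: "0 < q" "q < \<eta>"
    "F k (x + r *\<^sub>R \<nu> + \<eta> *\<^sub>R \<nu>) - F k (x + r *\<^sub>R \<nu>) = \<eta> * F (Suc k) (x + r *\<^sub>R \<nu> + q *\<^sub>R \<nu>)"
    by blast
  then have "G k (x + r *\<^sub>R \<nu>) = F (Suc k) (x + (r + q) *\<^sub>R \<nu>)"
    using \<open>\<eta> > 0\<close> by (simp add: G_def scaleR_left_distrib add.assoc)
  moreover have "diff_quot \<eta> \<nu> (Suc k) (F 0) x = diff_quot \<eta> \<nu> k (G 0) x"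
    by (simp add: G_def[abs_def])
  ultimately show ?case
    using r q by (intro exI[of _ "r + q"]) (auto simp: algebra_simps)
qed

lemma heat_diff_quot:
  assumes "heat I S w g h" "\<And>x j. x \<in> S' \<Longrightarrow> j \<le> k \<Longrightarrow> x + (real j * \<eta>) *\<^sub>R \<nu> \<in> S"
  shows "\<exists>g h. heat I S' (\<lambda>t. diff_quot \<eta> \<nu> k (w t)) g h"
  using assms
proof (induction k arbitrary: w g h S)
  case 0
  then have "S' \<subseteq> S" by force
  then show ?case using heat_subset[OF 0(1) order_refl] by auto
next
  case (Suc k)
  \<comment> \<open>The domain of the first quotient: the \<open>k + 2\<close> nodes required in
    \<open>S\<close> leave \<open>k + 1\<close> nodes in \<open>S1\<close>.\<close>
  define S1 where "S1 = {x \<in> S. x + \<eta> *\<^sub>R \<nu> \<in> S}"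
  have "x + (real j * \<eta>) *\<^sub>R \<nu> \<in> S1" if "x \<in> S'" "j \<le> k" for x j
    using Suc.prems(2)[OF that(1), of j] Suc.prems(2)[OF that(1), of "Suc j"] that
    by (simp add: S1_def scaleR_left_distrib algebra_simps)
  moreover have "S1 \<subseteq> S" "\<And>x. x \<in> S1 \<Longrightarrow> x + \<eta> *\<^sub>R \<nu> \<in> S" by (auto simp: S1_def)
  note heat_diff_quotient[OF Suc.prems(1) this, of \<eta>]
  ultimately show ?case unfolding diff_quot.simps by (intro Suc.IH)
qed

text \<open>Kept apart from the equation because it is applied on a time interval containing 0,
  where the solution is continuous but the equation is not assumed.\<close>

lemma continuous_on_diff_quot:
  fixes w :: "real \<Rightarrow> 'a::real_normed_vector \<Rightarrow> real"
  assumes "continuous_on (I \<times> S) (\<lambda>(t, x). w t x)"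
    and "\<And>x j. x \<in> S' \<Longrightarrow> j \<le> k \<Longrightarrow> x + (real j * \<eta>) *\<^sub>R \<nu> \<in> S"
  shows "continuous_on (I \<times> S') (\<lambda>(t, x). diff_quot \<eta> \<nu> k (w t) x)"
  using assms
proof (induction k arbitrary: w S)
  case 0
  then have "I \<times> S' \<subseteq> I \<times> S" by force
  from continuous_on_subset[OF 0(1) this] show ?case by simp
next
  case (Suc k)
  define S1 where "S1 = {x \<in> S. x + \<eta> *\<^sub>R \<nu> \<in> S}"
  have S1: "x + (real j * \<eta>) *\<^sub>R \<nu> \<in> S1" if "x \<in> S'" "j \<le> k" for x j
    using Suc.prems(2)[OF that(1), of j] Suc.prems(2)[OF that(1), of "Suc j"] that
    by (simp add: S1_def scaleR_left_distrib algebra_simps)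
  have "continuous_on (I \<times> S1) (\<lambda>z. w (fst z) (snd z + \<eta> *\<^sub>R \<nu>))"
    by (rule continuous_on_compose2[OF Suc.prems(1)[unfolded split_beta],
          of "I \<times> S1" "\<lambda>z. (fst z, snd z + \<eta> *\<^sub>R \<nu>)", unfolded fst_conv snd_conv])
      (auto intro!: continuous_intros simp: S1_def)
  moreover have "continuous_on (I \<times> S1) (\<lambda>z. w (fst z) (snd z))"
    by (rule continuous_on_subset[OF Suc.prems(1)[unfolded split_beta]]) (auto simp: S1_def)
  ultimately have "continuous_on (I \<times> S1) (\<lambda>z. (w (fst z) (snd z + \<eta> *\<^sub>R \<nu>) - w (fst z) (snd z)) / \<eta>)"
    unfolding divide_inverse by (intro continuous_intros)
  then have "continuous_on (I \<times> S1) (\<lambda>(t, x). (w t (x + \<eta> *\<^sub>R \<nu>) - w t x) / \<eta>)"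
    by (simp add: split_beta)
  from Suc.IH[OF this S1] show ?case by simp
qed

text \<open>Regularity of the datum has to pass from \<open>f\<close> to \<open>u 0\<close>, and the
  two are tied together on \<Omega> only; openness makes all derivatives blind to the rest.\<close>

lemma Ck_on_cong:
  assumes "open S" "Ck_on k S f" "\<And>x. x \<in> S \<Longrightarrow> f x = g x"
  shows "Ck_on k S g"
  using assms(2,3)
proof (induction k arbitrary: f g)
  case 0
  then show ?case using continuous_on_cong[of S S f g] by simp
next
  case (Suc k)
  have D: "(g has_derivative frechet_derivative f (at x)) (at x)" if x: "x \<in> S" for x
  proof -
    have "(f has_derivative frechet_derivative f (at x)) (at x)"
      using Suc.prems(1) x frechet_derivative_works by auto
    then show ?thesis
      by (rule has_derivative_transform_within_open[OF _ assms(1) x Suc.prems(2)])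
  qed
  have "Ck_on k S (\<lambda>x. frechet_derivative g (at x) v)" for v
  proof (rule Suc.IH)
    show "Ck_on k S (\<lambda>x. frechet_derivative f (at x) v)" using Suc.prems(1) by simp
    show "frechet_derivative f (at x) v = frechet_derivative g (at x) v" if "x \<in> S" for x
      using frechet_derivative_at[OF D[OF that]] by simp
  qed
  then show ?case using D by (auto simp: differentiable_def)
qed

lemma Ck_on_dir_deriv_iter:
  assumes "open S" "Ck_on k S f"
  shows "continuous_on S (dir_deriv_iter k \<nu> f)"
    and "\<And>j x. j < k \<Longrightarrow> x \<in> S \<Longrightarrow>
      ((\<lambda>r. dir_deriv_iter j \<nu> f (x + r *\<^sub>R \<nu>)) has_real_derivative
        dir_deriv_iter (Suc j) \<nu> f x) (at 0)"
proof -
  have "continuous_on S (dir_deriv_iter k \<nu> f) \<and> (\<forall>j<k. \<forall>x\<in>S.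
      ((\<lambda>r. dir_deriv_iter j \<nu> f (x + r *\<^sub>R \<nu>)) has_real_derivative
        dir_deriv_iter (Suc j) \<nu> f x) (at 0))"
    using assms(2)
  proof (induction k arbitrary: f)
    case 0
    then show ?case by (simp add: dir_deriv_iter_def)
  next
    case (Suc k)
    have diff: "f differentiable (at x)" if "x \<in> S" for x using Suc.prems that by simp
    have "Ck_on k S (\<lambda>x. frechet_derivative f (at x) \<nu>)" using Suc.prems by simp
    then have "Ck_on k S (dir_deriv \<nu> f)"
      by (rule Ck_on_cong[OF assms(1)]) (simp add: differentiable_dir_deriv(1)[OF diff])
    note IH = Suc.IH[OF this]
    \<comment> \<open>\<open>Ck_on\<close> peels derivatives off on the inside while
      \<open>dir_deriv_iter\<close> adds them on the outside; powers of a single operator make the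
      two orders equal.\<close>
    have shift: "dir_deriv_iter j \<nu> (dir_deriv \<nu> f) = dir_deriv_iter (Suc j) \<nu> f" for j
      by (simp add: dir_deriv_iter_def funpow_swap1)
    have "((\<lambda>r. dir_deriv_iter j \<nu> f (x + r *\<^sub>R \<nu>)) has_real_derivative
        dir_deriv_iter (Suc j) \<nu> f x) (at 0)" if "j < Suc k" "x \<in> S" for j x
    proof (cases j)
      case 0
      then show ?thesis
        using differentiable_dir_deriv(2)[OF diff[OF that(2)]] by (simp add: dir_deriv_iter_def)
    next
      case (Suc i)
      then show ?thesis using IH that unfolding shift by simp
    qed
    then show ?case using IH unfolding shift by blast
  qed
  then show "continuous_on S (dir_deriv_iter k \<nu> f)"
    "\<And>j x. j < k \<Longrightarrow> x \<in> S \<Longrightarrow> ((\<lambda>r. dir_deriv_iter j \<nu> f (x + r *\<^sub>R \<nu>)) has_real_derivative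
        dir_deriv_iter (Suc j) \<nu> f x) (at 0)" by blast+
qed

section \<open>A quadratic barrier at the initial time\<close>

lemma has_real_derivative_dist_square:
  "((\<lambda>r. (x + r *\<^sub>R b - y) \<bullet> (x + r *\<^sub>R b - y)) has_real_derivative 2 * ((x - y) \<bullet> b)) (at 0)"
proof -
  have "(x + r *\<^sub>R b - y) \<bullet> (x + r *\<^sub>R b - y)
      = (x - y) \<bullet> (x - y) + 2 * r * ((x - y) \<bullet> b) + r\<^sup>2 * (b \<bullet> b)" for r
    by (simp add: inner_add_left inner_add_right inner_diff_left inner_diff_right inner_commute
        power2_eq_square algebra_simps)
  moreover have "((\<lambda>r. (x - y) \<bullet> (x - y) + 2 * r * ((x - y) \<bullet> b) + r\<^sup>2 * (b \<bullet> b))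
      has_real_derivative 2 * ((x - y) \<bullet> b)) (at 0)"
    by (auto intro!: derivative_eq_intros)
  ultimately show ?thesis by simp
qed

text \<open>The polynomial |x|^2 + 2nt, with n the dimension, solves the heat equation. Centred at
  \<open>x\<^sub>0\<close> and scaled by \<open>B / \<rho>\<^sup>2\<close> it is at least
  \<open>B\<close> on the sphere and nonnegative at time 0, yet small near the centre for small
  times.\<close>

lemma heat_initial_upper_bound:
  fixes x\<^sub>0 :: "'a::euclidean_space"
  assumes heat: "heat {0<..T} (ball x\<^sub>0 \<rho>) w g h" and "\<rho> > 0" "B \<ge> 0"
    and cont: "continuous_on ({0..T} \<times> ball x\<^sub>0 \<rho>) (\<lambda>(t, x). w t x)"
    and B: "\<And>t x. t \<in> {0<..T} \<Longrightarrow> x \<in> ball x\<^sub>0 \<rho> \<Longrightarrow> w t x \<le> m + B"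
    and init: "\<And>x. x \<in> ball x\<^sub>0 \<rho> \<Longrightarrow> w 0 x \<le> m"
    and tx: "t \<in> {0<..T}" "x \<in> ball x\<^sub>0 \<rho>"
  shows "w t x \<le> m + B / \<rho>\<^sup>2 * ((x - x\<^sub>0) \<bullet> (x - x\<^sub>0) + 2 * real DIM('a) * t)"
proof -
  define C where "C = B / \<rho>\<^sup>2"
  have C: "C \<ge> 0" using assms by (simp add: C_def)
  define q where "q t x = C * ((x - x\<^sub>0) \<bullet> (x - x\<^sub>0) + 2 * real DIM('a) * t)" for t x
  have contq: "continuous_on X (\<lambda>z. q (fst z) (snd z))" for X
    unfolding q_def by (intro continuous_intros)
  have qt: "((\<lambda>z. q (fst z) (snd z)) \<longlongrightarrow> q s y) (at (s, y) within X)" for s y X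
  proof -
    have "isCont (\<lambda>z. q (fst z) (snd z)) (s, y)"
      using contq[of UNIV] by (simp add: continuous_on_eq_continuous_at)
    then show ?thesis
      unfolding isCont_def by (intro tendsto_within_subset[of _ _ _ UNIV X]) simp_all
  qed
  have "w t x - m - q t x \<le> 0"
  proof (rule parabolic_maximum_principle[where F = "\<lambda>t x. w t x - m - q t x"
        and G = "\<lambda>b t x. g b t x - 0 - C * (2 * ((x - x\<^sub>0) \<bullet> b))"
        and H = "\<lambda>b t x. h b b t x - C * 2"
        and D = "\<lambda>t x. (\<Sum>b\<in>Basis. h b b t x) - 0 - C * (2 * real DIM('a))" and S = "ball x\<^sub>0 \<rho>"])
    show "open (ball x\<^sub>0 \<rho>)" "bounded (ball x\<^sub>0 \<rho>)" by auto
    show "continuous_on ({0<..T} \<times> ball x\<^sub>0 \<rho>) (\<lambda>(t, x). w t x - m - q t x)"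
      using heatD(4)[OF heat] unfolding split_beta by (intro continuous_intros contq)
    show "t \<in> {0<..T}" "x \<in> ball x\<^sub>0 \<rho>" by fact+
  next
    fix b :: 'a and t x assume b: "b \<in> Basis" and tx: "t \<in> {0<..T}" "x \<in> ball x\<^sub>0 \<rho>"
    have "((\<lambda>r. q t (x + r *\<^sub>R b)) has_real_derivative C * (2 * ((x - x\<^sub>0) \<bullet> b))) (at 0)"
      unfolding q_def by (auto intro!: derivative_eq_intros has_real_derivative_dist_square)
    then show "((\<lambda>r. w t (x + r *\<^sub>R b) - m - q t (x + r *\<^sub>R b)) has_real_derivative
        g b t x - 0 - C * (2 * ((x - x\<^sub>0) \<bullet> b))) (at 0)"
      by (intro DERIV_diff DERIV_const has_real_derivative_along_axis(1)[OF heatD(1)[OF heat tx] b])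
    have "((\<lambda>r. C * (2 * ((x + r *\<^sub>R b - x\<^sub>0) \<bullet> b))) has_real_derivative C * 2) (at 0)"
      unfolding inner_axis_shift[OF b b] by (auto intro!: derivative_eq_intros)
    then show "((\<lambda>r. g b t (x + r *\<^sub>R b) - 0 - C * (2 * ((x + r *\<^sub>R b - x\<^sub>0) \<bullet> b)))
        has_real_derivative h b b t x - C * 2) (at 0)"
      using has_real_derivative_along_axis(1)[OF heatD(2)[OF heat b tx] b]
      by (auto intro!: DERIV_diff)
  next
    fix t x assume tx: "t \<in> {0<..T}" "x \<in> ball x\<^sub>0 \<rho>"
    have "((\<lambda>s. q s x) has_real_derivative C * (2 * real DIM('a))) (at t)"
      unfolding q_def by (auto intro!: derivative_eq_intros)
    then show "((\<lambda>s. w s x - m - q s x) has_real_derivative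
        (\<Sum>b\<in>Basis. h b b t x) - 0 - C * (2 * real DIM('a))) (at t)"
      by (intro DERIV_diff DERIV_const heatD(3)[OF heat tx])
    show "(\<Sum>b\<in>Basis. h b b t x) - 0 - C * (2 * real DIM('a)) \<le> (\<Sum>b\<in>Basis. h b b t x - C * 2)"
      by (simp add: sum_subtractf)
  next
    fix s y e assume s: "s \<in> {0..T}" and y: "y \<in> closure (ball x\<^sub>0 \<rho>)"
      and sy: "s = 0 \<or> y \<notin> ball x\<^sub>0 \<rho>" and e: "(e::real) > 0"
    let ?Q = "{0<..T} \<times> ball x\<^sub>0 \<rho>"
    have in_Q: "\<forall>\<^sub>F z in at (s, y) within ?Q. z \<in> ?Q"
      by (auto simp: eventually_at_filter intro!: always_eventually)
    show "\<forall>\<^sub>F z in at (s, y) within ?Q. w (fst z) (snd z) - m - q (fst z) (snd z) \<le> e"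
    proof (cases "y \<in> ball x\<^sub>0 \<rho>")
      case True
      then have s0: "s = 0" and "(s, y) \<in> {0..T} \<times> ball x\<^sub>0 \<rho>" using sy s by auto
      then have "((\<lambda>z. w (fst z) (snd z)) \<longlongrightarrow> w s y) (at (s, y) within {0..T} \<times> ball x\<^sub>0 \<rho>)"
        using cont unfolding split_beta continuous_on_def by fastforce
      then have "((\<lambda>z. w (fst z) (snd z)) \<longlongrightarrow> w s y) (at (s, y) within ?Q)"
        by (rule tendsto_within_subset) auto
      moreover have "w s y < m + e" using init[OF True] e s0 by simp
      ultimately have "\<forall>\<^sub>F z in at (s, y) within ?Q. w (fst z) (snd z) < m + e"
        by (rule order_tendstoD(2))
      with in_Q show ?thesis
      proof eventually_elim
        case (elim z)
        then have "q (fst z) (snd z) \<ge> 0" using C by (auto simp: q_def)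
        then show ?case using elim by simp
      qed
    next
      case False
      then have "norm (y - x\<^sub>0) = \<rho>" using y \<open>\<rho> > 0\<close> by (simp add: dist_norm norm_minus_commute)
      then have "(y - x\<^sub>0) \<bullet> (y - x\<^sub>0) = \<rho>\<^sup>2" by (metis power2_norm_eq_inner)
      then have "C * \<rho>\<^sup>2 \<le> q s y" using s C by (auto simp: q_def intro!: mult_left_mono)
      then have "B - e < q s y" using e \<open>\<rho> > 0\<close> by (simp add: C_def)
      from order_tendstoD(1)[OF qt this] in_Q show ?thesis
      proof eventually_elim
        case (elim z)
        then show ?case using B[of "fst z" "snd z"] by auto
      qed
    qed
  qed
  then show ?thesis by (simp add: q_def C_def)
qed

lemma heat_initial_bound:
  fixes x\<^sub>0 :: "'a::euclidean_space"
  assumes heat: "heat {0<..T} (ball x\<^sub>0 \<rho>) w g h" and "\<rho> > 0" "B \<ge> 0"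
    and cont: "continuous_on ({0..T} \<times> ball x\<^sub>0 \<rho>) (\<lambda>(t, x). w t x)"
    and B: "\<And>t x. t \<in> {0<..T} \<Longrightarrow> x \<in> ball x\<^sub>0 \<rho> \<Longrightarrow> \<bar>w t x - m\<bar> \<le> B"
    and init: "\<And>x. x \<in> ball x\<^sub>0 \<rho> \<Longrightarrow> \<bar>w 0 x - m\<bar> \<le> \<epsilon>" and "\<epsilon> \<ge> 0"
    and tx: "t \<in> {0<..T}" "x \<in> ball x\<^sub>0 \<rho>"
  shows "\<bar>w t x - m\<bar> \<le> \<epsilon> + B / \<rho>\<^sup>2 * ((x - x\<^sub>0) \<bullet> (x - x\<^sub>0) + 2 * real DIM('a) * t)"
proof -
  have "w t x \<le> (m + \<epsilon>) + B / \<rho>\<^sup>2 * ((x - x\<^sub>0) \<bullet> (x - x\<^sub>0) + 2 * real DIM('a) * t)"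
  proof (rule heat_initial_upper_bound[OF heat assms(2,3) cont _ _ tx])
    show "w t x \<le> m + \<epsilon> + B" if "t \<in> {0<..T}" "x \<in> ball x\<^sub>0 \<rho>" for t x
      using B[OF that] \<open>\<epsilon> \<ge> 0\<close> by linarith
    show "w 0 x \<le> m + \<epsilon>" if "x \<in> ball x\<^sub>0 \<rho>" for x using init[OF that] by linarith
  qed
  \<comment> \<open>The unsimplified form is the linear combination with the zero solution that
    \<open>heat_lincomb\<close> yields; it stands for \<open>- w\<close>.\<close>
  moreover have "- 1 * w t x + 0 * 0 \<le>
      (- m + \<epsilon>) + B / \<rho>\<^sup>2 * ((x - x\<^sub>0) \<bullet> (x - x\<^sub>0) + 2 * real DIM('a) * t)"
  proof (rule heat_initial_upper_bound[OF heat_lincomb[OF heat heat_zero] assms(2,3) _ _ _ tx])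
    show "continuous_on ({0..T} \<times> ball x\<^sub>0 \<rho>) (\<lambda>(t, x). - 1 * w t x + 0 * 0)"
      using cont unfolding split_beta by (intro continuous_intros)
    show "- 1 * w t x + 0 * 0 \<le> - m + \<epsilon> + B" if "t \<in> {0<..T}" "x \<in> ball x\<^sub>0 \<rho>" for t x
      using B[OF that] \<open>\<epsilon> \<ge> 0\<close> by linarith
    show "- 1 * w 0 x + 0 * 0 \<le> - m + \<epsilon>" if "x \<in> ball x\<^sub>0 \<rho>" for x
      using init[OF that] by linarith
  qed
  ultimately show ?thesis by linarith
qed

text \<open>Difference quotients of order \<open>k\<close> solve the heat equation up to \<open>t = 0\<close> and, by the mean value
  theorem, inherit the bound on the \<open>k\<close>-th derivative. So the barrier estimate at \<open>t = 0\<close> is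
  uniform in the step size.\<close>

lemma dir_deriv_iter_continuous_to_initial_time:
  fixes \<Omega> :: "'a::euclidean_space set"
  assumes "open \<Omega>" and heat: "heat_solution {0<..} \<Omega> u"
    and cont: "continuous_on ({0..} \<times> \<Omega>) (\<lambda>(t, x). u t x)"
    and Ck: "Ck_on k \<Omega> (u 0)" and \<nu>: "norm \<nu> = 1"
    and C: "\<And>t x. t \<in> {0<..T} \<Longrightarrow> x \<in> \<Omega> \<Longrightarrow> \<bar>dir_deriv_iter k \<nu> (u t) x\<bar> \<le> C"
  shows "continuous_on ({0..T} \<times> \<Omega>) (\<lambda>(t, x). dir_deriv_iter k \<nu> (u t) x)"
  unfolding continuous_on_eq_continuous_within
proof safe
  fix t\<^sub>0 y assume t\<^sub>0: "t\<^sub>0 \<in> {0..T}" and y: "y \<in> \<Omega>"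
  define v where "v t = dir_deriv_iter k \<nu> (u t)" for t
  have heatv: "heat_solution {0<..} \<Omega> v"
    unfolding v_def by (rule heat_solution_dir_deriv_iter[OF _ assms(1) heat]) simp
  \<comment> \<open>Two sources meet here: \<open>Ck_on\<close> of the datum at time 0 and interior
    regularity at later times.\<close>
  have chain: "((\<lambda>r. dir_deriv_iter j \<nu> (u t) (x + r *\<^sub>R \<nu>)) has_real_derivative
        dir_deriv_iter (Suc j) \<nu> (u t) x) (at 0)" if "j < k" "t \<ge> 0" "x \<in> \<Omega>" for j t x
  proof (cases "t = 0")
    case True
    then show ?thesis using Ck_on_dir_deriv_iter(2)[OF assms(1) Ck] that by simp
  next
    case False
    then have "t \<in> {0<..}" using that by simp
    then show ?thesis
      unfolding dir_deriv_iter_Suc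
      using heat_solution_dir_deriv(2)[OF _ assms(1) heat_solution_dir_deriv_iter[OF _ assms(1) heat]]
        that by simp
  qed
  have "continuous (at (t\<^sub>0, y) within {0..T} \<times> \<Omega>) (\<lambda>(t, x). v t x)"
  proof (cases "t\<^sub>0 = 0")
    case False
    then have "(t\<^sub>0, y) \<in> {0<..} \<times> \<Omega>" using t\<^sub>0 y by simp
    moreover have "open ({0::real<..} \<times> \<Omega>)" using assms(1) by (simp add: open_Times)
    ultimately have "isCont (\<lambda>(t, x). v t x) (t\<^sub>0, y)"
      using heatD(4)[OF heatv] continuous_on_eq_continuous_at by blast
    then show ?thesis by (rule continuous_at_imp_continuous_at_within)
  next
    case True
    define m where "m = v 0 y"
    show ?thesis
      unfolding continuous_within tendsto_iff split_beta fst_conv snd_conv True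
    proof (intro allI impI)
      fix e :: real assume e: "e > 0"
      obtain d where d: "d > 0" "ball y d \<subseteq> \<Omega>" using \<open>open \<Omega>\<close> y openE by blast
      have cont0: "isCont (v 0) y"
        using Ck_on_dir_deriv_iter(1)[OF assms(1) Ck] y continuous_on_eq_continuous_at[OF assms(1)]
        unfolding v_def by blast
      then obtain d' where d': "d' > 0" "\<And>x. dist x y < d' \<Longrightarrow> dist (v 0 x) m < e / 2"
        using e half_gt_zero[OF e] unfolding continuous_at_eps_delta m_def by blast
      define \<rho> where "\<rho> = min d d' / 2"
      have \<rho>: "\<rho> > 0" using d d' by (simp add: \<rho>_def)
      have near: "x + r *\<^sub>R \<nu> \<in> \<Omega>" "\<bar>v 0 (x + r *\<^sub>R \<nu>) - m\<bar> \<le> e / 2"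
        if "x \<in> ball y \<rho>" "0 \<le> r" "r \<le> \<rho>" for x r
      proof -
        have "dist y (x + r *\<^sub>R \<nu>) \<le> dist y x + dist x (x + r *\<^sub>R \<nu>)" by (rule dist_triangle)
        also have "dist x (x + r *\<^sub>R \<nu>) = r" using \<nu> that by (simp add: dist_norm)
        finally have "dist y (x + r *\<^sub>R \<nu>) < d" "dist y (x + r *\<^sub>R \<nu>) < d'"
          using that by (auto simp: \<rho>_def)
        then show "x + r *\<^sub>R \<nu> \<in> \<Omega>" "\<bar>v 0 (x + r *\<^sub>R \<nu>) - m\<bar> \<le> e / 2"
          using d d'(2)[of "x + r *\<^sub>R \<nu>"] by (auto simp: dist_commute[of y] dist_real_def)
      qed
      have near0: "x \<in> \<Omega>" "\<bar>v 0 x - m\<bar> \<le> e / 2" if "x \<in> ball y \<rho>" for x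
        using near[OF that, of 0] \<rho> by auto
      \<comment> \<open>A bound for the distance of \<open>v\<close> from \<open>m\<close>; the
        maximum with 0 makes it nonnegative whatever the sign of \<open>C\<close>.\<close>
      define B where "B = max 0 C + \<bar>m\<bar>"
      define q where "q t x = e / 2 + B / \<rho>\<^sup>2 * ((x - y) \<bullet> (x - y) + 2 * real DIM('a) * t)" for t x
      \<comment> \<open>The bound \<open>q\<close> does not contain the step \<eta>. Together with
        the mean value form this allows \<eta> to tend to 0 at a fixed point.\<close>
      have quot: "\<bar>diff_quot \<eta> \<nu> k (u t) x - m\<bar> \<le> q t x
          \<and> (\<exists>r. 0 \<le> r \<and> r \<le> k * \<eta> \<and> diff_quot \<eta> \<nu> k (u t) x = v t (x + r *\<^sub>R \<nu>))"
        if \<eta>: "\<eta> > 0" "k * \<eta> \<le> \<rho>" and tx: "t \<in> {0<..T}" "x \<in> ball y \<rho>"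
        for \<eta> :: real and t x
      proof -
        have mv: "\<exists>r. 0 \<le> r \<and> r \<le> k * \<eta> \<and> diff_quot \<eta> \<nu> k (u t) x = v t (x + r *\<^sub>R \<nu>)"
          if "t \<ge> 0" "x \<in> ball y \<rho>" for t x
          using diff_quot_mean_value[OF \<eta>(1), of k "\<lambda>j. dir_deriv_iter j \<nu> (u t)" x \<nu>]
            chain[OF _ that(1) near(1)[OF that(2)]] \<eta>(2)
          by (simp add: v_def dir_deriv_iter_def)
        have shift: "x + (real j * \<eta>) *\<^sub>R \<nu> \<in> \<Omega>" if "x \<in> ball y \<rho>" "j \<le> k" for x j
        proof (rule near(1)[OF that(1)])
          have "real j * \<eta> \<le> k * \<eta>" using that \<eta> by (intro mult_right_mono) auto
          then show "real j * \<eta> \<le> \<rho>" using \<eta>(2) by linarith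
        qed (use \<eta> in simp)
        obtain g h where gh: "heat {0<..} (ball y \<rho>) (\<lambda>t. diff_quot \<eta> \<nu> k (u t)) g h"
          using heat_diff_quot[OF heat, of "ball y \<rho>" k \<eta> \<nu>] shift by blast
        have "\<bar>diff_quot \<eta> \<nu> k (u t) x - m\<bar> \<le> q t x"
          unfolding q_def
        proof (rule heat_initial_bound[OF _ \<rho> _ _ _ _ _ tx])
          show "heat {0<..T} (ball y \<rho>) (\<lambda>t. diff_quot \<eta> \<nu> k (u t)) g h"
            by (rule heat_subset[OF gh]) auto
          show "0 \<le> B" by (simp add: B_def)
          show "continuous_on ({0..T} \<times> ball y \<rho>) (\<lambda>(t, x). diff_quot \<eta> \<nu> k (u t) x)"
            by (rule continuous_on_diff_quot[OF _ shift], rule continuous_on_subset[OF cont]) auto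
          show "\<bar>diff_quot \<eta> \<nu> k (u t) x - m\<bar> \<le> B" if "t \<in> {0<..T}" "x \<in> ball y \<rho>" for t x
          proof -
            obtain r where r: "0 \<le> r" "r \<le> k * \<eta>" "diff_quot \<eta> \<nu> k (u t) x = v t (x + r *\<^sub>R \<nu>)"
              using mv[of t x] \<open>t \<in> {0<..T}\<close> \<open>x \<in> ball y \<rho>\<close> by auto
            then have "\<bar>v t (x + r *\<^sub>R \<nu>)\<bar> \<le> C"
              unfolding v_def using that \<eta> by (intro C near(1)) auto
            then show ?thesis using r by (simp add: B_def)
          qed
          show "\<bar>diff_quot \<eta> \<nu> k (u 0) x - m\<bar> \<le> e / 2" if "x \<in> ball y \<rho>" for x
            using mv[of 0 x] near(2)[OF that] that \<eta> by fastforce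
          show "0 \<le> e / 2" using e by simp
        qed
        then show ?thesis using mv tx by simp
      qed
      \<comment> \<open>The quotient is a value of \<open>v t\<close> at distance at most
        \<open>k * \<eta>\<close> from \<open>x\<close>; continuity of \<open>v t\<close> carries
        the bound over to \<open>x\<close> itself.\<close>
      have bound: "\<bar>v t x - m\<bar> \<le> q t x" if t: "t \<in> {0<..T}" and x: "x \<in> ball y \<rho>" for t x
      proof (rule field_le_epsilon)
        fix e' :: real assume e': "e' > 0"
        have "t \<in> {0<..}" using t by simp
        from has_derivative_continuous[OF heatD(1)[OF heatv this near0(1)[OF x]]]
        have "isCont (v t) x" .
        then obtain \<delta> where \<delta>: "\<delta> > 0" "\<And>z. dist z x < \<delta> \<Longrightarrow> dist (v t z) (v t x) < e'"
          using e' unfolding continuous_at_eps_delta by blast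
        define c where "c = min \<rho> (\<delta> / 2)"
        have c: "c > 0" "c \<le> \<rho>" "c < \<delta>" using \<rho> \<delta>(1) by (auto simp: c_def)
        \<comment> \<open>Dividing by \<open>k + 1\<close> yields \<open>k * \<eta> \<le> c\<close>
          and keeps \<eta> positive also for \<open>k = 0\<close>.\<close>
        define \<eta> where "\<eta> = c / (real k + 1)"
        have \<eta>: "\<eta> > 0" "k * \<eta> \<le> c" using c(1) by (auto simp: \<eta>_def field_simps)
        obtain r where r: "0 \<le> r" "r \<le> k * \<eta>" "\<bar>v t (x + r *\<^sub>R \<nu>) - m\<bar> \<le> q t x"
          using quot[OF \<eta>(1) _ t x] \<eta>(2) c(2) by auto
        have "dist (x + r *\<^sub>R \<nu>) x < \<delta>" using r \<nu> \<eta>(2) c(3) by (simp add: dist_norm)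
        from \<delta>(2)[OF this] r show "\<bar>v t x - m\<bar> \<le> q t x + e'" by (simp add: dist_real_def)
      qed
      have "continuous_on UNIV (\<lambda>z. q (fst z) (snd z))" unfolding q_def by (intro continuous_intros)
      then have "isCont (\<lambda>z. q (fst z) (snd z)) (0, y)" by (simp add: continuous_on_eq_continuous_at)
      then have "((\<lambda>z. q (fst z) (snd z)) \<longlongrightarrow> q 0 y) (at (0, y) within {0..T} \<times> \<Omega>)"
        unfolding isCont_def by (intro tendsto_within_subset[of _ _ _ UNIV "{0..T} \<times> \<Omega>"]) simp_all
      moreover have "q 0 y < e" using e by (simp add: q_def)
      ultimately have "\<forall>\<^sub>F z in at (0, y) within {0..T} \<times> \<Omega>. q (fst z) (snd z) < e"
        by (rule order_tendstoD(2))
      moreover have "\<forall>\<^sub>F z in at (0, y) within {0..T} \<times> \<Omega>. fst z \<in> {0..T}"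
        by (auto simp: eventually_at_filter intro!: always_eventually)
      moreover have "\<forall>\<^sub>F z in at (0, y) within {0..T} \<times> \<Omega>. snd z \<in> ball y \<rho>"
      proof (rule topological_tendstoD)
        show "(snd \<longlongrightarrow> y) (at (0::real, y) within {0..T} \<times> \<Omega>)"
          using tendsto_snd[OF tendsto_ident_at[of "(0::real, y)" "{0..T} \<times> \<Omega>"]] by simp
      qed (use \<rho> in auto)
      ultimately show "\<forall>\<^sub>F z in at (0, y) within {0..T} \<times> \<Omega>.
          dist (v (fst z) (snd z)) (v 0 y) < e"
      proof eventually_elim
        case (elim z)
        show ?case
        proof (cases "fst z = 0")
          case True
          then show ?thesis using near0(2)[OF elim(3)] e by (simp add: dist_real_def m_def)
        next
          case False
          then have "fst z \<in> {0<..T}" using elim by auto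
          from bound[OF this elim(3)] elim(1) show ?thesis by (simp add: dist_real_def m_def)
        qed
      qed
    qed
  qed
  then show "continuous (at (t\<^sub>0, y) within {0..T} \<times> \<Omega>) (\<lambda>(t, x). dir_deriv_iter k \<nu> (u t) x)"
    by (simp add: v_def)
qed

section \<open>The maximum principle with an exceptional corner\<close>

text \<open>Near each of its points the frontier lies in the graph of \<gamma>, the image of a
  hyperplane under a differentiable map of the whole space. Such maps send null sets to null sets,
  and nullity may be checked locally.\<close>

lemma C1_boundary_frontier_negligible:
  fixes \<Omega> :: "'a::euclidean_space set"
  assumes "open \<Omega>" "C1_boundary \<Omega>"
  shows "negligible (frontier \<Omega>)"
proof (subst locally_negligible_alt, rule ballI)
  fix z assume z: "z \<in> frontier \<Omega>"
  obtain r e \<gamma> where r: "r > 0" and e: "norm e = 1" and \<gamma>: "Ck_on 1 UNIV \<gamma>"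
    and graph: "\<Omega> \<inter> ball z r = {x \<in> ball z r. x \<bullet> e > \<gamma> (x - (x \<bullet> e) *\<^sub>R e)}"
    using assms(2) z unfolding C1_boundary_def by meson
  have diff\<gamma>: "\<gamma> differentiable (at x)" for x using \<gamma> by simp
  then have cont\<gamma>: "continuous_on UNIV \<gamma>"
    by (simp add: differentiable_imp_continuous_on differentiable_on_def differentiable_at_withinI)
  define F where "F x = x \<bullet> e - \<gamma> (x - (x \<bullet> e) *\<^sub>R e)" for x
  have contF: "continuous_on UNIV F"
  proof -
    have "continuous_on UNIV (\<lambda>x. \<gamma> (x - (x \<bullet> e) *\<^sub>R e))"
    proof (rule continuous_on_compose2[OF cont\<gamma>, where s = UNIV])
      show "continuous_on UNIV (\<lambda>x. x - (x \<bullet> e) *\<^sub>R e)" by (intro continuous_intros)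
    qed simp
    then show ?thesis unfolding F_def by (intro continuous_intros)
  qed
  have iff: "x \<in> \<Omega> \<longleftrightarrow> F x > 0" if "x \<in> ball z r" for x
  proof -
    have "x \<in> \<Omega> \<inter> ball z r \<longleftrightarrow> x \<in> {x \<in> ball z r. x \<bullet> e > \<gamma> (x - (x \<bullet> e) *\<^sub>R e)}"
      by (simp only: graph)
    then show ?thesis using that by (simp add: F_def)
  qed
  define \<phi> where "\<phi> y = y + \<gamma> y *\<^sub>R e" for y
  have "frontier \<Omega> \<inter> ball z r \<subseteq> \<phi> ` {y. e \<bullet> y = 0}"
  proof
    fix x assume x: "x \<in> frontier \<Omega> \<inter> ball z r"
    then have "x \<notin> \<Omega>" "x \<in> closure \<Omega>"
      using assms(1) by (auto simp: frontier_def interior_open)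
    then have "F x \<le> 0" using x iff[of x] by auto
    \<comment> \<open>Membership in the closure excludes \<open>F x < 0\<close>: this is an open
      condition that no point of \<Omega> near \<open>z\<close> satisfies.\<close>
    moreover have "F x \<ge> 0"
    proof (rule ccontr)
      assume "\<not> F x \<ge> 0"
      have "open (ball z r \<inter> F -` {..<0})"
        using continuous_open_vimage[of "{..<0}" F] contF
        by (intro open_Int) (auto simp: continuous_on_eq_continuous_at)
      moreover have "x \<in> ball z r \<inter> F -` {..<0}" using x \<open>\<not> F x \<ge> 0\<close> by auto
      ultimately have "\<Omega> \<inter> (ball z r \<inter> F -` {..<0}) \<noteq> {}"
        using \<open>x \<in> closure \<Omega>\<close> unfolding closure_iff_nhds_not_empty by blast
      then show False using iff by force
    qed
    ultimately have "x = \<phi> (x - (x \<bullet> e) *\<^sub>R e)" by (simp add: F_def \<phi>_def)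
    moreover have "e \<bullet> (x - (x \<bullet> e) *\<^sub>R e) = 0"
      using e by (simp add: inner_diff_right inner_commute norm_eq_1)
    ultimately show "x \<in> \<phi> ` {y. e \<bullet> y = 0}" by blast
  qed
  moreover have "negligible (\<phi> ` {y. e \<bullet> y = 0})"
  proof (rule negligible_differentiable_image_negligible)
    show "negligible {y. e \<bullet> y = 0}" by (rule negligible_hyperplane) (use e in auto)
    show "\<phi> differentiable_on {y. e \<bullet> y = 0}"
      unfolding differentiable_on_def
    proof
      fix x
      obtain D where "(\<gamma> has_derivative D) (at x)" using diff\<gamma> by (auto simp: differentiable_def)
      then have "(\<phi> has_derivative (\<lambda>h. h + D h *\<^sub>R e)) (at x)"
        unfolding \<phi>_def
        by (intro has_derivative_add has_derivative_ident has_derivative_scaleR_left)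
      then have "(\<phi> has_derivative (\<lambda>h. h + D h *\<^sub>R e)) (at x within {y. e \<bullet> y = 0})"
        by (rule has_derivative_at_withinI)
      then show "\<phi> differentiable (at x within {y. e \<bullet> y = 0})" unfolding differentiable_def by blast
    qed
  qed simp
  ultimately have "negligible (frontier \<Omega> \<inter> ball z r)" by (rule negligible_subset[rotated])
  then show "\<exists>U. openin (top_of_set (frontier \<Omega>)) U \<and> z \<in> U \<and> negligible U"
    using z r openin_open_Int[of "ball z r" "frontier \<Omega>"] by (intro exI) auto
qed

text \<open>Vitali covering: disjoint balls inside an open neighbourhood of small measure have small
  total volume, and their fivefold enlargements cover \<open>K\<close>. The powers of the radii are
  volumes up to the constant of the unit ball; they serve later as weights of Gaussians.\<close>

lemma negligible_compact_ball_cover: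
  fixes K :: "'a::euclidean_space set"
  assumes "compact K" "negligible K" "\<epsilon> > 0"
  obtains C r where "finite C" "\<And>a. a \<in> C \<Longrightarrow> r a > 0" "K \<subseteq> (\<Union>a\<in>C. ball a (r a))"
    "(\<Sum>a\<in>C. r a ^ DIM('a)) \<le> \<epsilon>"
proof -
  define V where "V = unit_ball_vol (DIM('a))"
  have V: "V > 0" by (simp add: V_def)
  \<comment> \<open>Compensates for the fivefold enlargement and for the volume of the unit
    ball.\<close>
  define e where "e = \<epsilon> * V / 5 ^ DIM('a)"
  have e: "e > 0" using V assms(3) by (simp add: e_def)
  have null: "K \<in> null_sets lebesgue" using assms(2) by (simp add: negligible_iff_null_sets)
  obtain U where U: "open U" "K \<subseteq> U" "emeasure lebesgue (U - K) < ennreal e"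
    using sets_lebesgue_outer_open[of K e] null e by blast
  have Usets: "U \<in> sets lebesgue" using U(1) by (simp add: borel_open)
  have Ue: "emeasure lebesgue U < ennreal e"
    using emeasure_Diff_null_set[OF null Usets] U(3) by simp
  then have Um: "U \<in> lmeasurable" using Usets by (simp add: fmeasurable_def less_trans[of _ "ennreal e"])
  have "\<exists>\<rho>>0. \<rho> \<le> 1 \<and> ball x \<rho> \<subseteq> U" if x: "x \<in> K" for x
  proof -
    obtain d where "d > 0" "ball x d \<subseteq> U" using U x openE by blast
    then show ?thesis by (intro exI[of _ "min d 1"]) auto
  qed
  then obtain \<rho> where \<rho>: "\<And>x. x \<in> K \<Longrightarrow> \<rho> x > 0" "\<And>x. x \<in> K \<Longrightarrow> \<rho> x \<le> 1"
    "\<And>x. x \<in> K \<Longrightarrow> ball x (\<rho> x) \<subseteq> U" by metis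
  obtain C where C: "C \<subseteq> K" "pairwise (\<lambda>i j. disjnt (ball i (\<rho> i)) (ball j (\<rho> j))) C"
    "K \<subseteq> (\<Union>i\<in>C. ball i (5 * \<rho> i))"
  proof (rule Vitali_covering_lemma_balls[where S = K and K = K and a = "\<lambda>i. i" and r = \<rho> and B = 1])
    show "K \<subseteq> (\<Union>i\<in>K. ball i (\<rho> i))" using \<rho>(1) by force
    show "0 < \<rho> i \<and> \<rho> i \<le> 1" if "i \<in> K" for i using \<rho> that by blast
  qed
  obtain C' where C': "C' \<subseteq> C" "finite C'" "K \<subseteq> (\<Union>i\<in>C'. ball i (5 * \<rho> i))"
    using compactE_image[OF assms(1), of C "\<lambda>i. ball i (5 * \<rho> i)"] C(3) by auto
  have "(\<Sum>a\<in>C'. V * \<rho> a ^ DIM('a)) = (\<Sum>a\<in>C'. measure lebesgue (ball a (\<rho> a)))"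
    using C C' \<rho>(1) by (intro sum.cong) (auto simp: V_def content_ball less_imp_le subset_iff)
  also have "\<dots> = measure lebesgue (\<Union>a\<in>C'. ball a (\<rho> a))"
    using C(2) C' pairwise_subset by (intro measure_UNION'[symmetric]) auto
  also have "\<dots> \<le> measure lebesgue U"
    using \<rho>(3) C C' Um by (intro measure_mono_fmeasurable) (auto simp: subset_iff)
  also have "\<dots> \<le> e"
    using Ue e by (simp add: measure_def enn2real_leI less_imp_le)
  finally have "V * (\<Sum>a\<in>C'. \<rho> a ^ DIM('a)) \<le> e" by (simp add: sum_distrib_left)
  then have "5 ^ DIM('a) * (\<Sum>a\<in>C'. \<rho> a ^ DIM('a)) \<le> \<epsilon>" using V by (simp add: e_def field_simps)
  then have "(\<Sum>a\<in>C'. (5 * \<rho> a) ^ DIM('a)) \<le> \<epsilon>"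
    by (simp add: sum_distrib_left power_mult_distrib)
  moreover have "5 * \<rho> a > 0" if "a \<in> C'" for a using that C C' \<rho>(1) by auto
  ultimately show thesis using that[of C' "\<lambda>a. 5 * \<rho> a"] C' by blast
qed

text \<open>Solutions whose second derivatives are only required along the coordinate axes: enough for
  the maximum principle, and stable under averaging in time.\<close>

definition axis_heat :: "real set \<Rightarrow> 'a::euclidean_space set \<Rightarrow> (real \<Rightarrow> 'a \<Rightarrow> real) \<Rightarrow> bool" where
  "axis_heat I S F \<longleftrightarrow> (\<exists>G H. \<forall>t\<in>I. \<forall>x\<in>S.
     (\<forall>b\<in>Basis. ((\<lambda>r. F t (x + r *\<^sub>R b)) has_real_derivative G b t x) (at 0) \<and>
        ((\<lambda>r. G b t (x + r *\<^sub>R b)) has_real_derivative H b t x) (at 0)) \<and>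
     ((\<lambda>s. F s x) has_real_derivative (\<Sum>b\<in>Basis. H b t x)) (at t))"

lemma axis_heat_subset:
  assumes "axis_heat I S F" "I' \<subseteq> I"
  shows "axis_heat I' S F"
proof -
  have sub: "\<forall>t\<in>I'. Q t" if "\<forall>t\<in>I. Q t" for Q using that assms(2) by blast
  show ?thesis using assms(1) unfolding axis_heat_def by (elim exE) (intro exI, erule sub)
qed

lemma heat_imp_axis_heat:
  assumes "heat I S w g h"
  shows "axis_heat I S w"
  unfolding axis_heat_def
  using heatD(3)[OF assms] has_real_derivative_along_axis(1)[OF heatD(1)[OF assms]]
    has_real_derivative_along_axis(1)[OF heatD(2)[OF assms]]
  by (intro exI[of _ g] exI[of _ "\<lambda>b. h b b"]) simp

lemma axis_heat_const: "axis_heat I S (\<lambda>t x. c)"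
  unfolding axis_heat_def
  by (intro exI[of _ "\<lambda>b t x. 0"]) (auto intro!: derivative_eq_intros)

lemma axis_heat_lincomb:
  assumes "axis_heat I S F" "axis_heat I S F'"
  shows "axis_heat I S (\<lambda>t x. c * F t x + d * F' t x)"
proof -
  obtain G H where 1: "\<forall>t\<in>I. \<forall>x\<in>S.
     (\<forall>b\<in>Basis. ((\<lambda>r. F t (x + r *\<^sub>R b)) has_real_derivative G b t x) (at 0) \<and>
        ((\<lambda>r. G b t (x + r *\<^sub>R b)) has_real_derivative H b t x) (at 0)) \<and>
     ((\<lambda>s. F s x) has_real_derivative (\<Sum>b\<in>Basis. H b t x)) (at t)"
    using assms(1) unfolding axis_heat_def by blast
  obtain G' H' where 2: "\<forall>t\<in>I. \<forall>x\<in>S.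
     (\<forall>b\<in>Basis. ((\<lambda>r. F' t (x + r *\<^sub>R b)) has_real_derivative G' b t x) (at 0) \<and>
        ((\<lambda>r. G' b t (x + r *\<^sub>R b)) has_real_derivative H' b t x) (at 0)) \<and>
     ((\<lambda>s. F' s x) has_real_derivative (\<Sum>b\<in>Basis. H' b t x)) (at t)"
    using assms(2) unfolding axis_heat_def by blast
  show ?thesis
    unfolding axis_heat_def
    by (intro exI[of _ "\<lambda>b t x. c * G b t x + d * G' b t x"]
        exI[of _ "\<lambda>b t x. c * H b t x + d * H' b t x"])
      (use 1 2 in \<open>auto simp: sum.distrib simp flip: sum_distrib_left intro!: DERIV_add DERIV_cmult\<close>)
qed

lemma axis_heat_sum:
  assumes "finite B" "\<And>i. i \<in> B \<Longrightarrow> axis_heat I S (F i)"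
  shows "axis_heat I S (\<lambda>t x. \<Sum>i\<in>B. k i * F i t x)"
  using assms
proof (induction B rule: finite_induct)
  case empty
  show ?case using axis_heat_const[of I S 0] by simp
next
  case (insert i B)
  then show ?case using axis_heat_lincomb[of I S "F i" "\<lambda>t x. \<Sum>i\<in>B. k i * F i t x" "k i" 1] by simp
qed

text \<open>The Gauss kernel without its normalising constant, started at time \<open>- c\<close>,
  hence smooth up to and including time 0 when \<open>c > 0\<close>.\<close>

definition gauss :: "'a::euclidean_space \<Rightarrow> real \<Rightarrow> real \<Rightarrow> 'a \<Rightarrow> real" where
  "gauss a c t x = (t + c) powr (- real DIM('a) / 2) * exp (- ((x - a) \<bullet> (x - a)) / (4 * (t + c)))"

lemma axis_heat_gauss:
  assumes "c > 0"
  shows "axis_heat {0<..} S (gauss (a::'a::euclidean_space) c)"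
  unfolding axis_heat_def
proof (rule exI[of _ "\<lambda>b t x. gauss a c t x * (- ((x - a) \<bullet> b) / (2 * (t + c)))"],
    rule exI[of _ "\<lambda>b t x. gauss a c t x * (((x - a) \<bullet> b)\<^sup>2 / (4 * (t + c)\<^sup>2) - 1 / (2 * (t + c)))"],
    intro ballI conjI)
  fix t :: real and x :: 'a assume "t \<in> {0<..}"
  then have tc: "t + c > 0" using assms by simp
  {
    fix b :: 'a assume b: "b \<in> Basis"
    have 1: "((\<lambda>r. gauss a c t (x + r *\<^sub>R b)) has_real_derivative
        gauss a c t x * (- ((x - a) \<bullet> b) / (2 * (t + c)))) (at 0)"
    proof -
      have "((\<lambda>r. - ((x + r *\<^sub>R b - a) \<bullet> (x + r *\<^sub>R b - a)) / (4 * (t + c))) has_real_derivative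
          - (2 * ((x - a) \<bullet> b)) / (4 * (t + c))) (at 0)"
        by (intro DERIV_cdivide DERIV_minus has_real_derivative_dist_square)
      moreover have "- (2 * ((x - a) \<bullet> b)) / (4 * (t + c)) = - ((x - a) \<bullet> b) / (2 * (t + c))"
        using tc by (simp add: divide_simps)
      ultimately have "((\<lambda>r. - ((x + r *\<^sub>R b - a) \<bullet> (x + r *\<^sub>R b - a)) / (4 * (t + c)))
          has_real_derivative - ((x - a) \<bullet> b) / (2 * (t + c))) (at 0)" by metis
      from DERIV_cmult[OF DERIV_fun_exp[OF this], of "(t + c) powr (- real DIM('a) / 2)"]
      show ?thesis by (simp add: gauss_def mult.assoc)
    qed
    then show "((\<lambda>r. gauss a c t (x + r *\<^sub>R b)) has_real_derivative
        gauss a c t x * (- ((x - a) \<bullet> b) / (2 * (t + c)))) (at 0)" .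
    have 2: "((\<lambda>r. - ((x + r *\<^sub>R b - a) \<bullet> b) / (2 * (t + c))) has_real_derivative
        - 1 / (2 * (t + c))) (at 0)"
      unfolding inner_axis_shift[OF b b] by (rule DERIV_cdivide) (auto intro!: derivative_eq_intros)
    show "((\<lambda>r. gauss a c t (x + r *\<^sub>R b) * (- ((x + r *\<^sub>R b - a) \<bullet> b) / (2 * (t + c))))
        has_real_derivative
        gauss a c t x * (((x - a) \<bullet> b)\<^sup>2 / (4 * (t + c)\<^sup>2) - 1 / (2 * (t + c)))) (at 0)"
      using DERIV_mult[OF 1 2] by (simp add: power2_eq_square algebra_simps)
  }
  define n where "n = real DIM('a)"
  have "((\<lambda>s. (s + c) powr (- n / 2)) has_real_derivative
      (- n / 2) * (t + c) powr (- n / 2 - 1)) (at t)"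
    using tc by (auto intro!: derivative_eq_intros)
  moreover have "(t + c) powr (- n / 2 - 1) = (t + c) powr (- n / 2) / (t + c)"
    using tc by (simp add: powr_diff)
  ultimately have 1: "((\<lambda>s. (s + c) powr (- n / 2)) has_real_derivative
      (- n / 2) * ((t + c) powr (- n / 2) / (t + c))) (at t)" by metis
  have 2: "((\<lambda>s. exp (- ((x - a) \<bullet> (x - a)) / (4 * (s + c)))) has_real_derivative
      exp (- ((x - a) \<bullet> (x - a)) / (4 * (t + c))) * ((x - a) \<bullet> (x - a) / (4 * (t + c)\<^sup>2))) (at t)"
  proof (rule DERIV_fun_exp)
    let ?X = "(x - a) \<bullet> (x - a)" and ?y = "t + c"
    have "((\<lambda>s. - ?X / (4 * (s + c))) has_real_derivative (0 * (4 * ?y) - - ?X * 4) / (4 * ?y * (4 * ?y))) (at t)"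
      using tc by (intro DERIV_divide) (auto intro!: derivative_eq_intros)
    moreover have "(0 * (4 * ?y) - - ?X * 4) / (4 * ?y * (4 * ?y)) = ?X / (4 * ?y\<^sup>2)"
      using tc by (simp add: power2_eq_square divide_simps) (simp add: algebra_simps)
    ultimately show "((\<lambda>s. - ?X / (4 * (s + c))) has_real_derivative ?X / (4 * ?y\<^sup>2)) (at t)" by metis
  qed
  \<comment> \<open>Summing the second derivatives over the basis collects |x - a|^2 and n copies of
    the constant term, which is the logarithmic time derivative of the kernel.\<close>
  have sq: "(\<Sum>b\<in>Basis. ((x - a) \<bullet> b)\<^sup>2) = (x - a) \<bullet> (x - a)"
    by (subst euclidean_inner) (simp add: power2_eq_square)
  have "(\<Sum>b\<in>Basis. gauss a c t x * (((x - a) \<bullet> b)\<^sup>2 / (4 * (t + c)\<^sup>2) - 1 / (2 * (t + c))))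
      = gauss a c t x * ((x - a) \<bullet> (x - a) / (4 * (t + c)\<^sup>2) - n / (2 * (t + c)))"
    unfolding sum_distrib_left[symmetric] sum_subtractf sum_divide_distrib[symmetric] sq
    by (simp add: n_def)
  moreover have "\<dots> = (- n / 2) * ((t + c) powr (- n / 2) / (t + c)) * exp (- ((x - a) \<bullet> (x - a)) / (4 * (t + c)))
      + exp (- ((x - a) \<bullet> (x - a)) / (4 * (t + c))) * ((x - a) \<bullet> (x - a) / (4 * (t + c)\<^sup>2)) * (t + c) powr (- n / 2)"
    by (simp add: gauss_def n_def[symmetric] algebra_simps)
  ultimately show "((\<lambda>s. gauss a c s x) has_real_derivative
      (\<Sum>b\<in>Basis. gauss a c t x * (((x - a) \<bullet> b)\<^sup>2 / (4 * (t + c)\<^sup>2) - 1 / (2 * (t + c))))) (at t)"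
    using DERIV_mult[OF 1 2] by (simp add: gauss_def n_def)
qed

text \<open>Nothing but boundedness is assumed at the corner \<open>{0} \<times> frontier \<Omega>\<close>. There a sum of Gaussians,
  centred at balls covering the null set \<open>frontier \<Omega>\<close>, dominates the solution; at positive times
  this sum is as small as the total volume of the balls.\<close>

lemma maximum_principle_except_corner:
  fixes \<Omega> :: "'a::euclidean_space set"
  assumes "open \<Omega>" "bounded \<Omega>" "negligible (frontier \<Omega>)"
    and Z: "axis_heat {0<..T} \<Omega> Z"
    and cont: "continuous_on ({0..T} \<times> \<Omega>) (\<lambda>(t, x). Z t x)"
    and C: "\<And>t x. t \<in> {0<..T} \<Longrightarrow> x \<in> \<Omega> \<Longrightarrow> Z t x \<le> C"
    and init: "\<And>x. x \<in> \<Omega> \<Longrightarrow> Z 0 x \<le> 0"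
    and lateral: "\<And>s y e. s \<in> {0<..T} \<Longrightarrow> y \<in> frontier \<Omega> \<Longrightarrow> e > 0 \<Longrightarrow>
      \<forall>\<^sub>F z in at (s, y) within {0<..T} \<times> \<Omega>. Z (fst z) (snd z) \<le> e"
    and tx: "t \<in> {0<..T}" "x \<in> \<Omega>"
  shows "Z t x \<le> 0"
proof -
  define n where "n = real DIM('a)"
  \<comment> \<open>Undoes the factor exp(-1/4), a lower bound at time 0 for a weighted Gaussian on
    its own ball; the maximum with 0 keeps the barrier nonnegative.\<close>
  define C' where "C' = max 0 C * exp (1/4)"
  have C': "C' \<ge> 0" by (simp add: C'_def)
  have bound: "Z t x \<le> C' * t powr (- n / 2) * \<epsilon>" if "\<epsilon> > 0" for \<epsilon>
  proof -
    have "compact (frontier \<Omega>)" using assms(2) by (simp add: compact_frontier_bounded)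
    then obtain A r where A: "finite A" "\<And>a. a \<in> A \<Longrightarrow> r a > 0"
        "frontier \<Omega> \<subseteq> (\<Union>a\<in>A. ball a (r a))" "(\<Sum>a\<in>A. r a ^ DIM('a)) \<le> \<epsilon>"
      using negligible_compact_ball_cover[OF _ assms(3) \<open>\<epsilon> > 0\<close>] by blast
    \<comment> \<open>Shifting time by the squared radius ties the width of each Gaussian to its
      ball. A weighted term is then bounded below on its ball at time 0, but at time
      \<open>t > 0\<close> it is at most \<open>r a ^ DIM('a) * t powr (- n / 2)\<close>, and these
      bounds add up to a multiple of \<epsilon>.\<close>
    define \<Psi> where "\<Psi> t x = (\<Sum>a\<in>A. r a ^ DIM('a) * gauss a ((r a)\<^sup>2) t x)" for t x
    have \<Psi>_nonneg: "\<Psi> t x \<ge> 0" for t x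
      unfolding \<Psi>_def gauss_def using A(2) by (intro sum_nonneg) (simp add: less_imp_le)
    have cont\<Psi>: "continuous_on ({0..} \<times> UNIV) (\<lambda>z. \<Psi> (fst z) (snd z))"
      unfolding \<Psi>_def gauss_def
    proof (intro continuous_intros ballI)
      fix a and z :: "real \<times> 'a" assume "a \<in> A" "z \<in> {0..} \<times> UNIV"
      moreover have "(r a)\<^sup>2 > 0" using A(2)[OF \<open>a \<in> A\<close>] by simp
      ultimately have "fst z + (r a)\<^sup>2 > 0" by (auto simp: mem_Times_iff intro: add_nonneg_pos)
      then show "fst z + (r a)\<^sup>2 \<noteq> 0" "4 * (fst z + (r a)\<^sup>2) \<noteq> 0" by auto
    qed
    have "axis_heat {0<..T} \<Omega> \<Psi>"
      unfolding \<Psi>_def using A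
      by (intro axis_heat_sum axis_heat_subset[OF axis_heat_gauss]) (auto dest: A(2))
    from axis_heat_lincomb[OF Z this, of 1 "- C'"]
    obtain G H where GH: "\<forall>t\<in>{0<..T}. \<forall>x\<in>\<Omega>.
        (\<forall>b\<in>Basis. ((\<lambda>r. Z t (x + r *\<^sub>R b) - C' * \<Psi> t (x + r *\<^sub>R b)) has_real_derivative G b t x) (at 0) \<and>
          ((\<lambda>r. G b t (x + r *\<^sub>R b)) has_real_derivative H b t x) (at 0)) \<and>
        ((\<lambda>s. Z s x - C' * \<Psi> s x) has_real_derivative (\<Sum>b\<in>Basis. H b t x)) (at t)"
      unfolding axis_heat_def by auto
    have "Z t x - C' * \<Psi> t x \<le> 0"
    proof (rule parabolic_maximum_principle[where F = "\<lambda>t x. Z t x - C' * \<Psi> t x" and a = 0 and T = T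
          and G = G and H = H and D = "\<lambda>t x. \<Sum>b\<in>Basis. H b t x", OF assms(1,2) _ _ _ _ order_refl _ tx])
      have "continuous_on ({0<..T} \<times> \<Omega>) (\<lambda>z. Z (fst z) (snd z))"
        using cont unfolding split_beta by (rule continuous_on_subset) auto
      moreover have "continuous_on ({0<..T} \<times> \<Omega>) (\<lambda>z. \<Psi> (fst z) (snd z))"
        by (rule continuous_on_subset[OF cont\<Psi>]) auto
      ultimately show "continuous_on ({0<..T} \<times> \<Omega>) (\<lambda>(t, x). Z t x - C' * \<Psi> t x)"
        unfolding split_beta by (intro continuous_intros)
    next
      fix s y e assume s: "s \<in> {0..T}" and y: "y \<in> closure \<Omega>" and sy: "s = 0 \<or> y \<notin> \<Omega>"
        and e: "(e::real) > 0"
      let ?Q = "{0<..T} \<times> \<Omega>"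
      have in_Q: "\<forall>\<^sub>F z in at (s, y) within ?Q. z \<in> ?Q"
        by (auto simp: eventually_at_filter intro!: always_eventually)
      \<comment> \<open>Either alternative suffices: \<open>Z\<close> is small and the barrier
        nonnegative, or the barrier alone nearly reaches the global bound \<open>C\<close>. The
        second one serves the corner.\<close>
      have "(\<forall>\<^sub>F z in at (s, y) within ?Q. Z (fst z) (snd z) \<le> e)
          \<or> (\<forall>\<^sub>F z in at (s, y) within ?Q. C - e \<le> C' * \<Psi> (fst z) (snd z))"
      proof (cases "y \<in> \<Omega>")
        case True
        then have "s = 0" using sy by simp
        have "((\<lambda>z. Z (fst z) (snd z)) \<longlongrightarrow> Z s y) (at (s, y) within {0..T} \<times> \<Omega>)"
          using cont True s unfolding split_beta continuous_on_def by fastforce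
        then have "((\<lambda>z. Z (fst z) (snd z)) \<longlongrightarrow> Z s y) (at (s, y) within ?Q)"
          by (rule tendsto_within_subset) auto
        moreover have "Z s y < e" using init[OF True] e \<open>s = 0\<close> by simp
        ultimately have "\<forall>\<^sub>F z in at (s, y) within ?Q. Z (fst z) (snd z) < e"
          by (rule order_tendstoD(2))
        then show ?thesis by (auto elim: eventually_mono)
      next
        case False
        then have yf: "y \<in> frontier \<Omega>" using y assms(1) by (simp add: frontier_def interior_open)
        show ?thesis
        proof (cases "s = 0")
          case False
          then show ?thesis using lateral[OF _ yf e, of s] s by auto
        next
          case True
          obtain a where a: "a \<in> A" "y \<in> ball a (r a)" using A(3) yf by blast
          have ra: "r a > 0" by (rule A(2)[OF a(1)])
          have "exp (- (1/4)) \<le> r a ^ DIM('a) * gauss a ((r a)\<^sup>2) 0 y"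
          proof -
            have "(y - a) \<bullet> (y - a) \<le> (r a)\<^sup>2"
              using a(2) ra by (simp add: dist_norm norm_minus_commute power_mono flip: power2_norm_eq_inner)
            then have "exp (- (1/4)) \<le> exp (- ((y - a) \<bullet> (y - a)) / (4 * (r a)\<^sup>2))"
              using ra by (simp add: field_simps)
            moreover have "r a ^ DIM('a) * ((r a)\<^sup>2) powr (- n / 2) = 1"
            proof -
              have "((r a)\<^sup>2) powr (- n / 2) = r a powr (- n)"
                using ra powr_powr[of "r a" 2 "- n / 2"] by simp
              then show ?thesis using ra by (simp add: n_def powr_minus powr_realpow)
            qed
            ultimately show ?thesis by (simp add: gauss_def n_def flip: mult.assoc)
          qed
          also have "\<dots> \<le> \<Psi> 0 y"
            unfolding \<Psi>_def using A(1,2) a(1)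
            by (intro member_le_sum) (auto simp: gauss_def less_imp_le)
          finally have "C' * exp (- (1/4)) \<le> C' * \<Psi> s y"
            using C' True by (simp add: mult_left_mono)
          moreover have "C' * exp (- (1/4)) = max 0 C" by (simp add: C'_def exp_minus)
          ultimately have less: "C - e < C' * \<Psi> s y" using e by linarith
          have "((\<lambda>z. \<Psi> (fst z) (snd z)) \<longlongrightarrow> \<Psi> s y) (at (s, y) within {0..} \<times> UNIV)"
            using cont\<Psi> True unfolding continuous_on_def by fastforce
          then have "((\<lambda>z. C' * \<Psi> (fst z) (snd z)) \<longlongrightarrow> C' * \<Psi> s y) (at (s, y) within ?Q)"
            by (intro tendsto_intros tendsto_within_subset[of _ _ _ "{0..} \<times> UNIV" ?Q]) auto
          from order_tendstoD(1)[OF this less] show ?thesis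
            by (intro disjI2) (auto elim!: eventually_mono)
        qed
      qed
      then show "\<forall>\<^sub>F z in at (s, y) within ?Q. Z (fst z) (snd z) - C' * \<Psi> (fst z) (snd z) \<le> e"
      proof
        assume "\<forall>\<^sub>F z in at (s, y) within ?Q. Z (fst z) (snd z) \<le> e"
        then show ?thesis
        proof eventually_elim
          case (elim z)
          moreover have "C' * \<Psi> (fst z) (snd z) \<ge> 0" using C' \<Psi>_nonneg by simp
          ultimately show ?case by linarith
        qed
      next
        assume "\<forall>\<^sub>F z in at (s, y) within ?Q. C - e \<le> C' * \<Psi> (fst z) (snd z)"
        with in_Q show ?thesis
        proof eventually_elim
          case (elim z)
          then have "Z (fst z) (snd z) \<le> C" using C by auto
          then show ?case using elim(2) by linarith
        qed
      qed
    qed (use GH in blast)+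
    moreover have "\<Psi> t x \<le> t powr (- n / 2) * \<epsilon>"
    proof -
      have "\<Psi> t x \<le> (\<Sum>a\<in>A. r a ^ DIM('a) * t powr (- n / 2))"
        unfolding \<Psi>_def
      proof (intro sum_mono mult_left_mono)
        fix a assume "a \<in> A"
        have "gauss a ((r a)\<^sup>2) t x \<le> (t + (r a)\<^sup>2) powr (- n / 2) * 1"
          unfolding gauss_def n_def using tx by (intro mult_left_mono) auto
        also have "(t + (r a)\<^sup>2) powr (- n / 2) \<le> t powr (- n / 2)"
          using tx by (intro powr_mono2') (auto simp: n_def)
        finally show "gauss a ((r a)\<^sup>2) t x \<le> t powr (- n / 2)" by simp
        show "0 \<le> r a ^ DIM('a)" using A(2)[OF \<open>a \<in> A\<close>] by simp
      qed
      also have "\<dots> = t powr (- n / 2) * (\<Sum>a\<in>A. r a ^ DIM('a))"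
        by (simp add: sum_distrib_right mult.commute)
      also have "\<dots> \<le> t powr (- n / 2) * \<epsilon>" using A(4) by (intro mult_left_mono) auto
      finally show ?thesis .
    qed
    then have "C' * \<Psi> t x \<le> C' * t powr (- n / 2) * \<epsilon>"
      using C' by (simp add: mult_left_mono mult.assoc)
    ultimately show ?thesis by linarith
  qed
  show ?thesis
  proof (rule field_le_epsilon)
    fix e :: real assume e: "e > 0"
    define K where "K = C' * t powr (- n / 2)"
    have K: "K \<ge> 0" using C' by (simp add: K_def)
    have "K * (e / (K + 1)) \<le> e" using K e by (simp add: field_simps)
    then show "Z t x \<le> 0 + e" using bound[of "e / (K + 1)"] K e by (simp add: K_def)
  qed
qed

section \<open>Averages in time\<close>

lemma has_real_derivative_integral_param:
  fixes f :: "real \<Rightarrow> real \<Rightarrow> real"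
  assumes "\<delta> > 0"
    and "\<And>r \<sigma>. \<bar>r\<bar> < \<delta> \<Longrightarrow> \<sigma> \<in> {0..h} \<Longrightarrow> ((\<lambda>r. f r \<sigma>) has_real_derivative fx r \<sigma>) (at r)"
    and "\<And>r. \<bar>r\<bar> < \<delta> \<Longrightarrow> continuous_on {0..h} (f r)"
    and "continuous_on ({-\<delta><..<\<delta>} \<times> {0..h}) (\<lambda>(r, \<sigma>). fx r \<sigma>)"
  shows "((\<lambda>r. integral {0..h} (f r)) has_real_derivative integral {0..h} (fx 0)) (at 0)"
proof -
  have "((\<lambda>r. integral (cbox 0 h) (f r)) has_real_derivative integral (cbox 0 h) (fx 0))
      (at 0 within {-\<delta><..<\<delta>})"
  proof (rule leibniz_rule_field_derivative)
    show "((\<lambda>r. f r \<sigma>) has_real_derivative fx r \<sigma>) (at r within {-\<delta><..<\<delta>})"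
      if "r \<in> {-\<delta><..<\<delta>}" "\<sigma> \<in> cbox 0 h" for r \<sigma>
      using assms(2)[of r \<sigma>] that by (auto intro: has_field_derivative_at_within)
    show "f r integrable_on cbox 0 h" if "r \<in> {-\<delta><..<\<delta>}" for r
      using assms(3)[of r] that by (intro integrable_continuous) auto
  qed (use assms in auto)
  moreover have "at 0 within {-\<delta><..<\<delta>} = at 0" by (rule at_within_open) (use assms(1) in auto)
  ultimately show ?thesis by simp
qed

text \<open>Differentiation under the integral is justified by joint continuity of the gradient and
  the Hessian. The integral is not divided by \<open>h\<close>, so later bounds carry a factor
  \<open>h\<close>.\<close>

lemma axis_heat_time_average:
  assumes "open \<Omega>" and heat: "heat_solution {0<..} \<Omega> v"
  shows "axis_heat {0<..} \<Omega> (\<lambda>s x. integral {0..h} (\<lambda>\<sigma>. v (s + \<sigma>) x))"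
  unfolding axis_heat_def
proof (rule exI[of _ "\<lambda>b s x. integral {0..h} (\<lambda>\<sigma>. dir_deriv b (v (s + \<sigma>)) x)"],
    rule exI[of _ "\<lambda>b s x. integral {0..h} (\<lambda>\<sigma>. dir_deriv b (dir_deriv b (v (s + \<sigma>))) x)"],
    intro ballI conjI)
  have comp: "continuous_on A (\<lambda>z. F (p z) (q z))"
    if "continuous_on ({0<..} \<times> \<Omega>) (\<lambda>(t, x). F t x)" "continuous_on A p" "continuous_on A q"
      "\<And>z. z \<in> A \<Longrightarrow> p z > 0 \<and> q z \<in> \<Omega>"
    for F :: "real \<Rightarrow> 'a \<Rightarrow> real" and A :: "'c::topological_space set" and p q
    by (rule continuous_on_compose2[OF that(1)[unfolded split_beta], where f = "\<lambda>z. (p z, q z)",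
          unfolded fst_conv snd_conv])
      (use that in \<open>auto intro!: continuous_intros\<close>)
  note cont_v = heatD(4)[OF heat] and cont_g = heatD(5)[OF heat]
  have cont_h: "continuous_on ({0<..} \<times> \<Omega>) (\<lambda>(t, x). dir_deriv b (dir_deriv b (v t)) x)"
    if "b \<in> Basis" for b
    by (rule heat_solution_continuous_hessian[OF _ assms that that]) simp
  fix s x assume "s \<in> {0::real<..}" and x: "x \<in> \<Omega>"
  then have s: "s > 0" by simp
  {
    fix b :: 'a assume b: "b \<in> Basis"
    obtain \<delta> where \<delta>: "\<delta> > 0" "ball x \<delta> \<subseteq> \<Omega>" using assms(1) x openE by blast
    have in_\<Omega>: "x + r *\<^sub>R b \<in> \<Omega>" if "\<bar>r\<bar> < \<delta>" for r
      using \<delta> that b by (auto simp: subset_iff dist_norm)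
    have pos: "s + \<sigma> \<in> {0<..}" if "\<sigma> \<in> {0..h}" for \<sigma> using s that by simp
    have "((\<lambda>r. integral {0..h} (\<lambda>\<sigma>. v (s + \<sigma>) (x + r *\<^sub>R b))) has_real_derivative
        integral {0..h} (\<lambda>\<sigma>. dir_deriv b (v (s + \<sigma>)) (x + 0 *\<^sub>R b))) (at 0)"
    proof (rule has_real_derivative_integral_param[OF \<delta>(1)])
      show "((\<lambda>r. v (s + \<sigma>) (x + r *\<^sub>R b)) has_real_derivative
          dir_deriv b (v (s + \<sigma>)) (x + r *\<^sub>R b)) (at r)" if "\<bar>r\<bar> < \<delta>" "\<sigma> \<in> {0..h}" for r \<sigma>
        by (rule has_real_derivative_shift, rule has_real_derivative_along_axis(1)[OF _ b],
            rule heatD(1)[OF heat pos[OF that(2)] in_\<Omega>[OF that(1)]])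
      show "continuous_on {0..h} (\<lambda>\<sigma>. v (s + \<sigma>) (x + r *\<^sub>R b))" if "\<bar>r\<bar> < \<delta>" for r
        by (rule comp[OF cont_v]) (use in_\<Omega>[OF that] s in \<open>auto intro!: continuous_intros\<close>)
      show "continuous_on ({-\<delta><..<\<delta>} \<times> {0..h}) (\<lambda>(r, \<sigma>). dir_deriv b (v (s + \<sigma>)) (x + r *\<^sub>R b))"
        unfolding split_beta
        by (rule comp[OF cont_g[OF b]]) (use in_\<Omega> s in \<open>auto intro!: continuous_intros\<close>)
    qed
    then show "((\<lambda>r. integral {0..h} (\<lambda>\<sigma>. v (s + \<sigma>) (x + r *\<^sub>R b))) has_real_derivative
        integral {0..h} (\<lambda>\<sigma>. dir_deriv b (v (s + \<sigma>)) x)) (at 0)" by simp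
    have "((\<lambda>r. integral {0..h} (\<lambda>\<sigma>. dir_deriv b (v (s + \<sigma>)) (x + r *\<^sub>R b))) has_real_derivative
        integral {0..h} (\<lambda>\<sigma>. dir_deriv b (dir_deriv b (v (s + \<sigma>))) (x + 0 *\<^sub>R b))) (at 0)"
    proof (rule has_real_derivative_integral_param[OF \<delta>(1)])
      show "((\<lambda>r. dir_deriv b (v (s + \<sigma>)) (x + r *\<^sub>R b)) has_real_derivative
          dir_deriv b (dir_deriv b (v (s + \<sigma>))) (x + r *\<^sub>R b)) (at r)"
        if "\<bar>r\<bar> < \<delta>" "\<sigma> \<in> {0..h}" for r \<sigma>
        by (rule has_real_derivative_shift, rule has_real_derivative_along_axis(1)[OF _ b],
            rule heatD(2)[OF heat b pos[OF that(2)] in_\<Omega>[OF that(1)]])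
      show "continuous_on {0..h} (\<lambda>\<sigma>. dir_deriv b (v (s + \<sigma>)) (x + r *\<^sub>R b))" if "\<bar>r\<bar> < \<delta>" for r
        by (rule comp[OF cont_g[OF b]]) (use in_\<Omega>[OF that] s in \<open>auto intro!: continuous_intros\<close>)
      show "continuous_on ({-\<delta><..<\<delta>} \<times> {0..h})
          (\<lambda>(r, \<sigma>). dir_deriv b (dir_deriv b (v (s + \<sigma>))) (x + r *\<^sub>R b))"
        unfolding split_beta
        by (rule comp[OF cont_h[OF b]]) (use in_\<Omega> s in \<open>auto intro!: continuous_intros\<close>)
    qed
    then show "((\<lambda>r. integral {0..h} (\<lambda>\<sigma>. dir_deriv b (v (s + \<sigma>)) (x + r *\<^sub>R b))) has_real_derivative
        integral {0..h} (\<lambda>\<sigma>. dir_deriv b (dir_deriv b (v (s + \<sigma>))) x)) (at 0)" by simp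
  }
  \<comment> \<open>Perturbations of absolute value below \<open>s\<close> keep all times positive,
    where the equation holds.\<close>
  have "((\<lambda>r. integral {0..h} (\<lambda>\<sigma>. v (s + r + \<sigma>) x)) has_real_derivative
      integral {0..h} (\<lambda>\<sigma>. \<Sum>b\<in>Basis. dir_deriv b (dir_deriv b (v (s + 0 + \<sigma>))) x)) (at 0)"
  proof (rule has_real_derivative_integral_param[OF s])
    show "((\<lambda>r. v (s + r + \<sigma>) x) has_real_derivative
        (\<Sum>b\<in>Basis. dir_deriv b (dir_deriv b (v (s + r + \<sigma>))) x)) (at r)"
      if "\<bar>r\<bar> < s" "\<sigma> \<in> {0..h}" for r \<sigma>
    proof -
      have "s + r + \<sigma> \<in> {0<..}" using that by auto
      from heatD(3)[OF heat this x] show ?thesis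
        using DERIV_shift[of "\<lambda>q. v q x" _ r "s + \<sigma>"] by (simp add: ac_simps)
    qed
    show "continuous_on {0..h} (\<lambda>\<sigma>. v (s + r + \<sigma>) x)" if "\<bar>r\<bar> < s" for r
      by (rule comp[OF cont_v]) (use x that in \<open>auto intro!: continuous_intros\<close>)
    show "continuous_on ({-s<..<s} \<times> {0..h})
        (\<lambda>(r, \<sigma>). \<Sum>b\<in>Basis. dir_deriv b (dir_deriv b (v (s + r + \<sigma>))) x)"
      unfolding split_beta
      by (intro continuous_on_sum comp[OF cont_h]) (use x in \<open>auto intro!: continuous_intros\<close>)
  qed
  then have "((\<lambda>q. integral {0..h} (\<lambda>\<sigma>. v (q + \<sigma>) x)) has_real_derivative
      integral {0..h} (\<lambda>\<sigma>. \<Sum>b\<in>Basis. dir_deriv b (dir_deriv b (v (s + \<sigma>))) x)) (at s)"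
    using DERIV_shift[of "\<lambda>q. integral {0..h} (\<lambda>\<sigma>. v (q + \<sigma>) x)" _ 0 s] by (simp add: ac_simps)
  moreover have "integral {0..h} (\<lambda>\<sigma>. \<Sum>b\<in>Basis. dir_deriv b (dir_deriv b (v (s + \<sigma>))) x)
      = (\<Sum>b\<in>Basis. integral {0..h} (\<lambda>\<sigma>. dir_deriv b (dir_deriv b (v (s + \<sigma>))) x))"
  proof (rule integral_sum[OF finite_Basis])
    show "(\<lambda>\<sigma>. dir_deriv b (dir_deriv b (v (s + \<sigma>))) x) integrable_on {0..h}" if "b \<in> Basis" for b
      by (intro integrable_continuous_real comp[OF cont_h[OF that]])
        (use x s in \<open>auto intro!: continuous_intros\<close>)
  qed
  ultimately show "((\<lambda>q. integral {0..h} (\<lambda>\<sigma>. v (q + \<sigma>) x)) has_real_derivative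
      (\<Sum>b\<in>Basis. integral {0..h} (\<lambda>\<sigma>. dir_deriv b (dir_deriv b (v (s + \<sigma>))) x))) (at s)"
    by simp
qed

text \<open>For \<open>s \<le> s'\<close> both windows are completed to \<open>{s..s' + h}\<close>
  by pieces of length \<open>s' - s\<close>, and each of the two pieces contributes at most
  \<open>C\<close> times its length.\<close>

lemma time_average_lipschitz:
  fixes f :: "real \<Rightarrow> real"
  assumes "continuous_on {0..T + h} f" "\<And>t. t \<in> {0..T + h} \<Longrightarrow> \<bar>f t\<bar> \<le> C"
    and "h \<ge> 0" "s \<in> {0..T}" "s' \<in> {0..T}"
  shows "\<bar>integral {0..h} (\<lambda>\<sigma>. f (s + \<sigma>)) - integral {0..h} (\<lambda>\<sigma>. f (s' + \<sigma>))\<bar> \<le> 2 * C * \<bar>s - s'\<bar>"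
proof -
  have int: "f integrable_on {a..b}" if "0 \<le> a" "b \<le> T + h" for a b
    by (intro integrable_continuous_real continuous_on_subset[OF assms(1)]) (use that in auto)
  have bound: "\<bar>integral {a..b} f\<bar> \<le> C * (b - a)" if "0 \<le> a" "a \<le> b" "b \<le> T + h" for a b
    using integral_bound[of a b f C] continuous_on_subset[OF assms(1), of "{a..b}"] assms(2) that
    by auto
  have shift: "integral {0..h} (\<lambda>\<sigma>. f (s + \<sigma>)) = integral {s..s + h} f" for s
    using integral_shift_Icc_real[of 0 h f s] by (simp add: o_def add.commute)
  have le: "\<bar>integral {s..s + h} f - integral {s'..s' + h} f\<bar> \<le> 2 * C * (s' - s)"
    if "0 \<le> s" "s \<le> s'" "s' \<le> T" for s s'
  proof -
    have "integral {s..s'} f + integral {s'..s' + h} f = integral {s..s' + h} f"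
      by (rule Henstock_Kurzweil_Integration.integral_combine) (use that assms(3) in \<open>auto intro!: int\<close>)
    moreover have "integral {s..s + h} f + integral {s + h..s' + h} f = integral {s..s' + h} f"
      by (rule Henstock_Kurzweil_Integration.integral_combine) (use that assms(3) in \<open>auto intro!: int\<close>)
    ultimately show ?thesis
      using bound[of s s'] bound[of "s + h" "s' + h"] that assms(3) by (simp add: algebra_simps)
  qed
  show ?thesis
    unfolding shift using le[of s s'] le[of s' s] assms(4,5) by (cases "s \<le> s'") auto
qed

text \<open>Time averages are uniformly Lipschitz in time, so limits at fixed times become joint limits.\<close>

lemma time_average_boundary_bound:
  fixes v :: "real \<Rightarrow> 'a::euclidean_space \<Rightarrow> real"
  assumes "open \<Omega>" and cont: "continuous_on ({0..T + h} \<times> \<Omega>) (\<lambda>(t, x). v t x)"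
    and C: "\<And>t x. t \<in> {0..T + h} \<Longrightarrow> x \<in> \<Omega> \<Longrightarrow> \<bar>v t x\<bar> \<le> C"
    and M: "\<And>t e. t \<in> {0<..T + h} \<Longrightarrow> e > 0 \<Longrightarrow> \<forall>\<^sub>F x in at y within \<Omega>. \<bar>v t x\<bar> < M + e"
    and h: "h > 0" and s: "s \<in> {0<..T}" and y: "y \<in> frontier \<Omega>" and e: "e > 0"
  shows "\<forall>\<^sub>F z in at (s, y) within {0<..T} \<times> \<Omega>.
      \<bar>integral {0..h} (\<lambda>\<sigma>. v (fst z + \<sigma>) (snd z))\<bar> < h * M + e"
proof -
  define V where "V s x = integral {0..h} (\<lambda>\<sigma>. v (s + \<sigma>) x)" for s x
  have cont_t: "continuous_on {0..T + h} (\<lambda>t. v t x)" if "x \<in> \<Omega>" for x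
    by (rule continuous_on_compose2[OF cont[unfolded split_beta],
          where f = "\<lambda>t. (t, x)", unfolded fst_conv snd_conv])
      (use that in \<open>auto intro!: continuous_intros\<close>)
  have cont_\<sigma>: "continuous_on {0..h} (\<lambda>\<sigma>. v (s + \<sigma>) x)" if "x \<in> \<Omega>" for x
    by (rule continuous_on_compose2[OF cont_t[OF that]]) (use s in \<open>auto intro!: continuous_intros\<close>)
  have "\<forall>\<^sub>F x in at y within \<Omega>. \<bar>V s x\<bar> < h * M + e / 2"
  proof (rule sequentially_imp_eventually_within, intro allI impI, elim conjE)
    fix X assume X: "\<forall>n. X n \<in> \<Omega> \<and> X n \<noteq> y" "X \<longlonglongrightarrow> y"
    \<comment> \<open>Values of \<open>v\<close> need not converge at the boundary. Their absolute
      values, truncated below at \<open>M\<close>, do converge, namely to \<open>M\<close>, which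
      makes dominated convergence applicable.\<close>
    define q where "q n \<sigma> = max \<bar>v (s + \<sigma>) (X n)\<bar> M" for n \<sigma>
    have X\<Omega>: "X n \<in> \<Omega>" for n using X by blast
    have lim_X: "filterlim X (at y within \<Omega>) sequentially"
      unfolding filterlim_at using X by simp
    have contq: "continuous_on {0..h} (q n)" for n
      unfolding q_def by (intro continuous_intros cont_\<sigma>[OF X\<Omega>])
    have "(\<lambda>n. integral {0..h} (q n)) \<longlonglongrightarrow> integral {0..h} (\<lambda>\<sigma>. M)"
    proof (rule dominated_convergence(2))
      show "q n integrable_on {0..h}" for n by (rule integrable_continuous_real[OF contq])
      show "(\<lambda>\<sigma>. max C \<bar>M\<bar>) integrable_on {0..h}" by (rule integrable_const_ivl)
      show "norm (q n \<sigma>) \<le> max C \<bar>M\<bar>" if "\<sigma> \<in> {0..h}" for n \<sigma>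
        using C[of "s + \<sigma>" "X n"] X\<Omega> s that by (auto simp: q_def)
      show "(\<lambda>n. q n \<sigma>) \<longlonglongrightarrow> M" if "\<sigma> \<in> {0..h}" for \<sigma>
      proof (rule order_tendstoI)
        fix a assume "a < M"
        then show "\<forall>\<^sub>F n in sequentially. a < q n \<sigma>" by (simp add: q_def less_max_iff_disj)
      next
        fix a assume a: "M < a"
        have "s + \<sigma> \<in> {0<..T + h}" using s that by auto
        from M[OF this, of "a - M"] a have "\<forall>\<^sub>F x in at y within \<Omega>. \<bar>v (s + \<sigma>) x\<bar> < a" by simp
        from eventually_compose_filterlim[OF this lim_X]
        show "\<forall>\<^sub>F n in sequentially. q n \<sigma> < a"
          by eventually_elim (simp add: q_def a)
      qed
    qed
    then have "(\<lambda>n. integral {0..h} (q n)) \<longlonglongrightarrow> h * M" using h by simp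
    then have "\<forall>\<^sub>F n in sequentially. integral {0..h} (q n) < h * M + e / 2"
      by (rule order_tendstoD(2)) (use e in simp)
    then show "\<forall>\<^sub>F n in sequentially. \<bar>V s (X n)\<bar> < h * M + e / 2"
    proof eventually_elim
      case (elim n)
      have "norm (V s (X n)) \<le> integral {0..h} (q n)"
        unfolding V_def
        by (rule integral_norm_bound_integral)
          (use contq cont_\<sigma>[OF X\<Omega>] in \<open>auto intro!: integrable_continuous_real simp: q_def\<close>)
      then show ?case using elim by simp
    qed
  qed
  then obtain d where d: "d > 0" "\<And>x. x \<in> \<Omega> \<Longrightarrow> x \<noteq> y \<Longrightarrow> dist x y < d \<Longrightarrow> \<bar>V s x\<bar> < h * M + e / 2"
    unfolding eventually_at by blast
  have "y \<notin> \<Omega>" using y assms(1) by (simp add: frontier_def interior_open)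
  have C0: "2 * \<bar>C\<bar> + 1 > 0" by simp
  \<comment> \<open>The second entry limits the Lipschitz error in time to \<open>e / 2\<close>; the
    added 1 covers \<open>C = 0\<close>.\<close>
  define d' where "d' = min d (e / 2 / (2 * \<bar>C\<bar> + 1))"
  have d': "d' > 0" using d e by (simp add: d'_def)
  show ?thesis
    unfolding eventually_at V_def[symmetric]
  proof (intro exI[of _ d'] conjI d' ballI impI)
    fix z assume z: "z \<in> {0<..T} \<times> \<Omega>" "z \<noteq> (s, y) \<and> dist z (s, y) < d'"
    obtain s' x where sx: "z = (s', x)" by fastforce
    have s': "s' \<in> {0<..T}" and x: "x \<in> \<Omega>" using z sx by auto
    have dist: "dist s' s < d'" "dist x y < d'"
      using z(2) dist_fst_le[of z "(s, y)"] dist_snd_le[of z "(s, y)"] by (auto simp: sx)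
    have "\<bar>V s' x - V s x\<bar> \<le> 2 * C * \<bar>s' - s\<bar>"
      unfolding V_def
      by (rule time_average_lipschitz[OF cont_t[OF x] C[OF _ x]]) (use h s s' in auto)
    also have "\<dots> \<le> (2 * \<bar>C\<bar> + 1) * \<bar>s' - s\<bar>" by (intro mult_right_mono) auto
    also have "\<dots> \<le> (2 * \<bar>C\<bar> + 1) * (e / 2 / (2 * \<bar>C\<bar> + 1))"
      using dist(1) by (intro mult_left_mono) (auto simp: d'_def dist_real_def)
    also have "\<dots> = e / 2"
      using C0 by (metis less_irrefl nonzero_mult_div_cancel_left times_divide_eq_right)
    finally have "\<bar>V s' x - V s x\<bar> \<le> e / 2" .
    moreover have "\<bar>V s x\<bar> < h * M + e / 2"
      using d(2)[OF x] dist(2) \<open>y \<notin> \<Omega>\<close> x by (auto simp: d'_def)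
    ultimately have "\<bar>V s' x\<bar> < h * M + e" by linarith
    then show "\<bar>V (fst z) (snd z)\<bar> < h * M + e" by (simp add: sx)
  qed
qed

section \<open>Comparison with the Dirichlet heat semigroup\<close>

lemma time_average_limit:
  fixes f :: "real \<Rightarrow> real"
  assumes "continuous_on {0..T} f" "\<tau> > 0" "s \<ge> 0" "s + \<tau> \<le> T"
  shows "(\<lambda>n. integral {0..\<tau> / Suc n} (\<lambda>\<sigma>. f (s + \<sigma>)) / (\<tau> / Suc n)) \<longlonglongrightarrow> f s"
proof (rule LIMSEQ_I)
  fix e :: real assume e: "e > 0"
  have "s \<in> {0..T}" using assms by auto
  then obtain d where d: "d > 0" "\<And>q. q \<in> {0..T} \<Longrightarrow> dist q s < d \<Longrightarrow> dist (f q) (f s) < e / 2"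
    using assms(1) e unfolding continuous_on_iff by (meson half_gt_zero)
  have "(\<lambda>n. \<tau> / Suc n) \<longlonglongrightarrow> 0" by (rule LIMSEQ_Suc[OF lim_const_over_n])
  then have "\<forall>\<^sub>F n in sequentially. \<tau> / Suc n < d" by (rule order_tendstoD(2)) (rule d(1))
  then obtain N where N: "\<And>n. n \<ge> N \<Longrightarrow> \<tau> / Suc n < d" by (auto simp: eventually_sequentially)
  have "norm (integral {0..\<tau> / Suc n} (\<lambda>\<sigma>. f (s + \<sigma>)) / (\<tau> / Suc n) - f s) < e" if n: "n \<ge> N" for n
  proof -
    define h where "h = \<tau> / Suc n"
    have h: "h > 0" "h \<le> \<tau>" "h < d"
      using assms(2) N[OF n] by (auto simp: h_def field_simps)
    have cont: "continuous_on {0..h} (\<lambda>\<sigma>. f (s + \<sigma>))"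
      by (rule continuous_on_compose2[OF assms(1)]) (use assms h in \<open>auto intro!: continuous_intros\<close>)
    have "norm (integral {0..h} (\<lambda>\<sigma>. f (s + \<sigma>) - f s)) \<le> e / 2 * (h - 0)"
    proof (rule integral_bound)
      show "continuous_on {0..h} (\<lambda>\<sigma>. f (s + \<sigma>) - f s)" by (intro continuous_intros cont)
      show "norm (f (s + \<sigma>) - f s) \<le> e / 2" if "\<sigma> \<in> {0..h}" for \<sigma>
        using d(2)[of "s + \<sigma>"] that assms h by (auto simp: dist_real_def)
    qed (use h in simp)
    moreover have "integral {0..h} (\<lambda>\<sigma>. f (s + \<sigma>) - f s) = integral {0..h} (\<lambda>\<sigma>. f (s + \<sigma>)) - h * f s"
      using h by (subst integral_diff) (auto intro!: integrable_continuous_real cont)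
    ultimately have "\<bar>integral {0..h} (\<lambda>\<sigma>. f (s + \<sigma>)) - h * f s\<bar> \<le> e / 2 * h" by simp
    moreover have "integral {0..h} (\<lambda>\<sigma>. f (s + \<sigma>)) / h - f s = (integral {0..h} (\<lambda>\<sigma>. f (s + \<sigma>)) - h * f s) / h"
      using h by (simp add: field_simps)
    ultimately have "\<bar>integral {0..h} (\<lambda>\<sigma>. f (s + \<sigma>)) / h - f s\<bar> \<le> e / 2"
      using h by (simp add: abs_divide divide_le_eq)
    then show ?thesis using e by (simp add: h_def)
  qed
  then show "\<exists>N. \<forall>n\<ge>N. norm (integral {0..\<tau> / Suc n} (\<lambda>\<sigma>. f (s + \<sigma>)) / (\<tau> / Suc n) - f s) < e" by blast
qed

lemma set_integral_kernel_limit: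
  fixes \<Omega> :: "'a::euclidean_space set" and k :: "'a \<Rightarrow> real"
  assumes "open \<Omega>" and k: "set_integrable lebesgue \<Omega> k"
    and cont: "\<And>n. continuous_on \<Omega> (f n)" "continuous_on \<Omega> F"
    and bound: "\<And>n x. x \<in> \<Omega> \<Longrightarrow> \<bar>f n x\<bar> \<le> C"
    and lim: "\<And>x. x \<in> \<Omega> \<Longrightarrow> (\<lambda>n. f n x) \<longlonglongrightarrow> F x"
  shows "(\<lambda>n. LINT y:\<Omega>|lebesgue. k y * f n y) \<longlonglongrightarrow> (LINT y:\<Omega>|lebesgue. k y * F y)"
  unfolding set_lebesgue_integral_def
proof (rule integral_dominated_convergence)
  have int: "integrable lebesgue (\<lambda>y. indicator \<Omega> y *\<^sub>R k y)" using k by (simp add: set_integrable_def)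
  have meas: "(\<lambda>y. indicator \<Omega> y *\<^sub>R (k y * F y)) \<in> borel_measurable lebesgue"
    if "continuous_on \<Omega> F" for F :: "'a \<Rightarrow> real"
  proof -
    have "(\<lambda>y. indicator \<Omega> y *\<^sub>R F y) \<in> borel_measurable borel"
      using assms(1) that by (intro borel_measurable_continuous_on_indicator) auto
    then have "(\<lambda>y. indicator \<Omega> y *\<^sub>R F y) \<in> borel_measurable lebesgue"
      by (intro measurable_completion) simp
    with borel_measurable_integrable[OF int]
    have "(\<lambda>y. (indicator \<Omega> y *\<^sub>R k y) * (indicator \<Omega> y *\<^sub>R F y)) \<in> borel_measurable lebesgue"
      by (rule borel_measurable_times)
    moreover have "(\<lambda>y. (indicator \<Omega> y *\<^sub>R k y) * (indicator \<Omega> y *\<^sub>R F y))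
        = (\<lambda>y. indicator \<Omega> y *\<^sub>R (k y * F y))"
      by (auto simp: indicator_def)
    ultimately show ?thesis by simp
  qed
  show "(\<lambda>y. indicator \<Omega> y *\<^sub>R (k y * F y)) \<in> borel_measurable lebesgue"
    "\<And>n. (\<lambda>y. indicator \<Omega> y *\<^sub>R (k y * f n y)) \<in> borel_measurable lebesgue"
    by (rule meas, rule cont)+
  show "integrable lebesgue (\<lambda>y. \<bar>C\<bar> * norm (indicator \<Omega> y *\<^sub>R k y))"
    by (intro integrable_mult_right integrable_norm int)
  show "AE y in lebesgue. (\<lambda>n. indicator \<Omega> y *\<^sub>R (k y * f n y)) \<longlonglongrightarrow> indicator \<Omega> y *\<^sub>R (k y * F y)"
    using lim by (intro AE_I2) (auto simp: indicator_def intro!: tendsto_intros)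
  show "AE y in lebesgue. norm (indicator \<Omega> y *\<^sub>R (k y * f n y)) \<le> \<bar>C\<bar> * norm (indicator \<Omega> y *\<^sub>R k y)" for n
  proof (intro AE_I2)
    fix y
    have "y \<in> \<Omega> \<Longrightarrow> \<bar>k y\<bar> * \<bar>f n y\<bar> \<le> \<bar>k y\<bar> * \<bar>C\<bar>"
      using bound[of y n] by (intro mult_left_mono) auto
    then show "norm (indicator \<Omega> y *\<^sub>R (k y * f n y)) \<le> \<bar>C\<bar> * norm (indicator \<Omega> y *\<^sub>R k y)"
      by (auto simp: indicator_def abs_mult mult.commute)
  qed
qed

text \<open>Spelled as in the last clause of \<open>dirichlet_heat_kernel\<close>, so that this
  clause applies verbatim; the case distinction makes the initial value exact at
  \<open>t = 0\<close>.\<close>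

definition heat_semigroup ::
    "'a::euclidean_space set \<Rightarrow> (real \<Rightarrow> 'a \<Rightarrow> 'a \<Rightarrow> real) \<Rightarrow> ('a \<Rightarrow> real) \<Rightarrow> real \<Rightarrow> 'a \<Rightarrow> real" where
  "heat_semigroup \<Omega> p h = (\<lambda>t x. if t = 0 then h x else (LINT y:\<Omega>|lebesgue. p t x y * h y))"

lemma heat_semigroup_solution:
  assumes "dirichlet_heat_kernel \<Omega> p" "continuous_on \<Omega> h" "bounded (h ` \<Omega>)"
  shows "dirichlet_heat_solution \<Omega> h (\<lambda>_. 0) (heat_semigroup \<Omega> p h)"
  using assms unfolding dirichlet_heat_kernel_def heat_semigroup_def by blast

lemma dirichlet_heat_solution_continuous:
  assumes "open \<Omega>" "dirichlet_heat_solution \<Omega> f g u"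
  shows "continuous_on ({0..} \<times> \<Omega>) (\<lambda>(t, x). u t x)"
proof -
  have "frontier \<Omega> \<inter> \<Omega> = {}" using assms(1) by (auto simp: frontier_def interior_open)
  then have "{0..} \<times> \<Omega> \<subseteq> {0..} \<times> closure \<Omega> - {0} \<times> frontier \<Omega>"
    using closure_subset[of \<Omega>] by auto
  then show ?thesis
    using assms(2) continuous_on_subset unfolding dirichlet_heat_solution_def by blast
qed

text \<open>Off the corner a solution is continuous on the closed cylinder, so zero boundary data
  become a limit in space and time jointly, as the maximum principle requires.\<close>

lemma heat_semigroup_vanishes_at_boundary:
  assumes "dirichlet_heat_solution \<Omega> h (\<lambda>_. 0) P" "s \<in> {0<..T}" "y \<in> frontier \<Omega>"
  shows "((\<lambda>z. P (fst z) (snd z)) \<longlongrightarrow> 0) (at (s, y) within {0<..T} \<times> \<Omega>)"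
proof -
  let ?K = "{0..} \<times> closure \<Omega> - {0} \<times> frontier \<Omega>"
  have cont: "continuous_on ?K (\<lambda>z. P (fst z) (snd z))"
    using assms(1) unfolding dirichlet_heat_solution_def split_beta by blast
  have "(s, y) \<in> ?K" using assms(2,3) by (auto simp: frontier_def)
  from bspec[OF cont[unfolded continuous_on_def] this]
  have "((\<lambda>z. P (fst z) (snd z)) \<longlongrightarrow> P s y) (at (s, y) within ?K)" by simp
  then have "((\<lambda>z. P (fst z) (snd z)) \<longlongrightarrow> P s y) (at (s, y) within {0<..T} \<times> \<Omega>)"
    by (rule tendsto_within_subset) (use closure_subset[of \<Omega>] in auto)
  moreover have "P s y = 0" using assms unfolding dirichlet_heat_solution_def by auto
  ultimately show ?thesis by simp
qed

text \<open>The comparison for the time averages \<open>V\<close> of \<open>v\<close>: both \<open>V\<close> minus its Dirichlet evolution and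
  \<open>M\<close> times one minus the evolution of one vanish at time zero.\<close>

lemma time_average_comparison:
  fixes \<Omega> :: "'a::euclidean_space set"
  assumes \<Omega>: "open \<Omega>" "bounded \<Omega>" "negligible (frontier \<Omega>)"
    and p: "dirichlet_heat_kernel \<Omega> p"
    and heat: "heat_solution {0<..} \<Omega> v"
    and cont: "continuous_on ({0..T + h} \<times> \<Omega>) (\<lambda>(t, x). v t x)"
    and C: "\<And>t x. t \<in> {0..T + h} \<Longrightarrow> x \<in> \<Omega> \<Longrightarrow> \<bar>v t x\<bar> \<le> C"
    and M: "\<And>t y e. t \<in> {0<..T + h} \<Longrightarrow> y \<in> frontier \<Omega> \<Longrightarrow> e > 0 \<Longrightarrow>
      \<forall>\<^sub>F x in at y within \<Omega>. \<bar>v t x\<bar> < M + e"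
    and h: "h > 0" and T: "T > 0" and x: "x \<in> \<Omega>"
  defines "V \<equiv> \<lambda>s x. integral {0..h} (\<lambda>\<sigma>. v (s + \<sigma>) x)"
  shows "continuous_on \<Omega> (V 0)" and "\<And>x. x \<in> \<Omega> \<Longrightarrow> \<bar>V 0 x\<bar> \<le> C * h"
    and "\<bar>V T x - heat_semigroup \<Omega> p (V 0) T x\<bar> \<le> h * M * (1 - heat_semigroup \<Omega> p (\<lambda>_. 1) T x)"
proof -
  have cont_v: "continuous_on (({0..T} \<times> \<Omega>) \<times> cbox 0 h) (\<lambda>(z, \<sigma>). v (fst z + \<sigma>) (snd z))"
    unfolding split_beta
    by (rule continuous_on_compose2[OF cont[unfolded split_beta],
          where f = "\<lambda>z. (fst (fst z) + snd z, snd (fst z))", unfolded fst_conv snd_conv])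
      (auto intro!: continuous_intros)
  have contV: "continuous_on ({0..T} \<times> \<Omega>) (\<lambda>z. V (fst z) (snd z))"
    using integral_continuous_on_param[OF cont_v] by (simp add: V_def)
  show contV0: "continuous_on \<Omega> (V 0)"
    by (rule continuous_on_compose2[OF contV, where f = "\<lambda>x. (0, x)", unfolded fst_conv snd_conv])
      (use T in \<open>auto intro!: continuous_intros\<close>)
  have boundV: "\<bar>V s x\<bar> \<le> C * h" if "s \<in> {0..T}" "x \<in> \<Omega>" for s x
  proof -
    have "norm (V s x) \<le> C * (h - 0)"
      unfolding V_def
    proof (rule integral_bound)
      show "continuous_on {0..h} (\<lambda>\<sigma>. v (s + \<sigma>) x)"
        by (rule continuous_on_compose2[OF cont[unfolded split_beta],
              where f = "\<lambda>\<sigma>. (s + \<sigma>, x)", unfolded fst_conv snd_conv])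
          (use that in \<open>auto intro!: continuous_intros\<close>)
      show "norm (v (s + \<sigma>) x) \<le> C" if "\<sigma> \<in> {0..h}" for \<sigma>
        using C[of "s + \<sigma>" x] \<open>s \<in> {0..T}\<close> \<open>x \<in> \<Omega>\<close> that by auto
    qed (use h in simp)
    then show ?thesis by simp
  qed
  then show boundV0: "\<bar>V 0 x\<bar> \<le> C * h" if "x \<in> \<Omega>" for x using that T by simp
  have "bounded (V 0 ` \<Omega>)"
    unfolding bounded_iff using boundV0 by (intro exI[of _ "C * h"]) auto
  define P where "P = heat_semigroup \<Omega> p (V 0)"
  define Q where "Q = heat_semigroup \<Omega> p (\<lambda>_. 1)"
  have P: "dirichlet_heat_solution \<Omega> (V 0) (\<lambda>_. 0) P"
    unfolding P_def by (rule heat_semigroup_solution[OF p contV0 \<open>bounded (V 0 ` \<Omega>)\<close>])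
  have Q: "dirichlet_heat_solution \<Omega> (\<lambda>_. 1) (\<lambda>_. 0) Q"
    unfolding Q_def by (rule heat_semigroup_solution[OF p]) (auto simp: bounded_iff)
  have sol: "axis_heat {0<..} \<Omega> P" "axis_heat {0<..} \<Omega> Q"
    using P Q heat_imp_axis_heat[OF solves_heat_imp_heat_solution[OF \<Omega>(1)]]
    unfolding dirichlet_heat_solution_def by blast+
  \<comment> \<open>The sign \<theta> is 1 or -1, which yields both halves of the absolute value
    from one argument.\<close>
  have main: "\<theta> * V T x - \<theta> * P T x + h * M * Q T x - h * M \<le> 0" if \<theta>: "\<bar>\<theta>\<bar> = 1" for \<theta>
  proof -
    obtain B where B: "\<And>t x. t \<in> {0..T} \<Longrightarrow> x \<in> \<Omega> \<Longrightarrow> \<bar>P t x\<bar> \<le> B"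
    proof -
      have "bounded ((\<lambda>(t, x). P t x) ` ({0..T} \<times> \<Omega>))"
        using P unfolding dirichlet_heat_solution_def by blast
      then show thesis using that unfolding bounded_iff by fastforce
    qed
    obtain B' where B': "\<And>t x. t \<in> {0..T} \<Longrightarrow> x \<in> \<Omega> \<Longrightarrow> \<bar>Q t x\<bar> \<le> B'"
    proof -
      have "bounded ((\<lambda>(t, x). Q t x) ` ({0..T} \<times> \<Omega>))"
        using Q unfolding dirichlet_heat_solution_def by blast
      then show thesis using that unfolding bounded_iff by fastforce
    qed
    have abs_\<theta>: "\<theta> * a \<le> \<bar>a\<bar>" "- (\<theta> * a) \<le> \<bar>a\<bar>" for a
    proof -
      have "\<bar>\<theta> * a\<bar> = \<bar>a\<bar>" using \<theta> by (simp add: abs_mult)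
      then show "\<theta> * a \<le> \<bar>a\<bar>" "- (\<theta> * a) \<le> \<bar>a\<bar>" by linarith+
    qed
    show ?thesis
    \<comment> \<open>At time 0 the terms cancel in pairs, as \<open>P\<close> is \<open>V\<close>
      and \<open>Q\<close> is 1 there. At the lateral boundary \<open>P\<close> and \<open>Q\<close>
      tend to 0 while the absolute value of \<open>V\<close> is eventually below any number above
      \<open>h * M\<close>. The constant adds up the bounds of the four terms.\<close>
    proof (rule maximum_principle_except_corner[OF \<Omega>, where T = T
          and Z = "\<lambda>s x. \<theta> * V s x - \<theta> * P s x + h * M * Q s x - h * M"
          and C = "C * h + B + \<bar>h * M\<bar> * B' + \<bar>h * M\<bar>"])
      have "axis_heat {0<..} \<Omega> (\<lambda>s x. 1 * (\<theta> * V s x + (- \<theta>) * P s x) + 1 * (h * M * Q s x + (- h * M) * 1))"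
        unfolding V_def
        by (intro axis_heat_lincomb axis_heat_const sol axis_heat_time_average[OF \<Omega>(1) heat])
      then have "axis_heat {0<..T} \<Omega> (\<lambda>s x. 1 * (\<theta> * V s x + (- \<theta>) * P s x) + 1 * (h * M * Q s x + (- h * M) * 1))"
        by (rule axis_heat_subset) auto
      then show "axis_heat {0<..T} \<Omega> (\<lambda>s x. \<theta> * V s x - \<theta> * P s x + h * M * Q s x - h * M)"
        by (simp add: algebra_simps)
      have "continuous_on ({0..T} \<times> \<Omega>) (\<lambda>z. F (fst z) (snd z))"
        if "dirichlet_heat_solution \<Omega> f g F" for f g F
        using dirichlet_heat_solution_continuous[OF \<Omega>(1) that] unfolding split_beta
        by (rule continuous_on_subset) auto
      then show "continuous_on ({0..T} \<times> \<Omega>) (\<lambda>(s, x). \<theta> * V s x - \<theta> * P s x + h * M * Q s x - h * M)"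
        unfolding split_beta using P Q by (intro continuous_intros contV) blast+
      show "\<theta> * V s x - \<theta> * P s x + h * M * Q s x - h * M \<le> C * h + B + \<bar>h * M\<bar> * B' + \<bar>h * M\<bar>"
        if "s \<in> {0<..T}" "x \<in> \<Omega>" for s x
      proof -
        have s: "s \<in> {0..T}" using that by simp
        have "h * M * Q s x \<le> \<bar>h * M\<bar> * \<bar>Q s x\<bar>" by (simp flip: abs_mult)
        also have "\<dots> \<le> \<bar>h * M\<bar> * B'" by (intro mult_left_mono B' s that) simp
        finally have "h * M * Q s x \<le> \<bar>h * M\<bar> * B'" .
        then show ?thesis
          using abs_\<theta>[of "V s x"] abs_\<theta>[of "P s x"] boundV[OF s that(2)] B[OF s that(2)] by linarith
      qed
      show "\<theta> * V 0 x - \<theta> * P 0 x + h * M * Q 0 x - h * M \<le> 0" if "x \<in> \<Omega>" for x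
        by (simp add: P_def Q_def heat_semigroup_def)
      show "\<forall>\<^sub>F z in at (s, y) within {0<..T} \<times> \<Omega>.
          \<theta> * V (fst z) (snd z) - \<theta> * P (fst z) (snd z) + h * M * Q (fst z) (snd z) - h * M \<le> e"
        if s: "s \<in> {0<..T}" and y: "y \<in> frontier \<Omega>" and e: "e > 0" for s y e
      proof -
        have "\<forall>\<^sub>F z in at (s, y) within {0<..T} \<times> \<Omega>. \<bar>V (fst z) (snd z)\<bar> < h * M + e / 2"
          unfolding V_def
          by (rule time_average_boundary_bound[OF \<Omega>(1) cont C _ h s y])
            (use M y e in auto)
        moreover have "((\<lambda>z. - \<theta> * P (fst z) (snd z) + h * M * Q (fst z) (snd z)) \<longlongrightarrow> - \<theta> * 0 + h * M * 0)
            (at (s, y) within {0<..T} \<times> \<Omega>)"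
          by (intro tendsto_intros heat_semigroup_vanishes_at_boundary[OF P s y]
              heat_semigroup_vanishes_at_boundary[OF Q s y])
        then have "\<forall>\<^sub>F z in at (s, y) within {0<..T} \<times> \<Omega>.
            - \<theta> * P (fst z) (snd z) + h * M * Q (fst z) (snd z) < e / 2"
          by (rule order_tendstoD(2)) (use e in simp)
        ultimately show ?thesis
        proof eventually_elim
          case (elim z)
          then show ?case using abs_\<theta>(1)[of "V (fst z) (snd z)"] by (simp add: algebra_simps)
        qed
      qed
      show "T \<in> {0<..T}" "x \<in> \<Omega>" using T x by auto
    qed
  qed
  from main[of 1] main[of "-1"]
  show "\<bar>V T x - heat_semigroup \<Omega> p (V 0) T x\<bar> \<le> h * M * (1 - heat_semigroup \<Omega> p (\<lambda>_. 1) T x)"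
    unfolding P_def Q_def by (simp add: algebra_simps abs_le_iff)
qed

text \<open>The comparison of averages is divided by \<open>h\<close>, and \<open>h\<close> tends to
  0. An average at time \<open>s\<close> looks ahead to \<open>s + h\<close>, which must not pass
  \<open>t\<close>; so times \<open>s < t\<close> come first and \<open>t\<close> itself follows by
  continuity in time.\<close>

lemma heat_comparison:
  fixes \<Omega> :: "'a::euclidean_space set"
  assumes \<Omega>: "open \<Omega>" "bounded \<Omega>" "negligible (frontier \<Omega>)"
    and p: "dirichlet_heat_kernel \<Omega> p"
    and heat: "heat_solution {0<..} \<Omega> v"
    and cont: "continuous_on ({0..t} \<times> \<Omega>) (\<lambda>(t, x). v t x)"
    and C: "\<And>s x. s \<in> {0..t} \<Longrightarrow> x \<in> \<Omega> \<Longrightarrow> \<bar>v s x\<bar> \<le> C"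
    and M: "\<And>s y e. s \<in> {0<..t} \<Longrightarrow> y \<in> frontier \<Omega> \<Longrightarrow> e > 0 \<Longrightarrow>
      \<forall>\<^sub>F x in at y within \<Omega>. \<bar>v s x\<bar> < M + e"
    and t: "t > 0" and x: "x \<in> \<Omega>"
  shows "\<bar>v t x - (LINT y:\<Omega>|lebesgue. p t x y * v 0 y)\<bar> \<le> M * (1 - (LINT y:\<Omega>|lebesgue. p t x y))"
proof -
  have cont_t: "continuous_on {0..t} (\<lambda>s. v s x)" if "x \<in> \<Omega>" for x
    by (rule continuous_on_compose2[OF cont[unfolded split_beta],
          where f = "\<lambda>s. (s, x)", unfolded fst_conv snd_conv])
      (use that in \<open>auto intro!: continuous_intros\<close>)
  have cont0: "continuous_on \<Omega> (v 0)"
    by (rule continuous_on_compose2[OF cont[unfolded split_beta],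
          where f = "\<lambda>x. (0, x)", unfolded fst_conv snd_conv])
      (use t in \<open>auto intro!: continuous_intros\<close>)
  define P where "P = heat_semigroup \<Omega> p (v 0)"
  define Q where "Q = heat_semigroup \<Omega> p (\<lambda>_. 1)"
  have "bounded (v 0 ` \<Omega>)" unfolding bounded_iff using C[of 0] t by auto
  then have P: "dirichlet_heat_solution \<Omega> (v 0) (\<lambda>_. 0) P"
    unfolding P_def by (intro heat_semigroup_solution[OF p cont0])
  have Q: "dirichlet_heat_solution \<Omega> (\<lambda>_. 1) (\<lambda>_. 0) Q"
    unfolding Q_def by (rule heat_semigroup_solution[OF p]) (auto simp: bounded_iff)
  have before: "\<bar>v s x - P s x\<bar> \<le> M * (1 - Q s x)" if s: "0 < s" "s < t" for s
  proof -
    define \<tau> where "\<tau> = t - s"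
    have \<tau>: "\<tau> > 0" using s by (simp add: \<tau>_def)
    define h where "h n = \<tau> / real (Suc n)" for n
    have h: "h n > 0" "h n \<le> \<tau>" for n using \<tau> by (auto simp: h_def field_simps)
    define V where "V n s x = integral {0..h n} (\<lambda>\<sigma>. v (s + \<sigma>) x)" for n s x
    have sub: "{0..s + h n} \<subseteq> {0..t}" "{0<..s + h n} \<subseteq> {0<..t}" for n
      using h(2)[of n] by (auto simp: \<tau>_def)
    have cont_n: "continuous_on ({0..s + h n} \<times> \<Omega>) (\<lambda>(t, x). v t x)" for n
      by (rule continuous_on_subset[OF cont]) (use sub(1) in blast)
    have C_n: "\<bar>v q x\<bar> \<le> C" if "q \<in> {0..s + h n}" "x \<in> \<Omega>" for q x n
      using C that sub(1) by blast
    have M_n: "\<forall>\<^sub>F x in at y within \<Omega>. \<bar>v q x\<bar> < M + e"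
      if "q \<in> {0<..s + h n}" "y \<in> frontier \<Omega>" "e > 0" for q y e n
      using M that sub(2) by blast
    have avg: "continuous_on \<Omega> (V n 0)" "\<And>y. y \<in> \<Omega> \<Longrightarrow> \<bar>V n 0 y\<bar> \<le> C * h n"
      "\<bar>V n s x - heat_semigroup \<Omega> p (V n 0) s x\<bar> \<le> h n * M * (1 - heat_semigroup \<Omega> p (\<lambda>_. 1) s x)" for n
      using time_average_comparison[OF \<Omega> p heat cont_n C_n[where n = n] M_n[where n = n] h(1) s(1) x]
      by (auto simp: V_def[abs_def])
    have lim: "(\<lambda>n. V n q y / h n) \<longlonglongrightarrow> v q y" if "y \<in> \<Omega>" "0 \<le> q" "q + \<tau> \<le> t" for q y
      unfolding V_def h_def by (rule time_average_limit[OF cont_t[OF that(1)] \<tau> that(2,3)])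
    \<comment> \<open>The initial datum of the comparison varies with \<open>n\<close>; after
      normalisation it is bounded by \<open>C\<close> and tends to \<open>v 0\<close> pointwise, so
      the kernel integrals converge too.\<close>
    have "(\<lambda>n. LINT y:\<Omega>|lebesgue. p s x y * (V n 0 y / h n)) \<longlonglongrightarrow> (LINT y:\<Omega>|lebesgue. p s x y * v 0 y)"
    proof (rule set_integral_kernel_limit[OF \<Omega>(1)])
      show "set_integrable lebesgue \<Omega> (p s x)"
        using p s x unfolding dirichlet_heat_kernel_def by blast
      show "continuous_on \<Omega> (\<lambda>y. V n 0 y / h n)" for n
        using avg(1)[of n] h(1)[of n] by (intro continuous_intros) auto
      show "\<bar>V n 0 y / h n\<bar> \<le> C" if "y \<in> \<Omega>" for n y
        using avg(2)[OF that, of n] h(1)[of n] by (simp add: abs_divide divide_le_eq)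
      show "(\<lambda>n. V n 0 y / h n) \<longlonglongrightarrow> v 0 y" if "y \<in> \<Omega>" for y
        by (rule lim[OF that]) (use s in \<open>auto simp: \<tau>_def\<close>)
    qed (rule cont0)
    moreover have "(LINT y:\<Omega>|lebesgue. p s x y * (V n 0 y / h n)) = heat_semigroup \<Omega> p (V n 0) s x / h n" for n
      using s by (simp add: heat_semigroup_def flip: set_integral_divide_zero)
    ultimately have "(\<lambda>n. heat_semigroup \<Omega> p (V n 0) s x / h n) \<longlonglongrightarrow> P s x"
      using s by (simp add: P_def heat_semigroup_def)
    then have "(\<lambda>n. \<bar>V n s x / h n - heat_semigroup \<Omega> p (V n 0) s x / h n\<bar>) \<longlonglongrightarrow> \<bar>v s x - P s x\<bar>"
      by (intro tendsto_intros lim[OF x]) (use s in \<open>auto simp: \<tau>_def\<close>)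
    moreover have "\<bar>V n s x / h n - heat_semigroup \<Omega> p (V n 0) s x / h n\<bar> \<le> M * (1 - Q s x)" for n
    proof -
      have "\<bar>V n s x - heat_semigroup \<Omega> p (V n 0) s x\<bar> \<le> h n * (M * (1 - Q s x))"
        using avg(3)[of n] by (simp add: Q_def mult.assoc)
      then show ?thesis
        using h(1)[of n] by (simp add: abs_divide divide_le_eq mult.commute flip: diff_divide_distrib)
    qed
    ultimately show ?thesis by (intro LIMSEQ_le_const2) auto
  qed
  have cont_sol: "continuous_on {0..t} (\<lambda>s. F s x)" if "dirichlet_heat_solution \<Omega> f g F" for f g F
    by (rule continuous_on_compose2[OF dirichlet_heat_solution_continuous[OF \<Omega>(1) that, unfolded split_beta],
          where f = "\<lambda>s. (s, x)", unfolded fst_conv snd_conv])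
      (use x in \<open>auto intro!: continuous_intros\<close>)
  have "\<bar>v t x - P t x\<bar> - M * (1 - Q t x) \<le> 0"
  proof (rule continuous_le_on_closure[where S = "{0<..<t}" and x = t])
    show "t \<in> closure {0<..<t}" using t by simp
    have "continuous_on {0..t} (\<lambda>s. \<bar>v s x - P s x\<bar> - M * (1 - Q s x))"
      by (intro continuous_intros cont_t[OF x] cont_sol[OF P] cont_sol[OF Q])
    then show "continuous_on (closure {0<..<t}) (\<lambda>s. \<bar>v s x - P s x\<bar> - M * (1 - Q s x))"
      using t by simp
    show "\<bar>v s x - P s x\<bar> - M * (1 - Q s x) \<le> 0" if "s \<in> {0<..<t}" for s
      using before[of s] that by simp
  qed
  then show ?thesis using t by (simp add: P_def Q_def heat_semigroup_def)
qed

text \<open>This keeps the extended real supremum finite. Nonnegativity has content: a supremum over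
  an empty frontier, or a \<open>Limsup\<close> along a trivial filter, would be minus infinity. A
  bounded nonempty \<Omega> has a frontier, and openness places its points outside \<Omega> but in
  the closure, so the filter is proper.\<close>

lemma boundary_norm_bounds:
  fixes \<Omega> :: "'a::euclidean_space set"
  assumes "open \<Omega>" "\<Omega> \<noteq> {}" "bounded \<Omega>" "\<And>x. x \<in> \<Omega> \<Longrightarrow> \<bar>h x\<bar> \<le> C"
  shows "0 \<le> boundary_norm \<Omega> h" "boundary_norm \<Omega> h \<le> ereal C"
proof -
  have "frontier \<Omega> \<noteq> {}" using assms(2,3) not_bounded_UNIV by (auto simp: frontier_eq_empty)
  then obtain y where y: "y \<in> frontier \<Omega>" by blast
  have "y \<in> closure \<Omega>" "y \<notin> \<Omega>" using y assms(1) by (auto simp: frontier_def interior_open)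
  then have "\<not> trivial_limit (at y within \<Omega>)"
    by (auto simp: trivial_limit_within closure_def)
  then have "0 \<le> Limsup (at y within \<Omega>) (\<lambda>x. ereal \<bar>h x\<bar>)"
    by (intro le_Limsup) auto
  then show "0 \<le> boundary_norm \<Omega> h"
    unfolding boundary_norm_def using y by (rule SUP_upper2[rotated])
  show "boundary_norm \<Omega> h \<le> ereal C"
    unfolding boundary_norm_def
    by (intro SUP_least Limsup_bounded) (auto simp: eventually_at_filter assms(4) intro!: always_eventually)
qed

theorem theorem1:
  fixes \<Omega> :: "'a::euclidean_space set"
    and f g :: "'a \<Rightarrow> real"
    and u :: "real \<Rightarrow> 'a \<Rightarrow> real"
    and p :: "real \<Rightarrow> 'a \<Rightarrow> 'a \<Rightarrow> real"
    and k :: nat and x\<^sub>0 \<nu> :: 'a and t :: real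
  assumes "bounded_C1_domain \<Omega>"
    and "k \<ge> 1"
    and "Ck_on k \<Omega> f" and "bounded (f ` \<Omega>)"
    and "x\<^sub>0 \<in> \<Omega>"
    and "norm \<nu> = 1"
    and "dirichlet_heat_solution \<Omega> f g u"
    and "dirichlet_heat_kernel \<Omega> p"
    and "t > 0"
    and "bounded ((\<lambda>(s, x). dir_deriv_iter k \<nu> (u s) x) ` ({0..t} \<times> \<Omega>))"
  shows "ereal \<bar>dir_deriv_iter k \<nu> (u t) x\<^sub>0
                - (LINT y:\<Omega>|lebesgue. p t x\<^sub>0 y * dir_deriv_iter k \<nu> f y)\<bar>
         \<le> ereal (1 - (LINT y:\<Omega>|lebesgue. p t x\<^sub>0 y)) *
           (SUP s\<in>{0..t}. boundary_norm \<Omega> (dir_deriv_iter k \<nu> (u s)))"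
proof -
  have \<Omega>: "open \<Omega>" "\<Omega> \<noteq> {}" "bounded \<Omega>" "negligible (frontier \<Omega>)"
    using assms(1) C1_boundary_frontier_negligible unfolding bounded_C1_domain_def by blast+
  define v where "v s = dir_deriv_iter k \<nu> (u s)" for s
  obtain C where C: "\<And>s x. s \<in> {0..t} \<Longrightarrow> x \<in> \<Omega> \<Longrightarrow> \<bar>v s x\<bar> \<le> C"
    using assms(10) unfolding v_def bounded_iff by fastforce
  have heat_u: "heat_solution {0<..} \<Omega> u"
    using assms(7) solves_heat_imp_heat_solution[OF \<Omega>(1)] unfolding dirichlet_heat_solution_def by blast
  have heat_v: "heat_solution {0<..} \<Omega> v"
    unfolding v_def by (rule heat_solution_dir_deriv_iter[OF _ \<Omega>(1) heat_u]) simp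
  have u0: "f x = u 0 x" if "x \<in> \<Omega>" for x
    using assms(7) that unfolding dirichlet_heat_solution_def by simp
  have cont_v: "continuous_on ({0..t} \<times> \<Omega>) (\<lambda>(s, x). v s x)"
    unfolding v_def
  proof (rule dir_deriv_iter_continuous_to_initial_time[OF \<Omega>(1) heat_u])
    show "continuous_on ({0..} \<times> \<Omega>) (\<lambda>(t, x). u t x)"
      by (rule dirichlet_heat_solution_continuous[OF \<Omega>(1) assms(7)])
    show "Ck_on k \<Omega> (u 0)" by (rule Ck_on_cong[OF \<Omega>(1) assms(3) u0])
    show "\<bar>dir_deriv_iter k \<nu> (u s) x\<bar> \<le> C" if "s \<in> {0<..t}" "x \<in> \<Omega>" for s x
      using C[of s x] that by (simp add: v_def)
  qed (rule assms(6))
  define S where "S = (SUP s\<in>{0..t}. boundary_norm \<Omega> (v s))"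
  have norms: "0 \<le> boundary_norm \<Omega> (v s)" "boundary_norm \<Omega> (v s) \<le> ereal C" if "s \<in> {0..t}" for s
    using boundary_norm_bounds[OF \<Omega>(1-3) C[OF that]] by auto
  have 0: "(0::real) \<in> {0..t}" using assms(9) by simp
  have "0 \<le> S" unfolding S_def by (rule SUP_upper2[OF 0]) (rule norms(1)[OF 0])
  moreover have "S \<le> ereal C" unfolding S_def by (intro SUP_least norms(2))
  \<comment> \<open>Being between 0 and \<open>C\<close>, the supremum is a real number, and the
    claim becomes an inequality between reals.\<close>
  ultimately obtain M where M: "S = ereal M" by (cases S) auto
  have "\<bar>v t x\<^sub>0 - (LINT y:\<Omega>|lebesgue. p t x\<^sub>0 y * v 0 y)\<bar> \<le> M * (1 - (LINT y:\<Omega>|lebesgue. p t x\<^sub>0 y))"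
  proof (rule heat_comparison[OF \<Omega>(1,3,4) assms(8) heat_v cont_v C])
    show "\<forall>\<^sub>F x in at y within \<Omega>. \<bar>v s x\<bar> < M + e"
      if s: "s \<in> {0<..t}" and y: "y \<in> frontier \<Omega>" and e: "e > 0" for s y e
    proof -
      have "Limsup (at y within \<Omega>) (\<lambda>x. ereal \<bar>v s x\<bar>) \<le> boundary_norm \<Omega> (v s)"
        unfolding boundary_norm_def using y by (rule SUP_upper)
      also have "\<dots> \<le> S" unfolding S_def using s by (intro SUP_upper) auto
      \<comment> \<open>The slack \<open>e\<close> makes the inequality strict, which is what turns
        an upper limit into an eventual bound.\<close>
      also have "\<dots> < ereal (M + e)" using e by (simp add: M)
      finally have "\<forall>\<^sub>F x in at y within \<Omega>. ereal \<bar>v s x\<bar> < ereal (M + e)" by (rule Limsup_lessD)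
      then show ?thesis by simp
    qed
  qed (use assms in auto)
  \<comment> \<open>\<open>v 0\<close> is built from \<open>u 0\<close>, known to agree with
    \<open>f\<close> on \<Omega>; by openness the iterated derivatives agree there as well.\<close>
  moreover have "(LINT y:\<Omega>|lebesgue. p t x\<^sub>0 y * v 0 y)
      = (LINT y:\<Omega>|lebesgue. p t x\<^sub>0 y * dir_deriv_iter k \<nu> f y)"
  proof (rule set_lebesgue_integral_cong)
    show "\<Omega> \<in> sets lebesgue" using \<Omega>(1) by (simp add: borel_open)
    show "\<forall>y. y \<in> \<Omega> \<longrightarrow> p t x\<^sub>0 y * v 0 y = p t x\<^sub>0 y * dir_deriv_iter k \<nu> f y"
      using dir_deriv_iter_cong[OF \<Omega>(1) _ u0] by (simp add: v_def)
  qed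
  ultimately show ?thesis using M by (simp add: v_def S_def mult.commute)
qed

end
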